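(* Let $(G,+)$ be a finite abelian group, $n$ a positive integer and $W=G\wr S_n$. For each $\underline\sigma\in\Sigma_n(G)$ and each $\underline\lambda\in\Lambda_n(G)$ we have $\langle \xi_{H_{\underline\sigma}},\chi^{\underline\lambda}\rangle\neq 0$ if and only if $\underline\sigma\to\underline\lambda$.
   Context: $[n]=\{1,\dots,n\}$. $W=G\wr S_n$ consists of pairs $(g,\pi)$, $g\in G^n$, $\pi\in S_n$, with $(f,\pi)(g,\sigma)=(f+g^\pi,\pi\sigma)$, $g^\pi=(g_{\pi^{-1}(1)},\dots,g_{\pi^{-1}(n)})$. Partitions: weakly decreasing sequences of nonnegative integers with finite sum; $\mathrm{Par}$ is the set of all partitions; $\emptyset$ the partition of 0; for partitions $\lambda,\mu$ (possibly of different sizes) $\lambda\trianglelefteq\mu$ means $\sum_{i\le m}\lambda_i\le\sum_{i\le m}\mu_i$ for all $m\ge 1$. $\Lambda_n(G)$ is the set of maps $\underline\lambda:G\to\mathrm{Par}$ with $\sum_g|\underline\lambda(g)|=n$; $\Sigma_n(G)$ is the set of maps $\underline\sigma$ from the set of subgroups of $G$ to $\mathrm{Par}$ with $\sum_{U\le G}|\underline\sigma(U)|=n$. Tabloids: for $\underline\sigma\in\Sigma_n(G)$ a $\underline\sigma$-tableau consists of, for each $U\le G$, the Young diagram of $\underline\sigma(U)$ with boxes filled by pairs $(c,i)$, $c\in G/U$, $i\in[n]$, all $i$ pairwise distinct; row-equivalence classes are $\underline\sigma$-tabloids; $W$ acts entrywise by $(g,\pi)\cdot(c,i)=(c+g_{\pi(i)},\pi(i))$.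 $H_{\underline\sigma}$ is the stabiliser in $W$ of a fixed $\underline\sigma$-tabloid, and $\xi_{H}=1_H\uparrow_H^W$ is the permutation character of $W$ on $W/H$. $\langle\phi,\psi\rangle=\frac1{|W|}\sum_{w}\phi(w)\overline{\psi(w)}$. Irreducible characters: fix an isomorphism $g\mapsto\theta^g$ from $G$ onto its group of linear characters. For a partition $\mu$ of $k$, $\psi^\mu$ is the irreducible character of $S_k$ indexed by $\mu$ (with $\psi^{(k)}$ trivial). For $\underline\lambda\in\Lambda_n(G)$ choose a partition of $[n]$ into sets $P_g$ ($g\in G$) with $|P_g|=|\underline\lambda(g)|$, let $S=\prod_g S_{P_g}$ and $G\wr S=G^n\rtimes S$, and let $\chi^{\underline\lambda}$ be the induction to $W$ of the character $((x_1,\dots,x_n),\pi)\mapsto\prod_{g\in G}\big(\prod_{i\in P_g}\theta^g(x_i)\big)\psi^{\underline\lambda(g)}(\pi|_{P_g})$ of $G\wr S$. These $\chi^{\underline\lambda}$ are exactly the irreducible characters of $W$ (independent of the choice of the $P_g$). Relation $\to$: for $U\le G$ let $U^\circ=\{g\in G:\theta^g(u)=1\text{ for all }u\in U\}$. Write $\underline\sigma\to\underline\lambda$ if there is $\underline\mu\in\Lambda_n(G)$ with $\underline\mu(g)\trianglelefteq\underline\lambda(g)$ for all $g\in G$ which arises as follows: colour every box of the Young diagram of $\underline\sigma(U)$, for every $U\le G$, with an element of $U^\circ$; then for each $g\in G$, $\underline\mu(g)$ is the partition having one part equal to $k$ for every row (of any of the diagrams $\underline\sigma(U)$) containing exactly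 $k\ge1$ boxes coloured $g$. *)

theory Defs
  imports
    Complex_Main
    "HOL-Library.FuncSet"
    "HOL-Library.Function_Algebras"
    "HOL-Combinatorics.Permutations"
    "HOL-Combinatorics.Orbits"
    "HOL-Algebra.Coset"
    "HOL-Algebra.Group_Action"
begin

text \<open>The finite abelian group is a commutative group in the sense of HOL-Algebra and is hence
  written multiplicatively.  Rows and columns of diagrams and parts of partitions are indexed
  from 0; the set [n] is \<open>{1..n}\<close>.\<close>

section \<open>Partitions\<close>

definition Par :: "(nat \<Rightarrow> nat) set" where
  "Par = {\<mu>. antimono \<mu> \<and> finite {i. \<mu> i \<noteq> 0}}"

definition psize :: "(nat \<Rightarrow> nat) \<Rightarrow> nat" where
  "psize \<mu> = (\<Sum>i | \<mu> i \<noteq> 0. \<mu> i)"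

definition dominated :: "(nat \<Rightarrow> nat) \<Rightarrow> (nat \<Rightarrow> nat) \<Rightarrow> bool" (infix \<open>\<unlhd>\<^sub>d\<close> 50) where
  "\<mu> \<unlhd>\<^sub>d \<nu> \<longleftrightarrow> (\<forall>m. (\<Sum>i<m. \<mu> i) \<le> (\<Sum>i<m. \<nu> i))"

definition par_maps_carrier :: "('a, 'b) monoid_scheme \<Rightarrow> nat \<Rightarrow> ('a \<Rightarrow> nat \<Rightarrow> nat) set" where
  "par_maps_carrier G n = {lam \<in> carrier G \<rightarrow>\<^sub>E Par. (\<Sum>g\<in>carrier G. psize (lam g)) = n}"

definition par_maps_subgroups ::
    "('a, 'b) monoid_scheme \<Rightarrow> nat \<Rightarrow> ('a set \<Rightarrow> nat \<Rightarrow> nat) set" where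
  "par_maps_subgroups G n =
     {\<sigma> \<in> {U. subgroup U G} \<rightarrow>\<^sub>E Par. (\<Sum>U | subgroup U G. psize (\<sigma> U)) = n}"


section \<open>Linear characters\<close>

definition complex_units :: "complex monoid" where
  "complex_units = \<lparr>carrier = UNIV - {0}, mult = (*), one = 1\<rparr>"

definition linear_chars :: "('a, 'b) monoid_scheme \<Rightarrow> ('a \<Rightarrow> complex) monoid" where
  "linear_chars G = \<lparr>carrier = hom G complex_units \<inter> extensional (carrier G),
                     mult = (\<lambda>\<phi> \<psi>. \<lambda>x\<in>carrier G. \<phi> x * \<psi> x),
                     one = (\<lambda>x\<in>carrier G. 1)\<rparr>"

definition annihilator ::
    "('a, 'b) monoid_scheme \<Rightarrow> ('a \<Rightarrow> 'a \<Rightarrow> complex) \<Rightarrow> 'a set \<Rightarrow> 'a set" where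
  "annihilator G \<theta> U = {g \<in> carrier G. \<forall>u\<in>U. \<theta> g u = 1}"


section \<open>Characters of finite groups\<close>

definition char_inner ::
    "('w, 'b) monoid_scheme \<Rightarrow> ('w \<Rightarrow> complex) \<Rightarrow> ('w \<Rightarrow> complex) \<Rightarrow> complex" where
  "char_inner W \<phi> \<psi> = (\<Sum>w\<in>carrier W. \<phi> w * cnj (\<psi> w)) / of_nat (order W)"

definition induced_char ::
    "('w, 'b) monoid_scheme \<Rightarrow> 'w set \<Rightarrow> ('w \<Rightarrow> complex) \<Rightarrow> 'w \<Rightarrow> complex" where
  "induced_char W H \<phi> w =
     (\<Sum>x\<in>carrier W. if inv\<^bsub>W\<^esub> x \<otimes>\<^bsub>W\<^esub> w \<otimes>\<^bsub>W\<^esub> x \<in> H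
                     then \<phi> (inv\<^bsub>W\<^esub> x \<otimes>\<^bsub>W\<^esub> w \<otimes>\<^bsub>W\<^esub> x) else 0) / of_nat (card H)"

definition perm_char :: "('w, 'b) monoid_scheme \<Rightarrow> 'w set \<Rightarrow> 'w \<Rightarrow> complex" where
  "perm_char W H = induced_char W H (\<lambda>_. 1)"


section \<open>Row-equivalence\<close>

text \<open>A box is a pair (row label, column).  For fillings with pairwise distinct entries,
  row-equivalence means that corresponding rows have the same set of entries.\<close>

definition row_class ::
    "('r \<times> nat) set \<Rightarrow> ('r \<times> nat \<Rightarrow> 'e) set \<Rightarrow> ('r \<times> nat \<Rightarrow> 'e) \<Rightarrow> ('r \<times> nat \<Rightarrow> 'e) set" where
  "row_class D T t = {t' \<in> T. \<forall>r. t' ` {b \<in> D. fst b = r} = t ` {b \<in> D. fst b = r}}"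


section \<open>Irreducible characters of symmetric groups\<close>

text \<open>The symmetric group of any finite set \<open>A\<close> with \<open>card A = psize \<mu>\<close> acts on the Specht
  module over the complex numbers, built from \<open>\<mu>\<close>-tableaux with entries in \<open>A\<close>.\<close>

definition diagram :: "(nat \<Rightarrow> nat) \<Rightarrow> (nat \<times> nat) set" where
  "diagram \<mu> = {(r, c). c < \<mu> r}"

definition sym_tableaux :: "(nat \<Rightarrow> nat) \<Rightarrow> 'e set \<Rightarrow> (nat \<times> nat \<Rightarrow> 'e) set" where
  "sym_tableaux \<mu> A = {t \<in> extensional (diagram \<mu>). bij_betw t (diagram \<mu>) A}"

definition sym_tabloid :: "(nat \<Rightarrow> nat) \<Rightarrow> 'e set \<Rightarrow> (nat \<times> nat \<Rightarrow> 'e) \<Rightarrow> (nat \<times> nat \<Rightarrow> 'e) set" where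
  "sym_tabloid \<mu> A t = row_class (diagram \<mu>) (sym_tableaux \<mu> A) t"

definition sym_tabloids :: "(nat \<Rightarrow> nat) \<Rightarrow> 'e set \<Rightarrow> (nat \<times> nat \<Rightarrow> 'e) set set" where
  "sym_tabloids \<mu> A = sym_tabloid \<mu> A ` sym_tableaux \<mu> A"

definition column_stabilizer :: "(nat \<Rightarrow> nat) \<Rightarrow> 'e set \<Rightarrow> (nat \<times> nat \<Rightarrow> 'e) \<Rightarrow> ('e \<Rightarrow> 'e) set" where
  "column_stabilizer \<mu> A t = {q. q permutes A \<and>
     (\<forall>c. q ` (t ` {b \<in> diagram \<mu>. snd b = c}) = t ` {b \<in> diagram \<mu>. snd b = c})}"

text \<open>Complex-valued functions supported on the set of tabloids represent formal linear
  combinations of tabloids.\<close>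

definition polytabloid ::
    "(nat \<Rightarrow> nat) \<Rightarrow> 'e set \<Rightarrow> (nat \<times> nat \<Rightarrow> 'e) \<Rightarrow> (nat \<times> nat \<Rightarrow> 'e) set \<Rightarrow> complex" where
  "polytabloid \<mu> A t X = (\<Sum>q\<in>column_stabilizer \<mu> A t.
     if X = sym_tabloid \<mu> A (compose (diagram \<mu>) q t) then of_int (sign q) else 0)"

text \<open>The linear extension to formal linear combinations of the action of \<open>p\<close> on tabloids.\<close>

definition tabloid_perm ::
    "(nat \<Rightarrow> nat) \<Rightarrow> 'e set \<Rightarrow> ('e \<Rightarrow> 'e) \<Rightarrow> ((nat \<times> nat \<Rightarrow> 'e) set \<Rightarrow> complex)
       \<Rightarrow> (nat \<times> nat \<Rightarrow> 'e) set \<Rightarrow> complex" where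
  "tabloid_perm \<mu> A p v X =
     (\<Sum>Y\<in>sym_tabloids \<mu> A. if compose (diagram \<mu>) p ` Y = X then v Y else 0)"

interpretation cfun: vector_space "\<lambda>(a :: complex) (f :: 'x \<Rightarrow> complex) x. a * f x"
  by unfold_locales (auto simp: fun_eq_iff algebra_simps)

definition specht_module ::
    "(nat \<Rightarrow> nat) \<Rightarrow> 'e set \<Rightarrow> ((nat \<times> nat \<Rightarrow> 'e) set \<Rightarrow> complex) set" where
  "specht_module \<mu> A = cfun.span (polytabloid \<mu> A ` sym_tableaux \<mu> A)"

text \<open>The trace of a linear endomorphism of a finite-dimensional subspace \<open>V\<close>; it does not
  depend on the basis chosen.\<close>

definition trace_on ::
    "('x \<Rightarrow> complex) set \<Rightarrow> (('x \<Rightarrow> complex) \<Rightarrow> ('x \<Rightarrow> complex)) \<Rightarrow> complex" where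
  "trace_on V f =
     (let B = (SOME B. cfun.independent B \<and> cfun.span B = V)
      in \<Sum>b\<in>B. cfun.representation B (f b) b)"

definition sym_char :: "(nat \<Rightarrow> nat) \<Rightarrow> 'e set \<Rightarrow> ('e \<Rightarrow> 'e) \<Rightarrow> complex" where
  "sym_char \<mu> A p = trace_on (specht_module \<mu> A) (tabloid_perm \<mu> A p)"


section \<open>The wreath product and its irreducible characters\<close>

definition wreath :: "('a, 'b) monoid_scheme \<Rightarrow> nat \<Rightarrow> ((nat \<Rightarrow> 'a) \<times> (nat \<Rightarrow> nat)) monoid" where
  "wreath G n = \<lparr>carrier = ({1..n} \<rightarrow>\<^sub>E carrier G) \<times> {p. p permutes {1..n}},
     mult = (\<lambda>(f, p) (g, s). (\<lambda>i\<in>{1..n}. f i \<otimes>\<^bsub>G\<^esub> g (inv_into UNIV p i), p \<circ> s)),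
     one = (\<lambda>i\<in>{1..n}. \<one>\<^bsub>G\<^esub>, id)\<rparr>"

definition block_system ::
    "('a, 'b) monoid_scheme \<Rightarrow> nat \<Rightarrow> ('a \<Rightarrow> nat \<Rightarrow> nat) \<Rightarrow> ('a \<Rightarrow> nat set) \<Rightarrow> bool" where
  "block_system G n lam P \<longleftrightarrow>
     (\<Union>g\<in>carrier G. P g) = {1..n} \<and> disjoint_family_on P (carrier G) \<and>
     (\<forall>g\<in>carrier G. card (P g) = psize (lam g))"

definition wreath_young ::
    "('a, 'b) monoid_scheme \<Rightarrow> nat \<Rightarrow> ('a \<Rightarrow> nat set) \<Rightarrow> ((nat \<Rightarrow> 'a) \<times> (nat \<Rightarrow> nat)) set" where
  "wreath_young G n P = {(x, p) \<in> carrier (wreath G n). \<forall>g\<in>carrier G. p ` P g = P g}"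

definition wreath_char ::
    "('a, 'b) monoid_scheme \<Rightarrow> nat \<Rightarrow> ('a \<Rightarrow> 'a \<Rightarrow> complex) \<Rightarrow> ('a \<Rightarrow> nat \<Rightarrow> nat)
       \<Rightarrow> ('a \<Rightarrow> nat set) \<Rightarrow> (nat \<Rightarrow> 'a) \<times> (nat \<Rightarrow> nat) \<Rightarrow> complex" where
  "wreath_char G n \<theta> lam P = induced_char (wreath G n) (wreath_young G n P)
     (\<lambda>(x, p). \<Prod>g\<in>carrier G.
        (\<Prod>i\<in>P g. \<theta> g (x i)) * sym_char (lam g) (P g) (perm_restrict p (P g)))"


section \<open>Tabloids for the wreath product\<close>

text \<open>The row labels are pairs (subgroup, row of its diagram).\<close>

definition boxes :: "('a, 'b) monoid_scheme \<Rightarrow> ('a set \<Rightarrow> nat \<Rightarrow> nat) \<Rightarrow> (('a set \<times> nat) \<times> nat) set" where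
  "boxes G \<sigma> = {((U, r), c). subgroup U G \<and> c < \<sigma> U r}"

definition tableaux ::
    "('a, 'b) monoid_scheme \<Rightarrow> nat \<Rightarrow> ('a set \<Rightarrow> nat \<Rightarrow> nat)
       \<Rightarrow> (('a set \<times> nat) \<times> nat \<Rightarrow> 'a set \<times> nat) set" where
  "tableaux G n \<sigma> = {t \<in> extensional (boxes G \<sigma>).
     (\<forall>((U, r), c) \<in> boxes G \<sigma>. t ((U, r), c) \<in> (rcosets\<^bsub>G\<^esub> U) \<times> {1..n}) \<and>
     inj_on (\<lambda>b. snd (t b)) (boxes G \<sigma>)}"

definition tabloids ::
    "('a, 'b) monoid_scheme \<Rightarrow> nat \<Rightarrow> ('a set \<Rightarrow> nat \<Rightarrow> nat)
       \<Rightarrow> (('a set \<times> nat) \<times> nat \<Rightarrow> 'a set \<times> nat) set set" where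
  "tabloids G n \<sigma> = row_class (boxes G \<sigma>) (tableaux G n \<sigma>) ` tableaux G n \<sigma>"

fun entry_act ::
    "('a, 'b) monoid_scheme \<Rightarrow> (nat \<Rightarrow> 'a) \<times> (nat \<Rightarrow> nat) \<Rightarrow> 'a set \<times> nat \<Rightarrow> 'a set \<times> nat" where
  "entry_act G (g, p) (C, i) = (C #>\<^bsub>G\<^esub> g (p i), p i)"

definition tabloid_act ::
    "('a, 'b) monoid_scheme \<Rightarrow> ('a set \<Rightarrow> nat \<Rightarrow> nat) \<Rightarrow> (nat \<Rightarrow> 'a) \<times> (nat \<Rightarrow> nat)
       \<Rightarrow> (('a set \<times> nat) \<times> nat \<Rightarrow> 'a set \<times> nat) set
       \<Rightarrow> (('a set \<times> nat) \<times> nat \<Rightarrow> 'a set \<times> nat) set" where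
  "tabloid_act G \<sigma> w X = (\<lambda>t. compose (boxes G \<sigma>) (entry_act G w) t) ` X"


section \<open>The relation between the two index sets\<close>

definition colouring ::
    "('a, 'b) monoid_scheme \<Rightarrow> ('a \<Rightarrow> 'a \<Rightarrow> complex) \<Rightarrow> ('a set \<Rightarrow> nat \<Rightarrow> nat)
       \<Rightarrow> (('a set \<times> nat) \<times> nat \<Rightarrow> 'a) \<Rightarrow> bool" where
  "colouring G \<theta> \<sigma> \<kappa> \<longleftrightarrow> (\<forall>((U, r), c) \<in> boxes G \<sigma>. \<kappa> ((U, r), c) \<in> annihilator G \<theta> U)"

text \<open>Since \<open>\<mu> g\<close> is a partition, it is determined by its multiplicities of parts \<open>k \<ge> 1\<close>.\<close>

definition arises_from ::
    "('a, 'b) monoid_scheme \<Rightarrow> ('a set \<Rightarrow> nat \<Rightarrow> nat) \<Rightarrow> (('a set \<times> nat) \<times> nat \<Rightarrow> 'a)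
       \<Rightarrow> ('a \<Rightarrow> nat \<Rightarrow> nat) \<Rightarrow> bool" where
  "arises_from G \<sigma> \<kappa> \<mu> \<longleftrightarrow> (\<forall>g\<in>carrier G. \<forall>k\<ge>1.
     card {i. \<mu> g i = k} =
     card {(U, r). subgroup U G \<and> card {c. c < \<sigma> U r \<and> \<kappa> ((U, r), c) = g} = k})"

definition arrow ::
    "('a, 'b) monoid_scheme \<Rightarrow> nat \<Rightarrow> ('a \<Rightarrow> 'a \<Rightarrow> complex) \<Rightarrow> ('a set \<Rightarrow> nat \<Rightarrow> nat)
       \<Rightarrow> ('a \<Rightarrow> nat \<Rightarrow> nat) \<Rightarrow> bool" where
  "arrow G n \<theta> \<sigma> lam \<longleftrightarrow> (\<exists>\<mu> \<in> par_maps_carrier G n. (\<forall>g\<in>carrier G. \<mu> g \<unlhd>\<^sub>d lam g) \<and>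
     (\<exists>\<kappa>. colouring G \<theta> \<sigma> \<kappa> \<and> arises_from G \<sigma> \<kappa> \<mu>))"

end

theory Submission imports Defs begin

text \<open>
  Mackey's formula writes the inner product as a positive multiple of the sum, over all tabloids in
  the orbit of \<open>X\<close>, of the sum of the inducing character over the elements of \<open>G \<wr> S\<close> that
  fix the tabloid.  An element \<open>(x, p)\<close> fixes the tabloid of a tableau iff \<open>p\<close> preserves rows and every
  \<open>x\<^sub>j\<close> lies in a prescribed coset of the subgroup \<open>U\<close> labelling the diagram of \<open>j\<close>.  Summing over \<open>x\<close>
  gives zero unless every entry \<open>j\<close> from the block \<open>P g\<close> satisfies \<open>g \<in> U\<degree>\<close>, that is, unless colouring
  entries by their blocks is admissible.  The remaining sum over \<open>p\<close> is a product over \<open>g\<close> of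
  sums of \<open>\<psi>\<close> over Young subgroups, each a positive multiple of the dimension of a space of
  invariants in a Specht module.  By Young's rule this dimension is nonzero iff the type \<open>\<mu> g\<close> of the Young
  subgroup is dominated by \<open>lam g\<close>.  All terms are nonnegative, so nothing cancels.

  Only the nonvanishing part of Young's rule is needed: an average of polytabloids vanishes if two equal
  labels share a column, and has a positive coefficient if the labels increase strictly down the columns.
\<close>

section \<open>Traces\<close>

text \<open>Two features of the definitions shape the proof. \<open>trace_on\<close> evaluates a
  trace in an arbitrarily chosen basis, so independence of the basis comes first. And the
  irreducible characters of symmetric groups enter as traces on Specht modules, so their sums over
  Young subgroups are read off from explicit averages of polytabloids rather than from orthogonality
  relations. Such a sum is a group order times a dimension, hence a natural number; this integrality
  survives all later products and is what makes the contributions of the tabloids comparable.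
  Producing a column-strict filling with prescribed multiplicities from dominance is a problem of
  Gale-Ryser type, solved by moving single units. The blocks \<open>P\<close> stay fixed while the
  tableau moves through its orbit, so every colouring using each \<open>g\<close> exactly
  \<open>card (P g)\<close> times occurs. A colouring behind the arrow has these multiplicities
  because \<open>\<mu>\<close> and \<open>lam\<close> have the same total size and dominance bounds
  each \<open>psize (\<mu> g)\<close> by \<open>psize (lam g)\<close>, which forces equality for
  every \<open>g\<close>.\<close>

abbreviation cfun_linear :: "(('x \<Rightarrow> complex) \<Rightarrow> 'y \<Rightarrow> complex) \<Rightarrow> bool" where
  "cfun_linear f \<equiv> Vector_Spaces.linear (\<lambda>a f x. a * f x) (\<lambda>a f x. a * f x) f"

lemma cfun_linear_sum:
  assumes "cfun_linear f" shows "f (\<Sum>i\<in>I. (\<lambda>x. a i * v i x)) = (\<Sum>i\<in>I. (\<lambda>x. a i * f (v i) x))"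
proof -
  interpret f: Vector_Spaces.linear "\<lambda>a f x. a * f x" "\<lambda>a f x. a * f x" f by fact
  show ?thesis by (simp add: f.sum f.scale)
qed

lemma cfun_linear_sum_of_maps:
  assumes f: "\<And>k. k \<in> K \<Longrightarrow> cfun_linear (f k)"
  shows "cfun_linear (\<lambda>v. \<Sum>k\<in>K. f k v)"
proof unfold_locales
  fix u v show "(\<Sum>k\<in>K. f k (u + v)) = (\<Sum>k\<in>K. f k u) + (\<Sum>k\<in>K. f k v)"
    unfolding sum.distrib[symmetric]
  proof (rule sum.cong[OF refl])
    fix k assume "k \<in> K" then interpret fk: Vector_Spaces.linear "\<lambda>a f x. a * f x" "\<lambda>a f x. a * f x" "f k" by (rule f)
    show "f k (u + v) = f k u + f k v" by (rule fk.add)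
  qed
next
  fix a u
  have "f k (\<lambda>x. a * u x) = (\<lambda>x. a * f k u x)" if "k \<in> K" for k
  proof -
    interpret fk: Vector_Spaces.linear "\<lambda>a f x. a * f x" "\<lambda>a f x. a * f x" "f k" by (rule f[OF that])
    show ?thesis by (rule fk.scale)
  qed
  then show "(\<Sum>k\<in>K. f k (\<lambda>x. a * u x)) = (\<lambda>x. a * (\<Sum>k\<in>K. f k u) x)"
    by (subst cfun.scale_sum_right) simp
qed

text \<open>The basis hidden in \<open>trace_on\<close> is an arbitrary choice. Passing to
  \<open>C\<close> and back and cancelling the two changes of basis is the usual invariance of the
  trace; it permits a basis adapted to the operator.\<close>

lemma trace_on_basis:
  assumes f: "cfun_linear f" and fV: "\<And>v. v \<in> V \<Longrightarrow> f v \<in> V"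
    and C: "cfun.independent C" "cfun.span C = V" "finite C"
  shows "trace_on V f = (\<Sum>c\<in>C. cfun.representation C (f c) c)"
proof -
  define B where "B = (SOME B. cfun.independent B \<and> cfun.span B = V)"
  have B: "cfun.independent B" "cfun.span B = V"
    using someI[of "\<lambda>B. cfun.independent B \<and> cfun.span B = V", OF conjI[OF C(1,2)]] by (auto simp: B_def)
  have finB: "finite B"
    using cfun.independent_span_bound[OF C(3) B(1)] cfun.span_superset[of B] B(2) C(2) by auto
  let ?rB = "cfun.representation B" and ?rC = "cfun.representation C"
  have BV: "b \<in> V" if "b \<in> B" for b using that B(2) cfun.span_base by blast
  have CV: "c \<in> V" if "c \<in> C" for c using that C(2) cfun.span_base by blast
  have reC: "v = (\<Sum>c\<in>C. (\<lambda>x. ?rC v c * c x))" if "v \<in> V" for v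
    using cfun.sum_representation_eq[OF C(1) _ C(3) order_refl, of v] that C(2) by simp
  have repB: "?rB (\<Sum>c\<in>C. (\<lambda>x. k c * u c x)) b = (\<Sum>c\<in>C. k c * ?rB (u c) b)"
    if "\<And>c. c \<in> C \<Longrightarrow> u c \<in> V" for k u b
  proof -
    have 1: "u c \<in> cfun.span B" if "c \<in> C" for c using \<open>\<And>c. c \<in> C \<Longrightarrow> u c \<in> V\<close> that B(2) by simp
    show ?thesis
      by (simp add: cfun.representation_sum[OF B(1)] cfun.span_scale 1 cfun.representation_scale[OF B(1)])
  qed
  have repC: "?rC (\<Sum>b\<in>B. (\<lambda>x. k b * u b x)) c = (\<Sum>b\<in>B. k b * ?rC (u b) c)"
    if "\<And>b. b \<in> B \<Longrightarrow> u b \<in> V" for k u c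
  proof -
    have 1: "u c \<in> cfun.span C" if "c \<in> B" for c using \<open>\<And>c. c \<in> B \<Longrightarrow> u c \<in> V\<close> that C(2) by simp
    show ?thesis
      by (simp add: cfun.representation_sum[OF C(1)] cfun.span_scale 1 cfun.representation_scale[OF C(1)])
  qed
  have reB: "v = (\<Sum>b\<in>B. (\<lambda>x. ?rB v b * b x))" if "v \<in> V" for v
    using cfun.sum_representation_eq[OF B(1) _ finB order_refl, of v] that B(2) by simp
  \<comment> \<open>The two change-of-basis matrices are inverse to each other.\<close>
  have delta: "(\<Sum>b\<in>B. ?rB c' b * ?rC b c) = (if c = c' then 1 else 0)" if "c \<in> C" "c' \<in> C" for c c'
  proof -
    have "?rC c' c = ?rC (\<Sum>b\<in>B. (\<lambda>x. ?rB c' b * b x)) c" using reB[OF CV[OF that(2)]] by simp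
    also have "\<dots> = (\<Sum>b\<in>B. ?rB c' b * ?rC b c)" by (rule repC) (rule BV)
    finally show ?thesis using cfun.representation_basis[OF C(1) that(2)] by simp
  qed
  \<comment> \<open>First \<open>b\<close> and then each \<open>f c\<close> is expanded in
    \<open>C\<close>, which brings in the matrix of \<open>f\<close> relative to
    \<open>C\<close>.\<close>
  have "?rB (f b) b = (\<Sum>c\<in>C. \<Sum>c'\<in>C. ?rC (f c) c' * (?rB c' b * ?rC b c))" if b: "b \<in> B" for b
  proof -
    have "f b = f (\<Sum>c\<in>C. (\<lambda>x. ?rC b c * c x))" using reC[OF BV[OF b]] by simp
    also have "\<dots> = (\<Sum>c\<in>C. (\<lambda>x. ?rC b c * f c x))" by (rule cfun_linear_sum[OF f])
    finally have "?rB (f b) b = (\<Sum>c\<in>C. ?rC b c * ?rB (f c) b)" using repB[of f] fV CV by simp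
    also have "\<dots> = (\<Sum>c\<in>C. ?rC b c * (\<Sum>c'\<in>C. ?rC (f c) c' * ?rB c' b))"
    proof (rule sum.cong[OF refl])
      fix c assume c: "c \<in> C"
      have "?rB (f c) b = ?rB (\<Sum>c'\<in>C. (\<lambda>x. ?rC (f c) c' * c' x)) b" using reC[OF fV[OF CV[OF c]]] by simp
      also have "\<dots> = (\<Sum>c'\<in>C. ?rC (f c) c' * ?rB c' b)" by (rule repB) (rule CV)
      finally show "?rC b c * ?rB (f c) b = ?rC b c * (\<Sum>c'\<in>C. ?rC (f c) c' * ?rB c' b)" by simp
    qed
    finally show ?thesis by (simp add: sum_distrib_left mult_ac)
  qed
  then have "trace_on V f = (\<Sum>b\<in>B. \<Sum>c\<in>C. \<Sum>c'\<in>C. ?rC (f c) c' * (?rB c' b * ?rC b c))"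
    by (simp add: trace_on_def B_def[symmetric])
  also have "\<dots> = (\<Sum>c\<in>C. \<Sum>b\<in>B. \<Sum>c'\<in>C. ?rC (f c) c' * (?rB c' b * ?rC b c))" by (rule sum.swap)
  also have "\<dots> = (\<Sum>c\<in>C. \<Sum>c'\<in>C. ?rC (f c) c' * (\<Sum>b\<in>B. ?rB c' b * ?rC b c))"
    unfolding sum_distrib_left by (rule sum.cong[OF refl]) (rule sum.swap)
  also have "\<dots> = (\<Sum>c\<in>C. \<Sum>c'\<in>C. if c = c' then ?rC (f c) c' else 0)"
    by (intro sum.cong refl) (simp add: delta)
  also have "\<dots> = (\<Sum>c\<in>C. ?rC (f c) c)" by (simp add: C(3))
  finally show ?thesis .
qed

text \<open>All operators are evaluated in the same chosen basis, so additivity holds term by term.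
  \<open>C\<close> witnesses that a basis exists, hence that the choice in \<open>trace_on\<close>
  really yields one.\<close>

lemma trace_on_sum:
  assumes "\<And>k v. k \<in> K \<Longrightarrow> v \<in> V \<Longrightarrow> f k v \<in> V" and C: "cfun.independent C" "cfun.span C = V"
  shows "trace_on V (\<lambda>v. \<Sum>k\<in>K. f k v) = (\<Sum>k\<in>K. trace_on V (f k))"
proof -
  define B where "B = (SOME B. cfun.independent B \<and> cfun.span B = V)"
  have B: "cfun.independent B" "cfun.span B = V"
    using someI[of "\<lambda>B. cfun.independent B \<and> cfun.span B = V", OF conjI[OF C(1,2)]] by (auto simp: B_def)
  have "b \<in> V" if "b \<in> B" for b using that B(2) cfun.span_base by blast
  then have "cfun.representation B (\<Sum>k\<in>K. f k b) b = (\<Sum>k\<in>K. cfun.representation B (f k b) b)" if "b \<in> B" for b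
    using cfun.representation_sum[OF B(1), of K "\<lambda>k. f k b"] assms(1) B(2) that by simp
  then show ?thesis unfolding trace_on_def B_def[symmetric] Let_def
    by (simp add: sum.swap[of _ B K])
qed

text \<open>The sum \<open>Q\<close> of the operators is \<open>card K\<close> times a projection onto the fixed space, so in a
  basis of \<open>V\<close> extending a basis of \<open>Q ` V\<close> its trace can be read off.\<close>

lemma trace_on_group_sum:
  fixes f :: "'k \<Rightarrow> ('x \<Rightarrow> complex) \<Rightarrow> ('x \<Rightarrow> complex)"
  assumes f: "\<And>k. k \<in> K \<Longrightarrow> cfun_linear (f k)"
    and fV: "\<And>k v. k \<in> K \<Longrightarrow> v \<in> V \<Longrightarrow> f k v \<in> V"
    and V: "V = cfun.span T" "finite T"
    and fQ: "\<And>k v. k \<in> K \<Longrightarrow> v \<in> V \<Longrightarrow> f k (\<Sum>j\<in>K. f j v) = (\<Sum>j\<in>K. f j v)"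
  shows "\<exists>d::nat. (\<Sum>k\<in>K. trace_on V (f k)) = of_nat (card K * d) \<and>
     (d \<noteq> 0 \<longleftrightarrow> (\<exists>v\<in>V. (\<Sum>k\<in>K. f k v) \<noteq> 0))"
proof -
  define Q where "Q v = (\<Sum>k\<in>K. f k v)" for v
  have Qlin: "cfun_linear Q" unfolding Q_def by (rule cfun_linear_sum_of_maps[OF f])
  interpret Q: Vector_Spaces.linear "\<lambda>a f x. a * f x" "\<lambda>a f x. a * f x" Q by (rule Qlin)
  have subV: "cfun.subspace V" unfolding V by (rule cfun.subspace_span)
  have QV: "Q v \<in> V" if "v \<in> V" for v
    unfolding Q_def using that fV by (intro cfun.subspace_sum[OF subV]) auto
  \<comment> \<open>The basis of the image consists of vectors \<open>Q v\<close>, and on these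
    \<open>Q\<close> is multiplication by \<open>card K\<close>.\<close>
  obtain B1 where B1: "B1 \<subseteq> Q ` V" "cfun.independent B1" "Q ` V \<subseteq> cfun.span B1"
    by (rule cfun.maximal_independent_subset)
  have "B1 \<subseteq> V" using B1(1) QV by auto
  then obtain C where C: "B1 \<subseteq> C" "C \<subseteq> V" "cfun.independent C" "V \<subseteq> cfun.span C"
    using cfun.maximal_independent_subset_extend B1(2) by metis
  have spC: "cfun.span C = V" using C(2,4) subV by (rule cfun.span_subspace)
  have finC: "finite C" using cfun.independent_span_bound[OF V(2) C(3)] C(2) V(1) by auto
  have trQ: "trace_on V Q = (\<Sum>c\<in>C. cfun.representation C (Q c) c)"
    by (rule trace_on_basis[OF Qlin QV C(3) spC finC])
  have "cfun.representation C (Q c) c = (if c \<in> B1 then of_nat (card K) else 0)" if c: "c \<in> C" for c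
  proof (cases "c \<in> B1")
    case True
    then obtain v where v: "v \<in> V" "c = Q v" using B1(1) by auto
    have "Q c = (\<Sum>k\<in>K. c)" unfolding Q_def v(2) using fQ[OF _ v(1)] by (intro sum.cong refl) auto
    also have "\<dots> = (\<lambda>x. of_nat (card K) * c x)" by (simp add: fun_eq_iff)
    finally show ?thesis
      using True cfun.representation_scale[OF C(3), of c "of_nat (card K)"] cfun.representation_basis[OF C(3) c] c
        cfun.span_base[OF c] by simp
  next
    case False
    \<comment> \<open>\<open>Q c\<close> lies in the span of \<open>B1\<close>, so a basis vector
      outside \<open>B1\<close> contributes nothing to the diagonal.\<close>
    have "cfun.representation C (Q c) = cfun.representation B1 (Q c)"
      using B1(3) c C(2) by (intro cfun.representation_extend[OF C(3) _ C(1)]) auto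
    then show ?thesis using False cfun.representation_ne_zero[of B1 "Q c" c] by auto
  qed
  then have "trace_on V Q = (\<Sum>c\<in>C. if c \<in> B1 then of_nat (card K) else 0)" unfolding trQ by (rule sum.cong[OF refl])
  also have "\<dots> = of_nat (card K * card B1)"
    using finC C(1) by (simp add: sum.If_cases Int_absorb1)
  finally have tr: "trace_on V Q = of_nat (card K * card B1)" .
  have "finite B1" using finC C(1) finite_subset by blast
  then have "card B1 \<noteq> 0 \<longleftrightarrow> B1 \<noteq> {}" by auto
  also have "\<dots> \<longleftrightarrow> (\<exists>v\<in>V. Q v \<noteq> 0)"
  proof
    assume "B1 \<noteq> {}"
    then obtain b where b: "b \<in> B1" by auto
    then have "b \<noteq> 0" using B1(2) cfun.dependent_zero by auto
    then show "\<exists>v\<in>V. Q v \<noteq> 0" using b B1(1) by auto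
  next
    assume "\<exists>v\<in>V. Q v \<noteq> 0" then show "B1 \<noteq> {}" using B1(3) by auto
  qed
  finally have "card B1 \<noteq> 0 \<longleftrightarrow> (\<exists>v\<in>V. Q v \<noteq> 0)" .
  moreover have "trace_on V Q = (\<Sum>k\<in>K. trace_on V (f k))"
    unfolding Q_def by (rule trace_on_sum[OF fV C(3) spC])
  ultimately show ?thesis using tr unfolding Q_def by (intro exI[of _ "card B1"]) simp
qed

section \<open>Tabloids and Specht modules\<close>

lemma row_class_eq_iff:
  assumes "t \<in> T" "t' \<in> T"
  shows "row_class D T t = row_class D T t' \<longleftrightarrow> (\<forall>r. t ` {b \<in> D. fst b = r} = t' ` {b \<in> D. fst b = r})"
proof
  assume "row_class D T t = row_class D T t'"
  moreover have "t \<in> row_class D T t" using assms by (simp add: row_class_def)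
  ultimately have "t \<in> row_class D T t'" by simp
  then show "\<forall>r. t ` {b \<in> D. fst b = r} = t' ` {b \<in> D. fst b = r}" by (simp add: row_class_def)
next
  assume "\<forall>r. t ` {b \<in> D. fst b = r} = t' ` {b \<in> D. fst b = r}"
  then show "row_class D T t = row_class D T t'" by (simp add: row_class_def)
qed

lemma compose_compose: "compose D p (compose D q t) = compose D (p \<circ> q) t"
  by (auto simp: compose_def fun_eq_iff)

lemma compose_row: "compose D f t ` {b \<in> D. fst b = r} = f ` t ` {b \<in> D. fst b = r}"
  by (auto simp: compose_def image_iff)

text \<open>The maps \<open>f\<close> and \<open>f'\<close> are inverse to each other only through
  their effect on \<open>T\<close>. This covers permutations of the entries as well as the wreath
  product action, whose composition law holds for genuine coset entries.\<close>

lemma compose_row_class: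
  assumes T: "\<And>t. t \<in> T \<Longrightarrow> compose D f t \<in> T" "\<And>t. t \<in> T \<Longrightarrow> compose D f' t \<in> T"
    and inv: "\<And>t. t \<in> T \<Longrightarrow> compose D f (compose D f' t) = t"
             "\<And>t. t \<in> T \<Longrightarrow> compose D f' (compose D f t) = t"
    and t: "t \<in> T"
  shows "compose D f ` row_class D T t = row_class D T (compose D f t)"
proof (intro equalityI subsetI)
  fix s assume "s \<in> compose D f ` row_class D T t"
  then obtain x where "x \<in> T" "\<forall>r. x ` {b \<in> D. fst b = r} = t ` {b \<in> D. fst b = r}" "s = compose D f x"
    by (auto simp: row_class_def)
  then show "s \<in> row_class D T (compose D f t)" using T(1) by (simp add: row_class_def compose_row)
next
  fix s assume s: "s \<in> row_class D T (compose D f t)"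
  then have sT: "s \<in> T" by (simp add: row_class_def)
  have "compose D f' s ` {b \<in> D. fst b = r} = t ` {b \<in> D. fst b = r}" for r
  proof -
    have "compose D f' s ` {b \<in> D. fst b = r} = f' ` s ` {b \<in> D. fst b = r}" by (rule compose_row)
    also have "s ` {b \<in> D. fst b = r} = compose D f t ` {b \<in> D. fst b = r}"
      using s by (simp add: row_class_def)
    also have "f' ` compose D f t ` {b \<in> D. fst b = r} = compose D f' (compose D f t) ` {b \<in> D. fst b = r}"
      by (rule compose_row[symmetric])
    finally show ?thesis using inv(2)[OF t] by simp
  qed
  then have "compose D f' s \<in> row_class D T t" using T(2)[OF sT] by (simp add: row_class_def)
  then show "s \<in> compose D f ` row_class D T t" using inv(1)[OF sT] by (metis image_eqI)
qed

lemma sym_tableau_compose: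
  assumes "t \<in> sym_tableaux \<mu> A" "p permutes A"
  shows "compose (diagram \<mu>) p t \<in> sym_tableaux \<mu> A"
proof -
  have "bij_betw (p \<circ> t) (diagram \<mu>) A"
    using assms permutes_imp_bij[OF assms(2)] by (auto simp: sym_tableaux_def intro: bij_betw_trans)
  then have "bij_betw (compose (diagram \<mu>) p t) (diagram \<mu>) A"
    by (subst bij_betw_cong[where g="p \<circ> t"]) (auto simp: compose_def)
  then show ?thesis by (simp add: sym_tableaux_def)
qed

lemma sym_tableau_compose_id: "t \<in> sym_tableaux \<mu> A \<Longrightarrow> compose (diagram \<mu>) id t = t"
  by (auto simp: sym_tableaux_def compose_def extensional_def fun_eq_iff)

lemma finite_sym_tableaux:
  assumes "finite A" shows "finite (sym_tableaux \<mu> A)"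
proof (cases "sym_tableaux \<mu> A = {}")
  case False
  then obtain t where "bij_betw t (diagram \<mu>) A" by (auto simp: sym_tableaux_def)
  then have "finite (diagram \<mu>)" using assms bij_betw_finite by blast
  then have "finite (diagram \<mu> \<rightarrow>\<^sub>E A)" using assms by (simp add: finite_PiE)
  moreover have "sym_tableaux \<mu> A \<subseteq> diagram \<mu> \<rightarrow>\<^sub>E A"
    by (auto simp: sym_tableaux_def PiE_def bij_betw_def)
  ultimately show ?thesis by (rule rev_finite_subset)
qed simp

lemma sym_tabloid_compose:
  assumes "t \<in> sym_tableaux \<mu> A" "p permutes A"
  shows "compose (diagram \<mu>) p ` sym_tabloid \<mu> A t = sym_tabloid \<mu> A (compose (diagram \<mu>) p t)"
  unfolding sym_tabloid_def
  by (rule compose_row_class[where f' = "inv_into UNIV p"])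
     (use assms in \<open>auto simp: sym_tableau_compose permutes_inv compose_compose sym_tableau_compose_id permutes_inv_o\<close>)

section \<open>Column stabilisers and the action on polytabloids\<close>

lemma column_stabilizer_permutes: "q \<in> column_stabilizer \<mu> A t \<Longrightarrow> q permutes A"
  by (simp add: column_stabilizer_def)

lemma finite_column_stabilizer: "finite A \<Longrightarrow> finite (column_stabilizer \<mu> A t)"
  by (rule finite_subset[OF _ finite_permutations[of A]]) (auto simp: column_stabilizer_def)

lemma id_in_column_stabilizer: "id \<in> column_stabilizer \<mu> A t"
  by (simp add: column_stabilizer_def permutes_id)

lemma cfun_linear_tabloid_perm: "cfun_linear (tabloid_perm \<mu> A p)"
proof unfold_locales
  show "tabloid_perm \<mu> A p (u + v) = tabloid_perm \<mu> A p u + tabloid_perm \<mu> A p v" for u v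
    by (auto simp: tabloid_perm_def fun_eq_iff sum.distrib[symmetric] intro!: sum.cong)
  show "tabloid_perm \<mu> A p (\<lambda>x. a * u x) = (\<lambda>x. a * tabloid_perm \<mu> A p u x)" for a u
    by (auto simp: tabloid_perm_def fun_eq_iff sum_distrib_left intro!: sum.cong)
qed

text \<open>Pulls an outer condition into the summand, so that a double sum can be swapped and its
  inner sum collapsed.\<close>

lemma if_sum_if:
  "(if c then \<Sum>z\<in>S. if P z then v z else 0 else 0) =
    (\<Sum>z\<in>S. if P z then (if c then v z else 0) else (0::'b::comm_monoid_add))"
  by (cases c) (simp_all cong: if_cong)

lemma sum_fun_apply: "(\<Sum>i\<in>I. f i) x = (\<Sum>i\<in>I. f i x)"
  by (induction I rule: infinite_finite_induct) auto

lemma tabloid_perm_compose: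
  assumes "finite A" "j permutes A"
  shows "tabloid_perm \<mu> A k (tabloid_perm \<mu> A j v) = tabloid_perm \<mu> A (k \<circ> j) v"
proof
  fix X
  let ?S = "sym_tabloids \<mu> A" and ?c = "compose (diagram \<mu>)"
  have fin: "finite ?S" using finite_sym_tableaux[OF assms(1)] by (simp add: sym_tabloids_def)
  have jS: "?c j ` Z \<in> ?S" if "Z \<in> ?S" for Z
    using that assms(2) by (auto simp: sym_tabloids_def sym_tabloid_compose sym_tableau_compose)
  have "tabloid_perm \<mu> A k (tabloid_perm \<mu> A j v) X =
      (\<Sum>Y\<in>?S. \<Sum>Z\<in>?S. if ?c j ` Z = Y then (if ?c k ` Y = X then v Z else 0) else 0)"
    unfolding tabloid_perm_def
  proof (rule sum.cong[OF refl])
    fix Y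
    show "(if ?c k ` Y = X then \<Sum>Z\<in>?S. if ?c j ` Z = Y then v Z else 0 else 0) =
      (\<Sum>Z\<in>?S. if ?c j ` Z = Y then (if ?c k ` Y = X then v Z else 0) else 0)"
      by (rule if_sum_if)
  qed
  also have "\<dots> = (\<Sum>Z\<in>?S. \<Sum>Y\<in>?S. if ?c j ` Z = Y then (if ?c k ` Y = X then v Z else 0) else 0)"
    by (rule sum.swap)
  \<comment> \<open>For each \<open>Z\<close> exactly one \<open>Y\<close> contributes, the image of
    \<open>Z\<close> under \<open>j\<close>, which is again a tabloid because \<open>j\<close>
    permutes \<open>A\<close>.\<close>
  also have "\<dots> = (\<Sum>Z\<in>?S. if ?c k ` ?c j ` Z = X then v Z else 0)"
    using fin jS by (intro sum.cong refl) simp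
  also have "\<dots> = tabloid_perm \<mu> A (k \<circ> j) v X"
    unfolding tabloid_perm_def image_image compose_compose ..
  finally show "tabloid_perm \<mu> A k (tabloid_perm \<mu> A j v) X = tabloid_perm \<mu> A (k \<circ> j) v X" .
qed

text \<open>The index set remains the column stabiliser of the unmoved \<open>t\<close>, which makes
  single coefficients easy to compare for varying \<open>p\<close>.\<close>

lemma tabloid_perm_polytabloid:
  assumes A: "finite A" and t: "t \<in> sym_tableaux \<mu> A" and p: "p permutes A"
  shows "tabloid_perm \<mu> A p (polytabloid \<mu> A t) X =
    (\<Sum>q\<in>column_stabilizer \<mu> A t.
      if X = sym_tabloid \<mu> A (compose (diagram \<mu>) (p \<circ> q) t) then of_int (sign q) else 0)"
proof -
  let ?S = "sym_tabloids \<mu> A" and ?c = "compose (diagram \<mu>)" and ?C = "column_stabilizer \<mu> A t"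
    and ?tab = "sym_tabloid \<mu> A"
  have fin: "finite ?S" using finite_sym_tableaux[OF A] by (simp add: sym_tabloids_def)
  have qt: "?c q t \<in> sym_tableaux \<mu> A" if "q \<in> ?C" for q
    using that t by (intro sym_tableau_compose column_stabilizer_permutes)
  have "tabloid_perm \<mu> A p (polytabloid \<mu> A t) X =
      (\<Sum>Y\<in>?S. \<Sum>q\<in>?C. if Y = ?tab (?c q t) then (if ?c p ` Y = X then of_int (sign q) else 0) else 0)"
    unfolding tabloid_perm_def polytabloid_def
  proof (rule sum.cong[OF refl])
    fix Y
    show "(if ?c p ` Y = X then \<Sum>q\<in>?C. if Y = ?tab (?c q t) then of_int (sign q) else 0 else 0) =
      (\<Sum>q\<in>?C. if Y = ?tab (?c q t) then (if ?c p ` Y = X then of_int (sign q) else 0) else (0::complex))"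
      by (rule if_sum_if)
  qed
  also have "\<dots> = (\<Sum>q\<in>?C. \<Sum>Y\<in>?S. if Y = ?tab (?c q t) then (if ?c p ` Y = X then of_int (sign q) else 0) else 0)"
    by (rule sum.swap)
  also have "\<dots> = (\<Sum>q\<in>?C. if ?c p ` ?tab (?c q t) = X then of_int (sign q) else 0)"
    using fin qt by (intro sum.cong refl) (simp add: sym_tabloids_def)
  also have "\<dots> = (\<Sum>q\<in>?C. if X = ?tab (?c (p \<circ> q) t) then of_int (sign q) else 0)"
    using qt p by (intro sum.cong refl) (auto simp: sym_tabloid_compose compose_compose)
  finally show ?thesis .
qed

lemma sign_compose_permutes: "finite A \<Longrightarrow> p permutes A \<Longrightarrow> q permutes A \<Longrightarrow> sign (p \<circ> q) = sign p * sign q"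
  using permutation_permutes by (intro sign_compose) blast+

lemma column_stabilizer_conj:
  assumes p: "p permutes A" and q: "q \<in> column_stabilizer \<mu> A t"
  shows "p \<circ> q \<circ> inv_into UNIV p \<in> column_stabilizer \<mu> A (compose (diagram \<mu>) p t)"
proof -
  have "(p \<circ> q \<circ> inv_into UNIV p) ` (compose (diagram \<mu>) p t ` {b \<in> diagram \<mu>. snd b = c}) =
        compose (diagram \<mu>) p t ` {b \<in> diagram \<mu>. snd b = c}" for c
  proof -
    have 1: "compose (diagram \<mu>) p t ` {b \<in> diagram \<mu>. snd b = c} = p ` t ` {b \<in> diagram \<mu>. snd b = c}"
      by (auto simp: compose_def image_iff)
    have "(p \<circ> q \<circ> inv_into UNIV p) ` p ` Z = p ` q ` Z" for Z
      by (simp add: image_image permutes_inverses[OF p])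
    then show ?thesis unfolding 1 using q by (simp add: column_stabilizer_def)
  qed
  then show ?thesis
    using p q by (auto simp: column_stabilizer_def intro!: permutes_compose permutes_inv)
qed

text \<open>Conjugation by \<open>p\<close> matches the two column stabilisers and preserves signs.
  The identity makes the Specht module invariant under the symmetric group.\<close>

lemma tabloid_perm_polytabloid_eq:
  assumes A: "finite A" and t: "t \<in> sym_tableaux \<mu> A" and p: "p permutes A"
  shows "tabloid_perm \<mu> A p (polytabloid \<mu> A t) = polytabloid \<mu> A (compose (diagram \<mu>) p t)"
proof
  fix X
  let ?c = "compose (diagram \<mu>)"
  note perm = column_stabilizer_permutes
  have ip: "inv_into UNIV p permutes A" using p by (rule permutes_inv)
  have pp: "p \<circ> inv_into UNIV p = id" "inv_into UNIV p \<circ> p = id" using permutes_inv_o[OF p] by auto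
  have "q \<in> column_stabilizer \<mu> A (?c p t) \<Longrightarrow> inv_into UNIV p \<circ> q \<circ> p \<in> column_stabilizer \<mu> A t" for q
    using column_stabilizer_conj[OF ip, of q \<mu> "?c p t"] p
    by (simp add: compose_compose pp sym_tableau_compose_id[OF t] inv_inv_eq permutes_bij)
  then show "tabloid_perm \<mu> A p (polytabloid \<mu> A t) X = polytabloid \<mu> A (?c p t) X"
    unfolding tabloid_perm_polytabloid[OF assms] polytabloid_def
  proof (intro sum.reindex_bij_witness[where i = "\<lambda>q. inv_into UNIV p \<circ> q \<circ> p" and j = "\<lambda>q. p \<circ> q \<circ> inv_into UNIV p"])
    fix q assume q: "q \<in> column_stabilizer \<mu> A t"
    have "sign (p \<circ> q \<circ> inv_into UNIV p) = sign q"
      using perm[OF q] p ip A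
      by (simp add: sign_compose_permutes permutes_compose sign_inverse permutation_permutes[THEN iffD2] exI[of _ A] conjI)
    then show "(if X = sym_tabloid \<mu> A (?c (p \<circ> q \<circ> inv_into UNIV p) (?c p t)) then of_int (sign (p \<circ> q \<circ> inv_into UNIV p)) else 0) =
        (if X = sym_tabloid \<mu> A (?c (p \<circ> q) t) then of_int (sign q) else (0::complex))"
      by (simp add: compose_compose comp_assoc pp)
  qed (use p in \<open>auto simp: column_stabilizer_conj fun_eq_iff permutes_inverses\<close>)
qed

text \<open>A Young subgroup, described by a labelling whose fibres are its orbits. Labels have an
  arbitrary type because they will be pairs of a subgroup and a row.\<close>

definition label_stabilizer :: "'e set \<Rightarrow> ('e \<Rightarrow> 'r) \<Rightarrow> ('e \<Rightarrow> 'e) set" where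
  "label_stabilizer A \<rho> = {p. p permutes A \<and> (\<forall>a\<in>A. \<rho> (p a) = \<rho> a)}"

lemma finite_label_stabilizer: "finite A \<Longrightarrow> finite (label_stabilizer A \<rho>)"
  by (rule finite_subset[OF _ finite_permutations[of A]]) (auto simp: label_stabilizer_def)

lemma id_in_label_stabilizer: "id \<in> label_stabilizer A \<rho>"
  by (simp add: label_stabilizer_def permutes_id)

lemma label_stabilizer_compose:
  "p \<in> label_stabilizer A \<rho> \<Longrightarrow> q \<in> label_stabilizer A \<rho> \<Longrightarrow> p \<circ> q \<in> label_stabilizer A \<rho>"
  by (auto simp: label_stabilizer_def permutes_compose permutes_in_image)

lemma label_stabilizer_inv:
  assumes "p \<in> label_stabilizer A \<rho>" shows "inv_into UNIV p \<in> label_stabilizer A \<rho>"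
proof -
  have p: "p permutes A" using assms by (simp add: label_stabilizer_def)
  have "\<rho> (inv_into UNIV p a) = \<rho> a" if "a \<in> A" for a
  proof -
    have "inv_into UNIV p a \<in> A" using permutes_in_image[OF permutes_inv[OF p]] that by simp
    then have "\<rho> (p (inv_into UNIV p a)) = \<rho> (inv_into UNIV p a)" using assms by (simp add: label_stabilizer_def)
    then show ?thesis by (simp add: permutes_inverses[OF p])
  qed
  then show ?thesis using permutes_inv[OF p] by (simp add: label_stabilizer_def)
qed

lemma sum_label_stabilizer_shift:
  assumes k: "k \<in> label_stabilizer A \<rho>"
  shows "(\<Sum>p\<in>label_stabilizer A \<rho>. g (k \<circ> p)) = (\<Sum>p\<in>label_stabilizer A \<rho>. g p)"
    and "(\<Sum>p\<in>label_stabilizer A \<rho>. g (p \<circ> k)) = (\<Sum>p\<in>label_stabilizer A \<rho>. g p)"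
proof -
  have kp: "k permutes A" using k by (simp add: label_stabilizer_def)
  show "(\<Sum>p\<in>label_stabilizer A \<rho>. g (k \<circ> p)) = (\<Sum>p\<in>label_stabilizer A \<rho>. g p)"
    by (rule sum.reindex_bij_witness[where j = "\<lambda>p. k \<circ> p" and i = "\<lambda>p. inv_into UNIV k \<circ> p"])
       (use k in \<open>auto simp: label_stabilizer_compose label_stabilizer_inv fun_eq_iff permutes_inverses[OF kp]\<close>)
  show "(\<Sum>p\<in>label_stabilizer A \<rho>. g (p \<circ> k)) = (\<Sum>p\<in>label_stabilizer A \<rho>. g p)"
    by (rule sum.reindex_bij_witness[where j = "\<lambda>p. p \<circ> k" and i = "\<lambda>p. p \<circ> inv_into UNIV k"])
       (use k in \<open>auto simp: label_stabilizer_compose label_stabilizer_inv fun_eq_iff permutes_inverses[OF kp]\<close>)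
qed

text \<open>The trace computation for a group sum, applied to the Specht module. As \<open>Q\<close>
  is linear, it is nonzero on the module iff it is nonzero on one of the generating
  polytabloids.\<close>

lemma sum_sym_char_label_stabilizer:
  fixes A :: "'e set" and \<rho> :: "'e \<Rightarrow> 'r" and \<mu> :: "nat \<Rightarrow> nat"
  assumes A: "finite A"
  defines "Q \<equiv> \<lambda>v. \<Sum>p\<in>label_stabilizer A \<rho>. tabloid_perm \<mu> A p v"
  shows "\<exists>d::nat. (\<Sum>p\<in>label_stabilizer A \<rho>. sym_char \<mu> A p) = of_nat (card (label_stabilizer A \<rho>) * d) \<and>
     (d \<noteq> 0 \<longleftrightarrow> (\<exists>t\<in>sym_tableaux \<mu> A. Q (polytabloid \<mu> A t) \<noteq> 0))"
proof -
  let ?K = "label_stabilizer A \<rho>" and ?f = "tabloid_perm \<mu> A" and ?V = "specht_module \<mu> A"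
  let ?T = "polytabloid \<mu> A ` sym_tableaux \<mu> A"
  have perm: "p permutes A" if "p \<in> ?K" for p using that by (simp add: label_stabilizer_def)
  have lin: "cfun_linear (?f p)" for p by (rule cfun_linear_tabloid_perm)
  have inv: "?f p v \<in> ?V" if "p \<in> ?K" "v \<in> ?V" for p v
  proof -
    interpret fp: Vector_Spaces.linear "\<lambda>a f x. a * f x" "\<lambda>a f x. a * f x" "?f p" by (rule lin)
    have "?f p ` ?V = cfun.span (?f p ` ?T)" unfolding specht_module_def by (simp add: fp.span_image)
    also have "\<dots> \<subseteq> ?V" unfolding specht_module_def
      using tabloid_perm_polytabloid_eq[OF A _ perm[OF that(1)]] sym_tableau_compose[OF _ perm[OF that(1)]]
      by (intro cfun.span_mono) auto
    finally show ?thesis using that(2) by blast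
  qed
  have fQ: "?f k (\<Sum>j\<in>?K. ?f j v) = (\<Sum>j\<in>?K. ?f j v)" if k: "k \<in> ?K" for k v
  proof -
    have "?f k (\<Sum>j\<in>?K. ?f j v) = (\<Sum>j\<in>?K. ?f k (?f j v))"
      using cfun_linear_sum[OF lin, of k "\<lambda>_. 1" "\<lambda>j. ?f j v" ?K] by simp
    also have "\<dots> = (\<Sum>j\<in>?K. ?f (k \<circ> j) v)"
      by (intro sum.cong refl tabloid_perm_compose[OF A] perm)
    also have "\<dots> = (\<Sum>j\<in>?K. ?f j v)" by (rule sum_label_stabilizer_shift(1)[OF k])
    finally show ?thesis .
  qed
  have "\<exists>d::nat. (\<Sum>k\<in>?K. trace_on ?V (?f k)) = of_nat (card ?K * d) \<and>
     (d \<noteq> 0 \<longleftrightarrow> (\<exists>v\<in>?V. (\<Sum>k\<in>?K. ?f k v) \<noteq> 0))"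
    using lin inv fQ finite_sym_tableaux[OF A]
    by (intro trace_on_group_sum[where T = ?T]) (auto simp: specht_module_def)
  moreover have "(\<exists>v\<in>?V. Q v \<noteq> 0) \<longleftrightarrow> (\<exists>t\<in>sym_tableaux \<mu> A. Q (polytabloid \<mu> A t) \<noteq> 0)"
  proof
    assume "\<exists>t\<in>sym_tableaux \<mu> A. Q (polytabloid \<mu> A t) \<noteq> 0"
    then show "\<exists>v\<in>?V. Q v \<noteq> 0" unfolding specht_module_def by (blast intro: cfun.span_base)
  next
    assume v: "\<exists>v\<in>?V. Q v \<noteq> 0"
    interpret Q: Vector_Spaces.linear "\<lambda>a f x. a * f x" "\<lambda>a f x. a * f x" Q
      unfolding Q_def by (intro cfun_linear_sum_of_maps lin)
    show "\<exists>t\<in>sym_tableaux \<mu> A. Q (polytabloid \<mu> A t) \<noteq> 0"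
      using v Q.eq_0_on_span[of ?T] unfolding specht_module_def by blast
  qed
  ultimately show ?thesis unfolding sym_char_def Q_def by simp
qed

text \<open>If two entries of a column had equal labels, their transposition \<open>\<tau>\<close>
  would lie in both the label stabiliser and the column stabiliser. The first leaves the sum
  unchanged under \<open>p \<mapsto> p \<circ> \<tau>\<close>, the second turns the polytabloid into
  its negative, so the sum would be its own negative.\<close>

lemma label_sum_nonzero_imp_column_distinct:
  assumes A: "finite A" and t: "t \<in> sym_tableaux \<mu> A"
    and nz: "(\<Sum>p\<in>label_stabilizer A \<rho>. tabloid_perm \<mu> A p (polytabloid \<mu> A t)) \<noteq> 0"
    and b: "b \<in> diagram \<mu>" "b' \<in> diagram \<mu>" "snd b = snd b'" "b \<noteq> b'"
  shows "\<rho> (t b) \<noteq> \<rho> (t b')"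
proof
  assume eq: "\<rho> (t b) = \<rho> (t b')"
  let ?C = "column_stabilizer \<mu> A t" and ?e = "polytabloid \<mu> A t" and ?K = "label_stabilizer A \<rho>"
  define \<tau> where "\<tau> = transpose (t b) (t b')"
  have bij: "bij_betw t (diagram \<mu>) A" using t by (simp add: sym_tableaux_def)
  have tA: "t b \<in> A" "t b' \<in> A" using bij b by (auto simp: bij_betw_def)
  have ne: "t b \<noteq> t b'" using bij b by (auto simp: bij_betw_def inj_on_def)
  have \<tau>: "\<tau> permutes A" using tA by (simp add: \<tau>_def permutes_swap_id)
  have \<tau>K: "\<tau> \<in> ?K" using \<tau> eq by (auto simp: label_stabilizer_def \<tau>_def transpose_def)
  have \<tau>C: "\<tau> \<in> ?C"
  proof -
    have "\<tau> ` Z = Z" if "t b \<in> Z \<longleftrightarrow> t b' \<in> Z" for Z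
      using that by (auto simp: \<tau>_def transpose_def image_iff) 
    moreover have "t b \<in> t ` {x \<in> diagram \<mu>. snd x = c} \<longleftrightarrow> t b' \<in> t ` {x \<in> diagram \<mu>. snd x = c}" for c
      using inj_on_image_mem_iff[OF bij_betw_imp_inj_on[OF bij], of _ "{x \<in> diagram \<mu>. snd x = c}"] b by auto
    ultimately show ?thesis using \<tau> by (simp add: column_stabilizer_def)
  qed
  have \<tau>\<tau>: "\<tau> \<circ> \<tau> = id" by (simp add: \<tau>_def)
  have comp: "\<tau> \<circ> q \<in> ?C" if q: "q \<in> ?C" for q
  proof -
    have "(\<tau> \<circ> q) ` t ` {x \<in> diagram \<mu>. snd x = c} = t ` {x \<in> diagram \<mu>. snd x = c}" for c
      unfolding image_comp[of \<tau> q, symmetric] using q \<tau>C by (simp only: column_stabilizer_def mem_Collect_eq)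
    then show ?thesis using q \<tau> by (simp add: column_stabilizer_def permutes_compose)
  qed
  \<comment> \<open>Left multiplication by \<open>\<tau>\<close> permutes the column stabiliser and
    reverses every sign.\<close>
  have "tabloid_perm \<mu> A \<tau> ?e X = - ?e X" for X
  proof -
    have sg: "sign (\<tau> \<circ> q) = - sign q" if "q \<in> ?C" for q
      using sign_compose_permutes[OF A \<tau> column_stabilizer_permutes[OF that]] ne
      by (simp add: \<tau>_def sign_swap_id)
    have "tabloid_perm \<mu> A \<tau> ?e X =
        (\<Sum>q\<in>?C. if X = sym_tabloid \<mu> A (compose (diagram \<mu>) q t) then of_int (- sign q) else 0)"
      unfolding tabloid_perm_polytabloid[OF A t \<tau>]
      by (rule sum.reindex_bij_witness[where i = "\<lambda>q. \<tau> \<circ> q" and j = "\<lambda>q. \<tau> \<circ> q"])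
         (use comp sg in \<open>auto simp: o_assoc \<tau>\<tau>\<close>)
    also have "\<dots> = - ?e X" unfolding polytabloid_def sum_negf[symmetric] by (intro sum.cong) auto
    finally show ?thesis .
  qed
  then have \<tau>e: "tabloid_perm \<mu> A \<tau> ?e = (\<lambda>X. (-1) * ?e X)" by auto
  have neg: "tabloid_perm \<mu> A p (\<lambda>X. (-1) * v X) = - tabloid_perm \<mu> A p v" for p v
    by (auto simp: tabloid_perm_def fun_eq_iff sum_negf[symmetric] intro!: sum.cong)
  have "(\<Sum>p\<in>?K. tabloid_perm \<mu> A p ?e) = (\<Sum>p\<in>?K. tabloid_perm \<mu> A (p \<circ> \<tau>) ?e)"
    by (rule sum_label_stabilizer_shift(2)[OF \<tau>K, symmetric])
  also have "\<dots> = (\<Sum>p\<in>?K. tabloid_perm \<mu> A p (tabloid_perm \<mu> A \<tau> ?e))"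
    by (simp add: tabloid_perm_compose[OF A \<tau>])
  also have "\<dots> = - (\<Sum>p\<in>?K. tabloid_perm \<mu> A p ?e)" unfolding \<tau>e neg by (rule sum_negf)
  finally have "(\<Sum>p\<in>?K. tabloid_perm \<mu> A p ?e) = - (\<Sum>p\<in>?K. tabloid_perm \<mu> A p ?e)" .
  then have "(\<Sum>p\<in>?K. tabloid_perm \<mu> A p ?e) = 0" by (simp add: fun_eq_iff)
  then show False using nz by simp
qed

text \<open>If \<open>p \<circ> q\<close> fixes the tabloid of \<open>t\<close>, then \<open>q\<close> keeps the sum of the labels in every row, whereas
  in the first row that \<open>q\<close> does not fix it could only increase labels.\<close>

lemma column_strict_imp_trivial:
  fixes key :: "'r \<Rightarrow> nat"
  assumes A: "finite A" and t: "t \<in> sym_tableaux \<mu> A"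
    and strict: "\<And>r r' c. r < r' \<Longrightarrow> (r, c) \<in> diagram \<mu> \<Longrightarrow> (r', c) \<in> diagram \<mu> \<Longrightarrow>
        key (\<rho> (t (r, c))) < key (\<rho> (t (r', c)))"
    and p: "p \<in> label_stabilizer A \<rho>" and q: "q \<in> column_stabilizer \<mu> A t"
    and eq: "sym_tabloid \<mu> A t = sym_tabloid \<mu> A (compose (diagram \<mu>) (p \<circ> q) t)"
  shows "q = id"
proof -
  let ?D = "diagram \<mu>" and ?k = "\<lambda>a. key (\<rho> a)"
  have bij: "bij_betw t ?D A" and tinj: "inj_on t ?D" using t by (auto simp: sym_tableaux_def bij_betw_def)
  have tA: "t b \<in> A" if "b \<in> ?D" for b using bij that by (auto simp: bij_betw_def)
  have pp: "p permutes A" using p by (simp add: label_stabilizer_def)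
  have qp: "q permutes A" by (rule column_stabilizer_permutes[OF q])
  have finD: "finite ?D" using bij A bij_betw_finite by blast
  have rows: "t ` {b \<in> ?D. fst b = r} = (p \<circ> q \<circ> t) ` {b \<in> ?D. fst b = r}" for r
    using eq row_class_eq_iff[OF t sym_tableau_compose[OF t permutes_compose[OF qp pp]]]
    by (simp add: sym_tabloid_def compose_row image_comp)
  \<comment> \<open>Rows are handled from the top, so that all rows above \<open>r\<close> are
    already fixed by \<open>q\<close>.\<close>
  have fixed: "\<forall>c. (r, c) \<in> ?D \<longrightarrow> q (t (r, c)) = t (r, c)" for r
  proof (induction r rule: less_induct)
    case (less r)
    let ?R = "{b \<in> ?D. fst b = r}"
    \<comment> \<open>\<open>q\<close> keeps the column. It cannot send the entry into a higher row,
      whose entries are fixed by \<open>q\<close> and hence are images of themselves only; a lower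
      row carries a strictly larger key.\<close>
    have moved: "?k (t b) < ?k (q (t b)) \<or> q (t b) = t b" if b: "b \<in> ?R" for b
    proof -
      obtain c where bc: "b = (r, c)" using b by (cases b) auto
      have "q (t b) \<in> q ` (t ` {b \<in> ?D. snd b = c})" using b bc by auto
      then have "q (t b) \<in> t ` {b \<in> ?D. snd b = c}" using q by (simp add: column_stabilizer_def)
      then obtain r'' where r'': "(r'', c) \<in> ?D" "q (t b) = t (r'', c)" by auto
      have "\<not> r'' < r"
      proof
        assume "r'' < r"
        then have "q (t (r'', c)) = q (t b)" using less r'' by simp
        then have "t (r'', c) = t b" using permutes_inj[OF qp] by (simp add: inj_eq)
        then show False using \<open>r'' < r\<close> tinj r'' b bc by (auto simp: inj_on_def)
      qed
      then show ?thesis using strict[of r r'' c] r'' b bc by (cases "r = r''") auto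
    qed
    \<comment> \<open>\<open>p\<close> does not change labels and \<open>p \<circ> q\<close> maps
      the entries of the row onto themselves, so the total key of the row is preserved.\<close>
    have "(\<Sum>b\<in>?R. ?k (q (t b))) = (\<Sum>b\<in>?R. ?k ((p \<circ> q \<circ> t) b))"
      using p tA permutes_in_image[OF qp] by (intro sum.cong refl) (auto simp: label_stabilizer_def)
    also have "\<dots> = (\<Sum>e\<in>(p \<circ> q \<circ> t) ` ?R. ?k e)"
    proof (subst sum.reindex)
      have "inj_on t ?R" using tinj by (rule inj_on_subset) auto
      then show "inj_on (p \<circ> q \<circ> t) ?R"
        by (intro comp_inj_on inj_on_subset[OF permutes_inj[OF qp]] inj_on_subset[OF permutes_inj[OF pp]]) auto
    qed simp
    also have "\<dots> = (\<Sum>e\<in>t ` ?R. ?k e)" unfolding rows[symmetric] ..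
    also have "\<dots> = (\<Sum>b\<in>?R. ?k (t b))"
      using inj_on_subset[OF tinj] by (subst sum.reindex) auto
    finally have sums: "(\<Sum>b\<in>?R. ?k (q (t b))) = (\<Sum>b\<in>?R. ?k (t b))" .
    have "q (t b) = t b" if "b \<in> ?R" for b
    proof (rule ccontr)
      assume "q (t b) \<noteq> t b"
      then have "(\<Sum>b\<in>?R. ?k (t b)) < (\<Sum>b\<in>?R. ?k (q (t b)))"
        using moved[OF that] that finD
        by (intro sum_strict_mono_ex1 ballI bexI[OF _ that]) (use moved in \<open>force simp: less_imp_le\<close>)+
      then show False using sums by simp
    qed
    then show ?case by auto
  qed
  show ?thesis
  proof
    fix a show "q a = id a"
    proof (cases "a \<in> A")
      case True
      then obtain r c where "(r, c) \<in> ?D" "a = t (r, c)" using bij by (auto simp: bij_betw_def)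
      then show ?thesis using fixed by auto
    qed (use qp in \<open>auto simp: permutes_def\<close>)
  qed
qed

text \<open>In the coefficient of the tabloid of \<open>t\<close> itself only \<open>q = id\<close>
  survives, with sign 1. The coefficient thus counts the \<open>p\<close> fixing this tabloid, and
  the identity is one of them.\<close>

lemma column_strict_imp_label_sum_nonzero:
  fixes key :: "'r \<Rightarrow> nat"
  assumes A: "finite A" and t: "t \<in> sym_tableaux \<mu> A"
    and strict: "\<And>r r' c. r < r' \<Longrightarrow> (r, c) \<in> diagram \<mu> \<Longrightarrow> (r', c) \<in> diagram \<mu> \<Longrightarrow>
        key (\<rho> (t (r, c))) < key (\<rho> (t (r', c)))"
  shows "(\<Sum>p\<in>label_stabilizer A \<rho>. tabloid_perm \<mu> A p (polytabloid \<mu> A t)) \<noteq> 0"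
proof
  let ?K = "label_stabilizer A \<rho>" and ?C = "column_stabilizer \<mu> A t" and ?X = "sym_tabloid \<mu> A t"
    and ?c = "compose (diagram \<mu>)"
  assume zero: "(\<Sum>p\<in>?K. tabloid_perm \<mu> A p (polytabloid \<mu> A t)) = 0"
  have "tabloid_perm \<mu> A p (polytabloid \<mu> A t) ?X = (if ?X = sym_tabloid \<mu> A (?c p t) then 1 else 0)"
    if p: "p \<in> ?K" for p
  proof -
    have pp: "p permutes A" using p by (simp add: label_stabilizer_def)
    have "tabloid_perm \<mu> A p (polytabloid \<mu> A t) ?X =
        (\<Sum>q\<in>?C. if q = id then (if ?X = sym_tabloid \<mu> A (?c p t) then 1 else 0) else 0)"
      unfolding tabloid_perm_polytabloid[OF A t pp]
    proof (rule sum.cong[OF refl])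
      fix q assume q: "q \<in> ?C"
      have "?X = sym_tabloid \<mu> A (?c (p \<circ> q) t) \<longrightarrow> q = id"
        using column_strict_imp_trivial[OF A t, of key \<rho>, OF strict p q] by simp
      then show "(if ?X = sym_tabloid \<mu> A (?c (p \<circ> q) t) then of_int (sign q) else 0) =
          (if q = id then (if ?X = sym_tabloid \<mu> A (?c p t) then 1 else 0) else (0::complex))"
        by (cases "q = id") (simp_all add: sign_id)
    qed
    then show ?thesis using finite_column_stabilizer[OF A, of \<mu> t] id_in_column_stabilizer[of \<mu> A t] by simp
  qed
  then have "(\<Sum>p\<in>?K. tabloid_perm \<mu> A p (polytabloid \<mu> A t)) ?X =
      (\<Sum>p\<in>?K. if ?X = sym_tabloid \<mu> A (?c p t) then 1 else 0)" by (simp add: sum_fun_apply)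
  also have "\<dots> = of_nat (card {p \<in> ?K. ?X = sym_tabloid \<mu> A (?c p t)})"
    using finite_label_stabilizer[OF A, of \<rho>] by (simp add: sum.If_cases Int_def)
  finally have "card {p \<in> ?K. ?X = sym_tabloid \<mu> A (?c p t)} = 0" using zero by simp
  moreover have "id \<in> {p \<in> ?K. ?X = sym_tabloid \<mu> A (?c p t)}"
    using sym_tableau_compose_id[OF t] id_in_label_stabilizer by simp
  ultimately show False using finite_label_stabilizer[OF A, of \<rho>] by auto
qed

section \<open>Fillings of a diagram and dominance\<close>

text \<open>Fibres of equal size are matched one by one and the bijections glued. This turns a mere
  count of labels or colours into an actual tableau or permutation.\<close>

lemma bij_betw_matching_fibres:
  assumes "finite I" "finite R" and c: "\<And>k. card {i \<in> I. f i = k} = card {r \<in> R. g r = k}"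
  shows "\<exists>\<beta>. bij_betw \<beta> I R \<and> (\<forall>i\<in>I. g (\<beta> i) = f i)"
proof -
  have "\<exists>h. bij_betw h {i \<in> I. f i = k} {r \<in> R. g r = k}" for k
    using assms by (intro finite_same_card_bij) auto
  then obtain h where h: "\<And>k. bij_betw (h k) {i \<in> I. f i = k} {r \<in> R. g r = k}" by metis
  let ?\<beta> = "\<lambda>i. h (f i) i"
  have im: "?\<beta> i \<in> R \<and> g (?\<beta> i) = f i" if "i \<in> I" for i
    using h[of "f i"] that by (auto simp: bij_betw_def)
  have "inj_on ?\<beta> I"
  proof (rule inj_onI)
    fix i j assume ij: "i \<in> I" "j \<in> I" "?\<beta> i = ?\<beta> j"
    then have "f i = f j" using im by metis
    then show "i = j" using ij h[of "f i"] by (auto simp: bij_betw_def inj_on_def)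
  qed
  moreover have "R \<subseteq> ?\<beta> ` I"
  proof
    fix r assume "r \<in> R"
    then have "r \<in> h (g r) ` {i \<in> I. f i = g r}" using h[of "g r"] by (auto simp: bij_betw_def)
    then obtain x where x: "x \<in> I" "f x = g r" "r = h (g r) x" by auto
    then have "r = ?\<beta> x" by simp
    then show "r \<in> ?\<beta> ` I" using x(1) by (rule image_eqI)
  qed
  ultimately have "bij_betw ?\<beta> I R" using im by (auto simp: bij_betw_def)
  then show ?thesis using im by (intro exI[of _ ?\<beta>]) auto
qed

text \<open>The conjugate partition.\<close>

definition col_height :: "(nat \<Rightarrow> nat) \<Rightarrow> nat \<Rightarrow> nat" where
  "col_height \<mu> c = card {r. c < \<mu> r}"

text \<open>The rows meeting a column form an initial segment, because \<mu> is weakly decreasing;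
  membership is therefore a comparison with the height.\<close>

lemma in_column_iff:
  assumes "\<mu> \<in> Par" shows "c < \<mu> r \<longleftrightarrow> r < col_height \<mu> c"
proof -
  have anti: "antimono \<mu>" and "finite {r. \<mu> r \<noteq> 0}" using assms by (auto simp: Par_def)
  then have fin: "finite {r. c < \<mu> r}" by (auto elim: rev_finite_subset)
  have down: "s \<in> {r. c < \<mu> r}" if "r \<in> {r. c < \<mu> r}" "s \<le> r" for r s
    using that anti by (auto simp: antimono_def dest: spec[of _ s] intro: less_le_trans)
  show ?thesis
  proof
    assume "c < \<mu> r"
    then have "{..r} \<subseteq> {r. c < \<mu> r}" using down[of r] by auto
    then have "card {..r} \<le> col_height \<mu> c" unfolding col_height_def by (rule card_mono[OF fin])
    then show "r < col_height \<mu> c" by simp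
  next
    assume r: "r < col_height \<mu> c"
    show "c < \<mu> r"
    proof (rule ccontr)
      assume n: "\<not> c < \<mu> r"
      have "{r. c < \<mu> r} \<subseteq> {..<r}"
      proof
        fix s assume "s \<in> {r. c < \<mu> r}"
        then show "s \<in> {..<r}" using down[of s r] n by (cases "s < r") auto
      qed
      then have "col_height \<mu> c \<le> card {..<r}" unfolding col_height_def by (intro card_mono) auto
      then show False using r by simp
    qed
  qed
qed

lemma diagram_columns:
  assumes "\<mu> \<in> Par" shows "diagram \<mu> = {(r, c). c < \<mu> 0 \<and> r < col_height \<mu> c}"
proof -
  have "c < \<mu> r \<Longrightarrow> c < \<mu> 0" for r c
    using in_column_iff[OF assms, of c] by fastforce
  then show ?thesis by (auto simp: diagram_def in_column_iff[OF assms, symmetric])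
qed

lemma card_diagram_columns:
  assumes "\<mu> \<in> Par"
  shows "card {b \<in> diagram \<mu>. Q b} = (\<Sum>c<\<mu> 0. card {r. r < col_height \<mu> c \<and> Q (r, c)})"
proof -
  have "{b \<in> diagram \<mu>. Q b} = prod.swap ` (SIGMA c:{..<\<mu> 0}. {r. r < col_height \<mu> c \<and> Q (r, c)})"
    by (auto simp: diagram_columns[OF assms] image_iff)
  then have "card {b \<in> diagram \<mu>. Q b} = card (SIGMA c:{..<\<mu> 0}. {r. r < col_height \<mu> c \<and> Q (r, c)})"
    by (simp add: card_image)
  then show ?thesis by simp
qed

lemma card_diagram_rows: "card {b \<in> diagram \<mu>. fst b < m} = (\<Sum>r<m. \<mu> r)"
proof -
  have "{b \<in> diagram \<mu>. fst b < m} = (SIGMA r:{..<m}. {..<\<mu> r})" by (auto simp: diagram_def)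
  then show ?thesis by simp
qed

lemma finite_diagram: "\<mu> \<in> Par \<Longrightarrow> finite (diagram \<mu>)"
  by (rule finite_subset[of _ "(SIGMA r:{r. \<mu> r \<noteq> 0}. {..<\<mu> r})"]) (auto simp: diagram_def Par_def)

lemma card_diagram: "\<mu> \<in> Par \<Longrightarrow> card (diagram \<mu>) = psize \<mu>"
proof -
  assume "\<mu> \<in> Par"
  moreover have "diagram \<mu> = (SIGMA r:{r. \<mu> r \<noteq> 0}. {..<\<mu> r})" by (auto simp: diagram_def)
  ultimately show ?thesis by (simp add: psize_def Par_def)
qed

text \<open>A filling of the diagram with distinct entries in every column is given up to the order in the
  columns by the set of entries \<open>S c\<close> of every column \<open>c\<close>.\<close>

definition column_realizable :: "(nat \<Rightarrow> nat) \<Rightarrow> (nat \<Rightarrow> nat) \<Rightarrow> bool" where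
  "column_realizable h m \<longleftrightarrow> (\<exists>S. (\<forall>c. finite (S c) \<and> card (S c) = h c) \<and>
     (\<forall>i. finite {c. i \<in> S c} \<and> card {c. i \<in> S c} = m i))"

text \<open>The exchange step of the Gale-Ryser theorem: as \<open>a\<close> occurs in more columns
  than \<open>b\<close>, some column contains \<open>a\<close> but not \<open>b\<close>, and there
  \<open>a\<close> is replaced by \<open>b\<close>. Column heights do not change.\<close>

lemma column_realizable_transfer:
  assumes m: "column_realizable h m" and ab: "m b < m a"
  shows "column_realizable h (m(a := m a - 1, b := m b + 1))"
proof -
  obtain S where S: "\<And>c. finite (S c)" "\<And>c. card (S c) = h c"
    "\<And>i. finite {c. i \<in> S c}" "\<And>i. card {c. i \<in> S c} = m i"
    using m unfolding column_realizable_def by blast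
  have "\<not> {c. a \<in> S c} \<subseteq> {c. b \<in> S c}"
    using card_mono[OF S(3)[of b], of "{c. a \<in> S c}"] S(4) ab by auto
  then obtain c0 where c0: "a \<in> S c0" "b \<notin> S c0" by auto
  have ne: "a \<noteq> b" using ab by auto
  define S' where "S' = S(c0 := insert b (S c0 - {a}))"
  have "finite (S' c) \<and> card (S' c) = h c" for c
  proof -
    have "card (insert b (S c0 - {a})) = card (S c0)"
      using c0 S(1)[of c0] card_Suc_Diff1[OF S(1) c0(1)] by simp
    then show ?thesis using S(1,2) by (simp add: S'_def)
  qed
  moreover have "finite {c. i \<in> S' c} \<and> card {c. i \<in> S' c} = (m(a := m a - 1, b := m b + 1)) i" for i
  proof -
    have "{c. i \<in> S' c} = (if i = a then {c. a \<in> S c} - {c0} else if i = b then insert c0 {c. b \<in> S c} else {c. i \<in> S c})"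
      using c0 ne by (auto simp: S'_def)
    then show ?thesis using S(3,4) c0 ne by (simp add: card_Diff_singleton)
  qed
  ultimately show ?thesis unfolding column_realizable_def by blast
qed

text \<open>Single units are moved from rows with an excess to later rows with a deficit until
  \<open>m\<close> equals \<mu>; the induction is on the total excess, expressed by truncated
  subtraction. Intermediate \<open>m\<close> may fail to be weakly decreasing, so monotonicity is
  imposed on \<mu> alone.\<close>

lemma column_realizable_dominated:
  assumes "column_realizable h m" and \<mu>: "antimono \<mu>"
    and "\<And>i. i \<ge> L \<Longrightarrow> m i = 0" and \<mu>L: "\<And>i. i \<ge> L \<Longrightarrow> \<mu> i = 0"
    and "\<mu> \<unlhd>\<^sub>d m" and "(\<Sum>i<L. m i) = (\<Sum>i<L. \<mu> i)"
  shows "column_realizable h \<mu>"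
  using assms(1,3,5,6)
proof (induction "\<Sum>i<L. m i - \<mu> i" arbitrary: m rule: less_induct)
  case less
  note mL = less.prems(2) and dom = less.prems(3) and tot = less.prems(4)
  show ?case
  proof (cases "\<exists>b. m b < \<mu> b")
    case False
    then have ge: "\<mu> i \<le> m i" for i by (simp add: not_less)
    have "m i = \<mu> i" for i
    proof (cases "i < L")
      case True
      show ?thesis
      proof (rule ccontr)
        assume "m i \<noteq> \<mu> i"
        then have "(\<Sum>i<L. \<mu> i) < (\<Sum>i<L. m i)"
          using ge True by (intro sum_strict_mono_ex1) (auto intro!: bexI[of _ i] simp: le_neq_implies_less)
        then show False using tot by simp
      qed
    qed (use mL \<mu>L in auto)
    then have "m = \<mu>" by (simp add: fun_eq_iff)
    then show ?thesis using less.prems(1) by simp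
  next
    case True
    \<comment> \<open>With \<open>b\<close> the first deficient row, dominance forces an earlier row
      \<open>a\<close> with an excess. Then \<open>m b < \<mu> b \<le> \<mu> a < m a\<close>, so the
      exchange applies.\<close>
    define b where "b = (LEAST b. m b < \<mu> b)"
    have b: "m b < \<mu> b" unfolding b_def using True by (rule LeastI_ex)
    have below: "\<mu> i \<le> m i" if "i < b" for i using not_less_Least[of i "\<lambda>b. m b < \<mu> b"] that by (simp add: b_def)
    have bL: "b < L" using b \<mu>L[of b] by (cases "b < L") auto
    obtain a where a: "a < b" "\<mu> a < m a"
    proof (rule ccontr)
      assume "\<not> thesis"
      then have "m i \<le> \<mu> i" if "i < b" for i using that \<open>\<not> thesis\<close> not_less \<open>\<And>a. a < b \<Longrightarrow> \<mu> a < m a \<Longrightarrow> thesis\<close> by blast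
      then have "(\<Sum>i<b. m i) \<le> (\<Sum>i<b. \<mu> i)" by (intro sum_mono) auto
      then have "(\<Sum>i<Suc b. m i) < (\<Sum>i<Suc b. \<mu> i)" using b by simp
      moreover have "(\<Sum>i<Suc b. \<mu> i) \<le> (\<Sum>i<Suc b. m i)" using dom unfolding dominated_def by blast
      ultimately show False by simp
    qed
    have "\<mu> b \<le> \<mu> a" using \<mu> a(1) by (simp add: antimono_def)
    then have ab: "m b < m a" using a b by simp
    define m' where "m' = m(a := m a - 1, b := m b + 1)"
    have m'i: "int (m' i) = int (m i) - (if i = a then 1 else 0) + (if i = b then 1 else 0)" for i
      using a by (auto simp: m'_def of_nat_diff)
    have summ': "int (\<Sum>i<k. m' i) = int (\<Sum>i<k. m i) - (if a < k then 1 else 0) + (if b < k then 1 else 0)" for k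
      by (simp add: m'i sum.distrib sum_subtractf)
    have "column_realizable h m'" unfolding m'_def by (rule column_realizable_transfer[OF less.prems(1) ab])
    moreover have "m' i = 0" if "i \<ge> L" for i using mL[OF that] that bL a(1) by (auto simp: m'_def)
    moreover have "\<mu> \<unlhd>\<^sub>d m'"
      unfolding dominated_def
    proof
      fix k
      have 1: "(\<Sum>i<k. \<mu> i) \<le> (\<Sum>i<k. m i)" using dom by (simp add: dominated_def)
      show "(\<Sum>i<k. \<mu> i) \<le> (\<Sum>i<k. m' i)"
      \<comment> \<open>Only for these \<open>k\<close> does the partial sum drop, by one. There it
        had room: no row before \<open>b\<close> is deficient, and \<open>a\<close> has an
        excess.\<close>
      proof (cases "a < k \<and> k \<le> b")
        case True
        have "(\<Sum>i<k. \<mu> i) < (\<Sum>i<k. m i)"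
          using True below a by (intro sum_strict_mono_ex1) (auto intro!: bexI[of _ a])
        then show ?thesis using summ'[of k] True by (simp del: of_nat_sum)
      next
        case False
        then show ?thesis using summ'[of k] 1 a(1) by (auto simp del: of_nat_sum split: if_splits)
      qed
    qed
    moreover have "(\<Sum>i<L. m' i) = (\<Sum>i<L. \<mu> i)" using summ'[of L] tot bL a(1) by (simp del: of_nat_sum)
    \<comment> \<open>Row \<open>b\<close> has no excess even after receiving a unit, whereas the
      excess of row \<open>a\<close> decreases.\<close>
    moreover have "(\<Sum>i<L. m' i - \<mu> i) < (\<Sum>i<L. m i - \<mu> i)"
    proof (rule sum_strict_mono_ex1)
      show "\<forall>i\<in>{..<L}. m' i - \<mu> i \<le> m i - \<mu> i" using b by (auto simp: m'_def)
      show "\<exists>i\<in>{..<L}. m' i - \<mu> i < m i - \<mu> i"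
        using a bL by (intro bexI[of _ a]) (auto simp: m'_def)
    qed simp
    ultimately show ?thesis using less.hyps[of m'] by blast
  qed
qed

text \<open>The filling of each box by its row index; it is the start of the exchange
  process.\<close>

lemma column_realizable_refl:
  assumes "\<mu> \<in> Par" shows "column_realizable (col_height \<mu>) \<mu>"
  unfolding column_realizable_def
proof (intro exI[of _ "\<lambda>c. {..<col_height \<mu> c}"] conjI allI)
  fix i
  have "{c. i \<in> {..<col_height \<mu> c}} = {..<\<mu> i}" by (auto simp: in_column_iff[OF assms, symmetric])
  then show "finite {c. i \<in> {..<col_height \<mu> c}}" "card {c. i \<in> {..<col_height \<mu> c}} = \<mu> i" by auto
qed auto

text \<open>Every column lists its set \<open>S c\<close> in increasing order. Rows are left
  unordered, so the filling need not be semistandard, but strict columns are all that the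
  coefficient argument for polytabloids uses.\<close>

lemma column_strict_filling:
  assumes \<nu>: "\<nu> \<in> Par" and \<mu>: "column_realizable (col_height \<nu>) \<mu>"
  obtains F where "\<And>i. card {b \<in> diagram \<nu>. F b = i} = \<mu> i"
    and "\<And>r r' c. r < r' \<Longrightarrow> (r, c) \<in> diagram \<nu> \<Longrightarrow> (r', c) \<in> diagram \<nu> \<Longrightarrow> F (r, c) < (F (r', c) :: nat)"
proof -
  obtain S where S: "\<And>c. finite (S c)" "\<And>c. card (S c) = col_height \<nu> c"
    "\<And>i. finite {c. i \<in> S c}" "\<And>i. card {c. i \<in> S c} = \<mu> i"
    using \<mu> unfolding column_realizable_def by blast
  let ?l = "\<lambda>c. sorted_list_of_set (S c)"
  define F where "F b = ?l (snd b) ! fst b" for b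
  have len: "length (?l c) = col_height \<nu> c" for c by (simp add: S(2))
  have D: "(r, c) \<in> diagram \<nu> \<longleftrightarrow> r < col_height \<nu> c" for r c
    by (simp add: diagram_def in_column_iff[OF \<nu>])
  show thesis
  proof
    fix r r' c assume "r < r'" "(r, c) \<in> diagram \<nu>" "(r', c) \<in> diagram \<nu>"
    then show "F (r, c) < F (r', c)"
      using strict_sorted_list_of_set[of "S c"] len[of c] by (simp add: F_def D sorted_wrt_nth_less)
  next
    fix i
    have "card {r. r < col_height \<nu> c \<and> F (r, c) = i} = (if i \<in> S c then 1 else 0)" for c
    proof (cases "i \<in> S c")
      case True
      then obtain r where r: "r < col_height \<nu> c" "?l c ! r = i"
        using S(1)[of c] len[of c] by (metis in_set_conv_nth set_sorted_list_of_set)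
      then have "{r. r < col_height \<nu> c \<and> F (r, c) = i} = {r}"
        using distinct_sorted_list_of_set[of "S c"] len[of c] by (auto simp: F_def nth_eq_iff_index_eq)
      then show ?thesis using True by simp
    next
      case False
      then have "i \<notin> set (?l c)" using S(1)[of c] by simp
      then have "{r. r < col_height \<nu> c \<and> F (r, c) = i} = {}"
        using nth_mem[of _ "?l c"] unfolding F_def len fst_conv snd_conv by blast
      then show ?thesis using False by simp
    qed
    then have "card {b \<in> diagram \<nu>. F b = i} = (\<Sum>c<\<nu> 0. if i \<in> S c then 1 else 0)"
      using card_diagram_columns[OF \<nu>, of "\<lambda>b. F b = i"] by simp
    also have "\<dots> = card {c. c < \<nu> 0 \<and> i \<in> S c}" by (simp add: sum.If_cases Int_def)
    \<comment> \<open>A column with an entry has positive height, hence meets row 0.\<close>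
    also have "{c. c < \<nu> 0 \<and> i \<in> S c} = {c. i \<in> S c}"
    proof -
      have "c < \<nu> 0" if "i \<in> S c" for c
      proof -
        have "card (S c) \<noteq> 0" using that S(1)[of c] by auto
        then have "0 < col_height \<nu> c" using S(2)[of c] by simp
        then show ?thesis using in_column_iff[OF \<nu>, of c 0] by simp
      qed
      then show ?thesis by auto
    qed
    finally show "card {b \<in> diagram \<nu>. F b = i} = \<mu> i" by (simp add: S(4))
  qed
qed

text \<open>A column holds at most as many labels from \<open>R\<close> as the smaller of its height
  and \<open>m\<close>, which is exactly its number of boxes in the first \<open>m\<close>
  rows.\<close>

lemma column_distinct_count_le:
  assumes \<nu>: "\<nu> \<in> Par" and R: "finite R" "card R \<le> m"
    and dist: "\<And>b b'. b \<in> diagram \<nu> \<Longrightarrow> b' \<in> diagram \<nu> \<Longrightarrow> snd b = snd b' \<Longrightarrow> b \<noteq> b' \<Longrightarrow> F b \<noteq> F b'"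
  shows "card {b \<in> diagram \<nu>. F b \<in> R} \<le> (\<Sum>r<m. \<nu> r)"
proof -
  have D: "(r, c) \<in> diagram \<nu> \<longleftrightarrow> r < col_height \<nu> c" for r c
    by (simp add: diagram_def in_column_iff[OF \<nu>])
  have "card {r. r < col_height \<nu> c \<and> F (r, c) \<in> R} \<le> card {r. r < col_height \<nu> c \<and> r < m}" for c
  proof -
    have "card {r. r < col_height \<nu> c \<and> F (r, c) \<in> R} \<le> card R"
    proof (rule card_inj_on_le[OF _ _ R(1)])
      show "inj_on (\<lambda>r. F (r, c)) {r. r < col_height \<nu> c \<and> F (r, c) \<in> R}"
      proof (rule inj_onI)
        fix r r'
        assume "r \<in> {r. r < col_height \<nu> c \<and> F (r, c) \<in> R}" "r' \<in> {r. r < col_height \<nu> c \<and> F (r, c) \<in> R}"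
          "F (r, c) = F (r', c)"
        then show "r = r'" using dist[of "(r, c)" "(r', c)"] D by auto
      qed
    qed auto
    moreover have "card {r. r < col_height \<nu> c \<and> F (r, c) \<in> R} \<le> card {..<col_height \<nu> c}"
      by (intro card_mono) auto
    moreover have "{r. r < col_height \<nu> c \<and> r < m} = {..<min (col_height \<nu> c) m}" by auto
    ultimately show ?thesis using R(2) by simp
  qed
  then have "(\<Sum>c<\<nu> 0. card {r. r < col_height \<nu> c \<and> F (r, c) \<in> R}) \<le>
      (\<Sum>c<\<nu> 0. card {r. r < col_height \<nu> c \<and> fst (r, c) < m})" by (intro sum_mono) simp
  then show ?thesis
    using card_diagram_columns[OF \<nu>, of "\<lambda>b. F b \<in> R"] card_diagram_columns[OF \<nu>, of "\<lambda>b. fst b < m"]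
      card_diagram_rows[of \<nu> m] by simp
qed

section \<open>Fibre sizes as parts of a partition, and Young's rule\<close>

lemma card_union_fibres:
  assumes "finite A" "finite R"
  shows "card {a \<in> A. \<rho> a \<in> R} = (\<Sum>r\<in>R. card {a \<in> A. \<rho> a = r})"
proof -
  have "{a \<in> A. \<rho> a \<in> R} = (\<Union>r\<in>R. {a \<in> A. \<rho> a = r})" by auto
  then show ?thesis using assms by (simp only:) (subst card_UN_disjoint; auto)
qed

text \<open>Equal multiplicities of positive parts allow each nonzero row of \<mu> to be assigned
  its own label. Zero is excluded since a partition has infinitely many zero parts, while labels
  with empty fibre are arbitrary in number.\<close>

lemma parts_matching_fibres:
  fixes \<rho> :: "'e \<Rightarrow> 'r"
  assumes A: "finite A" and \<mu>: "\<mu> \<in> Par"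
    and cnt: "\<And>k. k \<ge> 1 \<Longrightarrow> card {i. \<mu> i = k} = card {r. card {a \<in> A. \<rho> a = r} = k}"
  obtains \<beta> where "bij_betw \<beta> {i. \<mu> i \<noteq> 0} (\<rho> ` A)"
    "\<And>i. \<mu> i \<noteq> 0 \<Longrightarrow> card {a \<in> A. \<rho> a = \<beta> i} = \<mu> i"
proof -
  define I where "I = {i. \<mu> i \<noteq> 0}"
  define R where "R = \<rho> ` A"
  let ?g = "\<lambda>r. card {a \<in> A. \<rho> a = r}"
  have finI: "finite I" using \<mu> by (simp add: I_def Par_def)
  have finR: "finite R" using A by (simp add: R_def)
  have R0: "r \<in> R \<longleftrightarrow> ?g r \<noteq> 0" for r using A by (auto simp: R_def)
  have "card {i \<in> I. \<mu> i = k} = card {r \<in> R. ?g r = k}" for k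
  proof (cases "k = 0")
    case False
    then have "{i \<in> I. \<mu> i = k} = {i. \<mu> i = k}" "{r \<in> R. ?g r = k} = {r. ?g r = k}" unfolding R0 by (auto simp: I_def)
    then show ?thesis using cnt[of k] False by simp
  next
    case True
    then have "{i \<in> I. \<mu> i = k} = {}" "{r \<in> R. ?g r = k} = {}" unfolding R0 by (auto simp: I_def)
    then show ?thesis by (simp only: card.empty)
  qed
  then obtain \<beta> where \<beta>: "bij_betw \<beta> I R" "\<And>i. i \<in> I \<Longrightarrow> ?g (\<beta> i) = \<mu> i"
    using bij_betw_matching_fibres[OF finI finR, of \<mu> ?g] by blast
  then show ?thesis using that unfolding I_def R_def by blast
qed

lemma psize_eq_card:
  fixes \<rho> :: "'e \<Rightarrow> 'r"
  assumes A: "finite A" and \<mu>: "\<mu> \<in> Par"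
    and cnt: "\<And>k. k \<ge> 1 \<Longrightarrow> card {i. \<mu> i = k} = card {r. card {a \<in> A. \<rho> a = r} = k}"
  shows "psize \<mu> = card A"
proof -
  obtain \<beta> where \<beta>: "bij_betw \<beta> {i. \<mu> i \<noteq> 0} (\<rho> ` A)"
    "\<And>i. \<mu> i \<noteq> 0 \<Longrightarrow> card {a \<in> A. \<rho> a = \<beta> i} = \<mu> i"
    using parts_matching_fibres[OF assms] by metis
  have "{a \<in> A. \<rho> a \<in> \<rho> ` A} = A" by auto
  then have "card A = (\<Sum>r\<in>\<rho> ` A. card {a \<in> A. \<rho> a = r})"
    using card_union_fibres[OF A, of "\<rho> ` A" \<rho>] A by simp
  also have "\<dots> = (\<Sum>i | \<mu> i \<noteq> 0. card {a \<in> A. \<rho> a = \<beta> i})"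
    by (rule sum.reindex_bij_betw[OF \<beta>(1), symmetric])
  also have "\<dots> = psize \<mu>" unfolding psize_def by (rule sum.cong) (simp_all add: \<beta>(2))
  finally show ?thesis by simp
qed

text \<open>Sorting by double conjugation: \<open>N\<close> is the conjugate of the desired
  partition, since it counts the values exceeding \<open>k\<close>, and the column heights of
  \<open>N\<close> are the sorted values.\<close>

lemma exists_partition_with_parts:
  fixes s :: "'r \<Rightarrow> nat"
  assumes fin: "finite {r. s r \<noteq> 0}"
  shows "\<exists>\<mu>\<in>Par. \<forall>k\<ge>1. card {i. \<mu> i = k} = card {r. s r = k}"
proof -
  define N where "N k = card {r. k < s r}" for k
  have finN: "finite {r. k < s r}" for k using fin by (rule rev_finite_subset) auto
  have N: "N \<in> Par"
  proof -
    have "antimono N" unfolding N_def by (auto simp: antimono_def intro!: card_mono finN)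
    moreover have "{k. N k \<noteq> 0} \<subseteq> (\<Union>r\<in>{r. s r \<noteq> 0}. {..<s r})"
    proof
      fix k assume "k \<in> {k. N k \<noteq> 0}"
      then have "card {r. k < s r} \<noteq> 0" unfolding N_def by (simp only: mem_Collect_eq not_False_eq_True)
      then have "{r. k < s r} \<noteq> {}" by (rule contrapos_nn) (simp only: card.empty)
      then obtain x where "k < s x" by blast
      then have "x \<in> {r. s r \<noteq> 0}" "k \<in> {..<s x}" by auto
      then show "k \<in> (\<Union>r\<in>{r. s r \<noteq> 0}. {..<s r})" by blast
    qed
    then have "finite {k. N k \<noteq> 0}" by (rule finite_subset) (rule finite_UN_I[OF fin], rule finite_lessThan)
    ultimately show ?thesis by (simp add: Par_def)
  qed
  let ?\<mu> = "col_height N"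
  have lt: "k < ?\<mu> i \<longleftrightarrow> i < N k" for k i using in_column_iff[OF N, of i k] by simp
  have "?\<mu> \<in> Par"
  proof -
    have "?\<mu> j \<le> ?\<mu> i" if "i \<le> j" for i j
    proof (rule ccontr)
      assume "\<not> ?\<mu> j \<le> ?\<mu> i"
      then show False using lt[of "?\<mu> i" j] lt[of "?\<mu> i" i] that by simp
    qed
    moreover have "{i. ?\<mu> i \<noteq> 0} \<subseteq> {..<N 0}" using lt[of 0] by auto
    ultimately show ?thesis by (auto simp: Par_def antimono_def intro: finite_subset)
  qed
  moreover have "card {i. ?\<mu> i = k} = card {r. s r = k}" if pos: "k \<ge> 1" for k
  proof -
    \<comment> \<open>Values equal to \<open>k\<close> exceed \<open>k - 1\<close> but not
      \<open>k\<close>, so both sides become \<open>N (k - 1) - N k\<close>.\<close>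
    obtain l where k: "k = Suc l" using pos by (cases k) auto
    have "{i. ?\<mu> i = k} = {i. l < ?\<mu> i} - {i. k < ?\<mu> i}" by (auto simp: k)
    also have "\<dots> = {..<N l} - {..<N k}" unfolding lt by auto
    finally have 1: "card {i. ?\<mu> i = k} = N l - N k" by simp
    have "{r. s r = k} = {r. l < s r} - {r. k < s r}" by (auto simp: k)
    moreover have "{r. k < s r} \<subseteq> {r. l < s r}" by (auto simp: k)
    ultimately have "card {r. s r = k} = N l - N k"
      unfolding N_def using card_Diff_subset[OF finN] by (simp only:)
    then show ?thesis using 1 by simp
  qed
  ultimately show ?thesis by blast
qed

text \<open>The support of Young's rule. The labels carry no order of their own; the bijection
  \<beta> from the rows of \<mu> to the labels in use supplies both the order for column strictness
  and the meaning of the first \<open>m\<close> parts.\<close>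

lemma sum_sym_char_nonzero_iff_dominated:
  fixes \<rho> :: "'e \<Rightarrow> 'r"
  assumes A: "finite A" and \<nu>: "\<nu> \<in> Par" "psize \<nu> = card A" and \<mu>: "\<mu> \<in> Par"
    and cnt: "\<And>k. k \<ge> 1 \<Longrightarrow> card {i. \<mu> i = k} = card {r. card {a \<in> A. \<rho> a = r} = k}"
  shows "\<exists>d::nat. (\<Sum>p\<in>label_stabilizer A \<rho>. sym_char \<nu> A p) = of_nat d \<and> (d \<noteq> 0 \<longleftrightarrow> \<mu> \<unlhd>\<^sub>d \<nu>)"
proof -
  define I where "I = {i. \<mu> i \<noteq> 0}"
  define R where "R = \<rho> ` A"
  let ?g = "\<lambda>r. card {a \<in> A. \<rho> a = r}"
  have finI: "finite I" using \<mu> by (simp add: I_def Par_def)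
  obtain \<beta> where \<beta>: "bij_betw \<beta> I R" "\<And>i. i \<in> I \<Longrightarrow> ?g (\<beta> i) = \<mu> i"
    using parts_matching_fibres[OF A \<mu> cnt] unfolding I_def R_def by auto
  have \<beta>inj: "inj_on \<beta> I" and \<beta>R: "\<beta> ` I = R" using \<beta>(1) by (auto simp: bij_betw_def)
  have sum\<mu>: "card {a \<in> A. \<rho> a \<in> \<beta> ` J} = (\<Sum>i\<in>J. \<mu> i)" if "J \<subseteq> I" for J
  proof -
    have "card {a \<in> A. \<rho> a \<in> \<beta> ` J} = (\<Sum>r\<in>\<beta> ` J. ?g r)"
      using finite_subset[OF that finI] by (intro card_union_fibres A) simp
    also have "\<dots> = (\<Sum>i\<in>J. ?g (\<beta> i))" using inj_on_subset[OF \<beta>inj that] by (simp add: sum.reindex)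
    also have "\<dots> = (\<Sum>i\<in>J. \<mu> i)" using \<beta>(2) that by (intro sum.cong) auto
    finally show ?thesis .
  qed
  have "{a \<in> A. \<rho> a \<in> R} = A" by (auto simp: R_def)
  then have cardA: "card A = (\<Sum>i\<in>I. \<mu> i)" using sum\<mu>[of I] \<beta>R by simp
  let ?Q = "\<lambda>t. \<Sum>p\<in>label_stabilizer A \<rho>. tabloid_perm \<nu> A p (polytabloid \<nu> A t)"
  have "(\<exists>t\<in>sym_tableaux \<nu> A. ?Q t \<noteq> 0) \<longleftrightarrow> \<mu> \<unlhd>\<^sub>d \<nu>"
  proof
    assume "\<exists>t\<in>sym_tableaux \<nu> A. ?Q t \<noteq> 0"
    then obtain t where t: "t \<in> sym_tableaux \<nu> A" "?Q t \<noteq> 0" by blast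
    have bij: "bij_betw t (diagram \<nu>) A" using t(1) by (simp add: sym_tableaux_def)
    show "\<mu> \<unlhd>\<^sub>d \<nu>" unfolding dominated_def
    proof
      fix m
      let ?J = "{..<m} \<inter> I"
      \<comment> \<open>Zero parts have no label, so only indices in \<open>I\<close> are kept; at
        most \<open>m\<close> labels remain.\<close>
      have "(\<Sum>i<m. \<mu> i) = (\<Sum>i\<in>?J. \<mu> i)" by (intro sum.mono_neutral_right) (auto simp: I_def)
      also have "\<dots> = card {a \<in> A. \<rho> a \<in> \<beta> ` ?J}" by (rule sum\<mu>[symmetric]) simp
      also have "{a \<in> A. \<rho> a \<in> \<beta> ` ?J} = t ` {b \<in> diagram \<nu>. \<rho> (t b) \<in> \<beta> ` ?J}"
        using bij by (auto simp: bij_betw_def)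
      also have "card \<dots> = card {b \<in> diagram \<nu>. \<rho> (t b) \<in> \<beta> ` ?J}"
        using bij by (intro card_image) (auto simp: bij_betw_def inj_on_def)
      also have "\<dots> \<le> (\<Sum>i<m. \<nu> i)"
      proof (rule column_distinct_count_le[OF \<nu>(1)])
        have "card (\<beta> ` ?J) \<le> card ?J" by (rule card_image_le) simp
        also have "\<dots> \<le> card {..<m}" by (intro card_mono) auto
        finally show "card (\<beta> ` ?J) \<le> m" by simp
      qed (use label_sum_nonzero_imp_column_distinct[OF A t] in auto)
      finally show "(\<Sum>i<m. \<mu> i) \<le> (\<Sum>i<m. \<nu> i)" .
    qed
  next
    assume dom: "\<mu> \<unlhd>\<^sub>d \<nu>"
    have finN: "finite {i. \<nu> i \<noteq> 0}" using \<nu>(1) by (simp add: Par_def)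
    \<comment> \<open>Beyond \<open>L\<close> both partitions vanish, which turns their sizes into
      sums over the same range.\<close>
    obtain L where L: "\<forall>i\<in>I \<union> {i. \<nu> i \<noteq> 0}. i < L"
      using finite_nat_set_iff_bounded[of "I \<union> {i. \<nu> i \<noteq> 0}"] finI finN by auto
    have "(\<Sum>i<L. \<mu> i) = card A"
      unfolding cardA using L by (intro sum.mono_neutral_right) (auto simp: I_def)
    moreover have "(\<Sum>i<L. \<nu> i) = card A"
      unfolding \<nu>(2)[symmetric] psize_def using L by (intro sum.mono_neutral_right) auto
    moreover have "\<nu> i = 0" "\<mu> i = 0" if "L \<le> i" for i
      using L that unfolding I_def by (metis (mono_tags) UnCI leD mem_Collect_eq)+
    ultimately have "column_realizable (col_height \<nu>) \<mu>"
      using \<mu> dom by - (rule column_realizable_dominated[OF column_realizable_refl[OF \<nu>(1)], where L = L],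
        simp_all add: Par_def)
    from column_strict_filling[OF \<nu>(1) this]
    obtain F where F: "\<And>i. card {b \<in> diagram \<nu>. F b = i} = \<mu> i"
      and strict: "\<And>r r' c. r < r' \<Longrightarrow> (r, c) \<in> diagram \<nu> \<Longrightarrow> (r', c) \<in> diagram \<nu> \<Longrightarrow> F (r, c) < (F (r', c) :: nat)"
      by metis
    have finD: "finite (diagram \<nu>)" by (rule finite_diagram[OF \<nu>(1)])
    have FI: "F b \<in> I" if "b \<in> diagram \<nu>" for b
    proof -
      have "b \<in> {b' \<in> diagram \<nu>. F b' = F b}" "finite {b' \<in> diagram \<nu>. F b' = F b}" using that finD by auto
      then have "card {b' \<in> diagram \<nu>. F b' = F b} \<noteq> 0" by (metis card_0_eq empty_iff)
      then show ?thesis by (simp add: F I_def)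
    qed
    have "card {b \<in> diagram \<nu>. \<beta> (F b) = r} = card {a \<in> A. \<rho> a = r}" for r
    proof (cases "r \<in> R")
      case True
      then obtain i where i: "i \<in> I" "r = \<beta> i" using \<beta>R by blast
      then have "{b \<in> diagram \<nu>. \<beta> (F b) = r} = {b \<in> diagram \<nu>. F b = i}"
        using FI \<beta>inj by (auto simp: inj_on_def)
      then show ?thesis using i F \<beta>(2) by simp
    next
      case False
      then have "{b \<in> diagram \<nu>. \<beta> (F b) = r} = {}" "{a \<in> A. \<rho> a = r} = {}"
        using FI \<beta>R by (auto simp: R_def)
      then show ?thesis by (simp only: card.empty)
    qed
    then obtain t0 where t0: "bij_betw t0 (diagram \<nu>) A" "\<And>b. b \<in> diagram \<nu> \<Longrightarrow> \<rho> (t0 b) = \<beta> (F b)"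
      using bij_betw_matching_fibres[OF finD A, of "\<lambda>b. \<beta> (F b)" \<rho>] by blast
    define t where "t = restrict t0 (diagram \<nu>)"
    have t: "t \<in> sym_tableaux \<nu> A"
      using t0(1) bij_betw_cong[of "diagram \<nu>" t t0 A] by (simp add: sym_tableaux_def t_def)
    \<comment> \<open>The order on labels is pulled back along \<beta>, so the key of an entry is
      its value in the column-strict filling \<open>F\<close>.\<close>
    have key: "inv_into I \<beta> (\<rho> (t b)) = F b" if "b \<in> diagram \<nu>" for b
      using that t0(2) FI \<beta>inj by (simp add: t_def)
    have "?Q t \<noteq> 0"
      by (rule column_strict_imp_label_sum_nonzero[OF A t, where key = "inv_into I \<beta>"])
        (use strict key in simp)
    then show "\<exists>t\<in>sym_tableaux \<nu> A. ?Q t \<noteq> 0" using t by blast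
  qed
  note main = this
  obtain d :: nat where
    d1: "(\<Sum>p\<in>label_stabilizer A \<rho>. sym_char \<nu> A p) = of_nat (card (label_stabilizer A \<rho>) * d)" and
    d2: "d \<noteq> 0 \<longleftrightarrow> (\<exists>t\<in>sym_tableaux \<nu> A. ?Q t \<noteq> 0)"
    using sum_sym_char_label_stabilizer[OF A, where \<rho> = \<rho> and \<mu> = \<nu>] by blast
  have "card (label_stabilizer A \<rho>) \<noteq> 0"
    using finite_label_stabilizer[OF A, of \<rho>] id_in_label_stabilizer[of A \<rho>] by auto
  then have "card (label_stabilizer A \<rho>) * d \<noteq> 0 \<longleftrightarrow> d \<noteq> 0" by simp
  also have "\<dots> \<longleftrightarrow> \<mu> \<unlhd>\<^sub>d \<nu>" using d2 main by (rule trans)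
  finally show ?thesis using d1 by blast
qed

text \<open>Recasts the criterion with \<mu> quantified inside, the form in which the arrow relation
  speaks of it. A partition with the required multiplicities always exists.\<close>

lemma sum_sym_char_label_stabilizer_nonzero_iff:
  fixes \<rho> :: "'e \<Rightarrow> 'r"
  assumes A: "finite A" and \<nu>: "\<nu> \<in> Par" "psize \<nu> = card A"
  shows "\<exists>d::nat. (\<Sum>p\<in>label_stabilizer A \<rho>. sym_char \<nu> A p) = of_nat d \<and>
    (d \<noteq> 0 \<longleftrightarrow> (\<exists>\<mu>\<in>Par. (\<forall>k\<ge>1. card {i. \<mu> i = k} = card {r. card {a \<in> A. \<rho> a = r} = k}) \<and> \<mu> \<unlhd>\<^sub>d \<nu>))"
proof -
  have "{r. card {a \<in> A. \<rho> a = r} \<noteq> 0} \<subseteq> \<rho> ` A"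
  proof
    fix r assume "r \<in> {r. card {a \<in> A. \<rho> a = r} \<noteq> 0}"
    then have "card {a \<in> A. \<rho> a = r} \<noteq> 0" by (simp only: mem_Collect_eq not_False_eq_True)
    then have "{a \<in> A. \<rho> a = r} \<noteq> {}" by (rule contrapos_nn) (simp only: card.empty)
    then show "r \<in> \<rho> ` A" by auto
  qed
  then have "finite {r. card {a \<in> A. \<rho> a = r} \<noteq> 0}" using A finite_subset by blast
  then obtain \<mu>0 where \<mu>0: "\<mu>0 \<in> Par" "\<And>k. k \<ge> 1 \<Longrightarrow> card {i. \<mu>0 i = k} = card {r. card {a \<in> A. \<rho> a = r} = k}"
    using exists_partition_with_parts[of "\<lambda>r. card {a \<in> A. \<rho> a = r}"] by blast
  obtain d :: nat where d: "(\<Sum>p\<in>label_stabilizer A \<rho>. sym_char \<nu> A p) = of_nat d" "d \<noteq> 0 \<longleftrightarrow> \<mu>0 \<unlhd>\<^sub>d \<nu>"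
    using sum_sym_char_nonzero_iff_dominated[OF A \<nu> \<mu>0] by blast
  \<comment> \<open>The character sum does not mention \<mu>, so every admissible \<mu> gives the
    same number.\<close>
  have "d \<noteq> 0" if \<mu>: "\<mu> \<in> Par" "\<forall>k\<ge>1. card {i. \<mu> i = k} = card {r. card {a \<in> A. \<rho> a = r} = k}" "\<mu> \<unlhd>\<^sub>d \<nu>" for \<mu>
  proof -
    obtain d' :: nat where "(\<Sum>p\<in>label_stabilizer A \<rho>. sym_char \<nu> A p) = of_nat d'" "d' \<noteq> 0"
      using sum_sym_char_nonzero_iff_dominated[OF A \<nu> \<mu>(1), of \<rho>] \<mu>(2,3) by blast
    then show ?thesis using d(1) by simp
  qed
  then show ?thesis using d \<mu>0 by blast
qed

section \<open>Inner products with permutation characters\<close>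

lemma (in group) mult_inv_cancel:
  assumes "z \<in> carrier G" "b \<in> carrier G"
  shows "z \<otimes> (inv z \<otimes> b) = b" "inv z \<otimes> (z \<otimes> b) = b"
  using assms by (simp_all flip: m_assoc)

lemma (in group) sum_conjugate:
  assumes z: "z \<in> carrier G"
  shows "(\<Sum>w\<in>carrier G. f (inv z \<otimes> w \<otimes> z)) = (\<Sum>w\<in>carrier G. f w)"
  by (rule sum.reindex_bij_witness[where i = "\<lambda>y. z \<otimes> y \<otimes> inv z" and j = "\<lambda>w. inv z \<otimes> w \<otimes> z"])
     (use z in \<open>simp_all add: m_assoc mult_inv_cancel\<close>)

lemma (in group) sum_translate:
  assumes z: "z \<in> carrier G"
  shows "(\<Sum>w\<in>carrier G. f (z \<otimes> w)) = (\<Sum>w\<in>carrier G. f w)"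
  by (rule sum.reindex_bij_witness[where i = "\<lambda>y. inv z \<otimes> y" and j = "\<lambda>w. z \<otimes> w"])
     (use z in \<open>simp_all add: mult_inv_cancel\<close>)

text \<open>Each induced character brings a sum over conjugators. One conjugation is absorbed into
  the other by translation, and the resulting factor \<open>order G\<close> cancels the
  normalisation of the inner product.\<close>

lemma (in group) char_inner_perm_induced:
  assumes fin: "finite (carrier G)" and Y: "Y \<subseteq> carrier G"
  shows "char_inner G (perm_char G H) (induced_char G Y \<phi>) =
    (\<Sum>x\<in>carrier G. \<Sum>y\<in>Y. if inv x \<otimes> y \<otimes> x \<in> H then cnj (\<phi> y) else 0) / (of_nat (card H) * of_nat (card Y))"
proof -
  let ?C = "carrier G"
  define h where "h u = (if u \<in> H then 1 else 0 :: complex)" for u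
  define k where "k u = (if u \<in> Y then cnj (\<phi> u) else 0)" for u
  define g where "g u = k u * (\<Sum>x\<in>?C. h (inv x \<otimes> u \<otimes> x))" for u
  \<comment> \<open>Replacing \<open>x\<close> by \<open>z \<otimes> x\<close> makes both factors
    functions of the conjugate of \<open>w\<close> by \<open>z\<close>; summing over all
    \<open>w\<close> then removes \<open>z\<close>.\<close>
  have step: "(\<Sum>w\<in>?C. (\<Sum>x\<in>?C. h (inv x \<otimes> w \<otimes> x)) * k (inv z \<otimes> w \<otimes> z)) = (\<Sum>u\<in>?C. g u)" if z: "z \<in> ?C" for z
  proof -
    have "(\<Sum>x\<in>?C. h (inv x \<otimes> w \<otimes> x)) = (\<Sum>x\<in>?C. h (inv x \<otimes> (inv z \<otimes> w \<otimes> z) \<otimes> x))" if w: "w \<in> ?C" for w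
    proof -
      have "(\<Sum>x\<in>?C. h (inv x \<otimes> w \<otimes> x)) = (\<Sum>x\<in>?C. h (inv (z \<otimes> x) \<otimes> w \<otimes> (z \<otimes> x)))"
        by (rule sum_translate[OF z, symmetric])
      also have "\<dots> = (\<Sum>x\<in>?C. h (inv x \<otimes> (inv z \<otimes> w \<otimes> z) \<otimes> x))"
        using z w by (intro sum.cong refl) (simp add: inv_mult_group m_assoc)
      finally show ?thesis .
    qed
    then have "(\<Sum>w\<in>?C. (\<Sum>x\<in>?C. h (inv x \<otimes> w \<otimes> x)) * k (inv z \<otimes> w \<otimes> z)) = (\<Sum>w\<in>?C. g (inv z \<otimes> w \<otimes> z))"
      by (intro sum.cong refl) (simp add: g_def mult.commute)
    then show ?thesis using sum_conjugate[OF z, of g] by simp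
  qed
  have pc: "perm_char G H w = (\<Sum>x\<in>?C. h (inv x \<otimes> w \<otimes> x)) / of_nat (card H)" for w
    by (simp add: perm_char_def induced_char_def h_def)
  have ic: "cnj (induced_char G Y \<phi> w) = (\<Sum>z\<in>?C. k (inv z \<otimes> w \<otimes> z)) / of_nat (card Y)" for w
    unfolding induced_char_def k_def by (simp add: if_distrib cong: if_cong)
  let ?q = "of_nat (card H) * of_nat (card Y) :: complex"
  have "(\<Sum>w\<in>?C. perm_char G H w * cnj (induced_char G Y \<phi> w)) =
      (\<Sum>w\<in>?C. (\<Sum>x\<in>?C. h (inv x \<otimes> w \<otimes> x)) * (\<Sum>z\<in>?C. k (inv z \<otimes> w \<otimes> z))) / ?q"
    by (subst sum_divide_distrib) (simp only: pc ic times_divide_times_eq)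
  also have "(\<Sum>w\<in>?C. (\<Sum>x\<in>?C. h (inv x \<otimes> w \<otimes> x)) * (\<Sum>z\<in>?C. k (inv z \<otimes> w \<otimes> z))) =
      (\<Sum>w\<in>?C. \<Sum>z\<in>?C. (\<Sum>x\<in>?C. h (inv x \<otimes> w \<otimes> x)) * k (inv z \<otimes> w \<otimes> z))"
    by (simp add: sum_distrib_left)
  also have "\<dots> = (\<Sum>z\<in>?C. \<Sum>w\<in>?C. (\<Sum>x\<in>?C. h (inv x \<otimes> w \<otimes> x)) * k (inv z \<otimes> w \<otimes> z))"
    by (rule sum.swap)
  also have "\<dots> = of_nat (order G) * (\<Sum>u\<in>?C. g u)" by (simp add: step order_def)
  also have "(\<Sum>u\<in>?C. g u) = (\<Sum>u\<in>?C. if u \<in> Y then cnj (\<phi> u) * (\<Sum>x\<in>?C. h (inv x \<otimes> u \<otimes> x)) else 0)"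
    by (intro sum.cong) (auto simp: g_def k_def)
  also have "\<dots> = (\<Sum>u\<in>Y. cnj (\<phi> u) * (\<Sum>x\<in>?C. h (inv x \<otimes> u \<otimes> x)))"
    using fin Y by (simp add: sum.If_cases Int_absorb1 flip: Int_def)
  also have "\<dots> = (\<Sum>u\<in>Y. \<Sum>x\<in>?C. if inv x \<otimes> u \<otimes> x \<in> H then cnj (\<phi> u) else 0)"
    by (intro sum.cong refl) (auto simp: sum_distrib_left h_def intro!: sum.cong)
  also have "\<dots> = (\<Sum>x\<in>?C. \<Sum>u\<in>Y. if inv x \<otimes> u \<otimes> x \<in> H then cnj (\<phi> u) else 0)" by (rule sum.swap)
  finally show ?thesis using fin order_gt_0_iff_finite by (simp add: char_inner_def)
qed

section \<open>The wreath product and its action on tabloids\<close>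

lemma wreath_carrier:
  "(f, p) \<in> carrier (wreath G n) \<longleftrightarrow> f \<in> {1..n} \<rightarrow>\<^sub>E carrier G \<and> p permutes {1..n}"
  by (simp add: wreath_def)

lemma wreath_mult:
  "(f, p) \<otimes>\<^bsub>wreath G n\<^esub> (g, s) = (\<lambda>i\<in>{1..n}. f i \<otimes>\<^bsub>G\<^esub> g (inv_into UNIV p i), p \<circ> s)"
  by (simp add: wreath_def)

lemma finite_wreath: "finite (carrier G) \<Longrightarrow> finite (carrier (wreath G n))"
  by (simp add: wreath_def finite_PiE finite_permutations)

lemma group_wreath:
  assumes "group G" shows "group (wreath G n)"
proof -
  interpret G: group G by fact
  let ?W = "wreath G n"
  have inv_in: "inv_into UNIV p i \<in> {1..n}" if "p permutes {1..n}" "i \<in> {1..n}" for p i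
    using permutes_in_image[OF permutes_inv[OF that(1)]] that(2) by simp
  have G_in: "f i \<in> carrier G" if "f \<in> {1..n} \<rightarrow>\<^sub>E carrier G" "i \<in> {1..n}" for f i
    using that by (rule PiE_mem)
  show ?thesis
  proof (rule groupI)
    fix x y assume "x \<in> carrier ?W" "y \<in> carrier ?W"
    then show "x \<otimes>\<^bsub>?W\<^esub> y \<in> carrier ?W"
      by (cases x; cases y) (auto simp: wreath_carrier wreath_mult permutes_compose G_in inv_in simp del: atLeastAtMost_iff One_nat_def)
  next
    show "\<one>\<^bsub>?W\<^esub> \<in> carrier ?W" by (auto simp: wreath_def permutes_id)
  next
    fix x y z assume "x \<in> carrier ?W" "y \<in> carrier ?W" "z \<in> carrier ?W"
    then show "x \<otimes>\<^bsub>?W\<^esub> y \<otimes>\<^bsub>?W\<^esub> z = x \<otimes>\<^bsub>?W\<^esub> (y \<otimes>\<^bsub>?W\<^esub> z)"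
      by (cases x; cases y; cases z)
        (auto simp: wreath_carrier wreath_mult fun_eq_iff restrict_def G.m_assoc G_in inv_in o_inv_distrib
          permutes_bij o_assoc simp del: atLeastAtMost_iff One_nat_def)
  next
    fix x assume x: "x \<in> carrier ?W"
    obtain f p where fp: "x = (f, p)" by (cases x)
    have f: "f \<in> {1..n} \<rightarrow>\<^sub>E carrier G" using x unfolding fp wreath_carrier by (rule conjunct1)
    have "(\<lambda>i\<in>{1..n}. \<one>\<^bsub>G\<^esub> \<otimes>\<^bsub>G\<^esub> f i) i = f i" for i
      using G_in[OF f, of i] PiE_arb[OF f, of i] by (cases "i \<in> {1..n}") (simp_all del: atLeastAtMost_iff One_nat_def)
    then have "(\<lambda>i\<in>{1..n}. \<one>\<^bsub>G\<^esub> \<otimes>\<^bsub>G\<^esub> f i) = f" by (rule ext)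
    then show "\<one>\<^bsub>?W\<^esub> \<otimes>\<^bsub>?W\<^esub> x = x"
      by (simp add: fp wreath_def inv_id cong: restrict_cong del: One_nat_def)
  next
    fix x assume x: "x \<in> carrier ?W"
    obtain f p where fp: "x = (f, p)" "f \<in> {1..n} \<rightarrow>\<^sub>E carrier G" "p permutes {1..n}"
      using x wreath_carrier[of _ _ G n] by (metis surj_pair)
    have pi: "p i \<in> {1..n}" if "i \<in> {1..n}" for i by (rule permutes_in_image[OF fp(3), THEN iffD2, OF that])
    \<comment> \<open>The base component is evaluated at \<open>p i\<close>, because the
      multiplication shifts it back along the inverse of the first permutation, here
      \<open>p\<close> itself.\<close>
    let ?y = "(\<lambda>i\<in>{1..n}. inv\<^bsub>G\<^esub> (f (p i)), inv_into UNIV p)"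
    have "?y \<in> carrier ?W"
      using fp by (auto simp: wreath_carrier permutes_inv G_in pi simp del: atLeastAtMost_iff One_nat_def)
    moreover have "?y \<otimes>\<^bsub>?W\<^esub> x = \<one>\<^bsub>?W\<^esub>"
      using fp by (auto simp: wreath_mult wreath_def fun_eq_iff restrict_def permutes_inv_o inv_inv_eq permutes_bij
          permutes_inverses G_in pi simp del: atLeastAtMost_iff One_nat_def)
    ultimately show "\<exists>y\<in>carrier ?W. y \<otimes>\<^bsub>?W\<^esub> x = \<one>\<^bsub>?W\<^esub>" by blast
  qed
qed

section \<open>The action of the wreath product on tableaux and tabloids\<close>

lemma tableau_entry:
  assumes "t \<in> tableaux G n \<sigma>" "b \<in> boxes G \<sigma>"
  shows "fst (t b) \<in> rcosets\<^bsub>G\<^esub> (fst (fst b))" "snd (t b) \<in> {1..n}" "subgroup (fst (fst b)) G"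
  using assms by (cases b; cases "fst b"; fastforce simp: tableaux_def boxes_def)+

lemma tableauxI:
  assumes "t \<in> extensional (boxes G \<sigma>)" "inj_on (\<lambda>b. snd (t b)) (boxes G \<sigma>)"
    "\<And>b. b \<in> boxes G \<sigma> \<Longrightarrow> fst (t b) \<in> rcosets\<^bsub>G\<^esub> (fst (fst b)) \<and> snd (t b) \<in> {1..n}"
  shows "t \<in> tableaux G n \<sigma>"
  using assms by (fastforce simp: tableaux_def mem_Times_iff)

lemma tableau_entry_carrier:
  assumes "group G" "t \<in> tableaux G n \<sigma>" "b \<in> boxes G \<sigma>" shows "fst (t b) \<subseteq> carrier G"
proof -
  interpret group G by fact
  interpret S: subgroup "fst (fst b)" G using tableau_entry[OF assms(2,3)] by simp
  show ?thesis using tableau_entry(1)[OF assms(2,3)] S.rcosets_carrier[OF assms(1)] by simp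
qed

text \<open>The factors translate the coset successively from the right, in the order opposite to
  that of the product; commutativity of \<open>G\<close> reconciles the two.\<close>

lemma entry_act_mult:
  assumes "comm_group G" "w \<in> carrier (wreath G n)" "w' \<in> carrier (wreath G n)" "C \<subseteq> carrier G" "i \<in> {1..n}"
  shows "entry_act G w (entry_act G w' (C, i)) = entry_act G (w \<otimes>\<^bsub>wreath G n\<^esub> w') (C, i)"
proof -
  interpret comm_group G by fact
  obtain f p g s where w: "w = (f, p)" "w' = (g, s)" by (cases w; cases w')
  have c: "f \<in> {1..n} \<rightarrow>\<^sub>E carrier G" "p permutes {1..n}" "g \<in> {1..n} \<rightarrow>\<^sub>E carrier G" "s permutes {1..n}"
    using assms(2,3) by (auto simp: w wreath_carrier)
  have "s i \<in> {1..n}" "p (s i) \<in> {1..n}"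
    using permutes_in_image[OF c(2)] permutes_in_image[OF c(4)] assms(5) by simp_all
  then have "g (s i) \<in> carrier G" "f (p (s i)) \<in> carrier G" "p (s i) \<in> {1..n}" using c PiE_mem by metis+
  then show ?thesis using assms(4)
    by (simp add: w wreath_mult coset_mult_assoc m_comm permutes_inverses[OF c(2)])
qed

lemma entry_act_one:
  assumes "group G" "C \<subseteq> carrier G" "i \<in> {1..n}"
  shows "entry_act G \<one>\<^bsub>wreath G n\<^esub> (C, i) = (C, i)"
proof -
  interpret group G by fact
  show ?thesis using assms by (simp add: wreath_def coset_mult_one)
qed

lemma tableau_act:
  assumes G: "comm_group G" and w: "w \<in> carrier (wreath G n)" and t: "t \<in> tableaux G n \<sigma>"
  shows "compose (boxes G \<sigma>) (entry_act G w) t \<in> tableaux G n \<sigma>"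
proof -
  interpret comm_group G by fact
  obtain f p where fp: "w = (f, p)" "f \<in> {1..n} \<rightarrow>\<^sub>E carrier G" "p permutes {1..n}"
    using w by (cases w) (auto simp: wreath_carrier)
  let ?t = "compose (boxes G \<sigma>) (entry_act G w) t"
  have val: "?t b = (fst (t b) #>\<^bsub>G\<^esub> f (p (snd (t b))), p (snd (t b)))" if "b \<in> boxes G \<sigma>" for b
    using that by (cases "t b") (simp add: compose_def fp(1))
  show ?thesis
  proof (rule tableauxI)
    have "inj_on (\<lambda>b. snd (t b)) (boxes G \<sigma>)" using t by (simp add: tableaux_def)
    then have "inj_on (p \<circ> (\<lambda>b. snd (t b))) (boxes G \<sigma>)"
      using inj_on_subset[OF permutes_inj[OF fp(3)]] by (intro comp_inj_on) auto
    then show "inj_on (\<lambda>b. snd (?t b)) (boxes G \<sigma>)" by (simp add: val inj_on_def)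
  next
    fix b assume b: "b \<in> boxes G \<sigma>"
    have p: "p (snd (t b)) \<in> {1..n}" by (rule permutes_in_image[OF fp(3), THEN iffD2, OF tableau_entry(2)[OF t b]])
    have U: "fst (fst b) \<subseteq> carrier G" using tableau_entry(3)[OF t b] by (rule subgroup.subset)
    obtain a where "a \<in> carrier G" "fst (t b) = fst (fst b) #>\<^bsub>G\<^esub> a"
      using tableau_entry(1)[OF t b] by (auto simp: RCOSETS_def)
    moreover have "f (p (snd (t b))) \<in> carrier G" using PiE_mem[OF fp(2) p] .
    ultimately have "fst (t b) #>\<^bsub>G\<^esub> f (p (snd (t b))) \<in> rcosets\<^bsub>G\<^esub> (fst (fst b))"
      using U by (simp add: coset_mult_assoc rcosetsI)
    then show "fst (?t b) \<in> rcosets\<^bsub>G\<^esub> (fst (fst b)) \<and> snd (?t b) \<in> {1..n}" using p by (simp add: val[OF b])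
  qed simp
qed

lemma tableau_act_mult:
  assumes G: "comm_group G" and w: "w \<in> carrier (wreath G n)" "w' \<in> carrier (wreath G n)"
    and t: "t \<in> tableaux G n \<sigma>"
  shows "compose (boxes G \<sigma>) (entry_act G w) (compose (boxes G \<sigma>) (entry_act G w') t) =
    compose (boxes G \<sigma>) (entry_act G (w \<otimes>\<^bsub>wreath G n\<^esub> w')) t"
proof
  fix b
  interpret comm_group G by fact
  show "compose (boxes G \<sigma>) (entry_act G w) (compose (boxes G \<sigma>) (entry_act G w') t) b =
    compose (boxes G \<sigma>) (entry_act G (w \<otimes>\<^bsub>wreath G n\<^esub> w')) t b"
    using entry_act_mult[OF G w tableau_entry_carrier[OF group_axioms t, of b] tableau_entry(2)[OF t, of b]]
    by (cases "b \<in> boxes G \<sigma>") (simp_all add: compose_def)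
qed

lemma tableau_act_one:
  assumes G: "group G" and t: "t \<in> tableaux G n \<sigma>"
  shows "compose (boxes G \<sigma>) (entry_act G \<one>\<^bsub>wreath G n\<^esub>) t = t"
proof
  fix b show "compose (boxes G \<sigma>) (entry_act G \<one>\<^bsub>wreath G n\<^esub>) t b = t b"
    using entry_act_one[OF G tableau_entry_carrier[OF G t, of b] tableau_entry(2)[OF t, of b]]
      extensional_arb[of t "boxes G \<sigma>" b] t
    by (cases "b \<in> boxes G \<sigma>") (simp_all add: compose_def tableaux_def)
qed

lemma tabloid_act_row_class:
  assumes G: "comm_group G" and w: "w \<in> carrier (wreath G n)" and t: "t \<in> tableaux G n \<sigma>"
  shows "tabloid_act G \<sigma> w (row_class (boxes G \<sigma>) (tableaux G n \<sigma>) t) =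
    row_class (boxes G \<sigma>) (tableaux G n \<sigma>) (compose (boxes G \<sigma>) (entry_act G w) t)"
proof -
  interpret comm_group G by fact
  interpret W: group "wreath G n" by (rule group_wreath) (rule group_axioms)
  show ?thesis
    unfolding tabloid_act_def
    by (rule compose_row_class[where f' = "entry_act G (inv\<^bsub>wreath G n\<^esub> w)"])
      (use w t in \<open>simp_all add: tableau_act[OF G] tableau_act_mult[OF G, where n = n] tableau_act_one[OF group_axioms]\<close>)
qed

lemma tabloid_act_mult:
  assumes G: "comm_group G" and w: "w \<in> carrier (wreath G n)" "w' \<in> carrier (wreath G n)"
    and X: "X \<in> tabloids G n \<sigma>"
  shows "tabloid_act G \<sigma> w (tabloid_act G \<sigma> w' X) = tabloid_act G \<sigma> (w \<otimes>\<^bsub>wreath G n\<^esub> w') X"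
proof -
  interpret comm_group G by fact
  interpret W: group "wreath G n" by (rule group_wreath) (rule group_axioms)
  obtain t where t: "t \<in> tableaux G n \<sigma>" "X = row_class (boxes G \<sigma>) (tableaux G n \<sigma>) t"
    using X by (auto simp: tabloids_def)
  show ?thesis
    using w t by (simp add: tabloid_act_row_class[OF G] tableau_act[OF G] tableau_act_mult[OF G])
qed

lemma tabloid_act_in:
  assumes G: "comm_group G" and w: "w \<in> carrier (wreath G n)" and X: "X \<in> tabloids G n \<sigma>"
  shows "tabloid_act G \<sigma> w X \<in> tabloids G n \<sigma>"
  using X by (auto simp: tabloids_def tabloid_act_row_class[OF G w] tableau_act[OF G w])

lemma tabloid_act_one:
  assumes G: "comm_group G" and X: "X \<in> tabloids G n \<sigma>"
  shows "tabloid_act G \<sigma> \<one>\<^bsub>wreath G n\<^esub> X = X"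
proof -
  interpret comm_group G by fact
  interpret W: group "wreath G n" by (rule group_wreath) (rule group_axioms)
  show ?thesis using X
    by (auto simp: tabloids_def tabloid_act_row_class[OF G W.one_closed] tableau_act_one[OF group_axioms])
qed

text \<open>A conjugate of \<open>y\<close> by \<open>x\<close> stabilises \<open>X\<close> iff
  \<open>y\<close> fixes the translate of \<open>X\<close> by \<open>x\<close>. The inner product is
  thus a positive multiple of a sum of natural numbers \<open>c\<close>, which vanishes only if
  every summand does.\<close>

lemma char_inner_stabilizer:
  fixes \<phi> :: "(nat \<Rightarrow> 'a) \<times> (nat \<Rightarrow> nat) \<Rightarrow> complex"
  assumes G: "comm_group G" "finite (carrier G)" and X: "X \<in> tabloids G n \<sigma>"
    and Y: "Y \<subseteq> carrier (wreath G n)" "Y \<noteq> {}"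
    and c: "\<And>X'. X' \<in> tabloids G n \<sigma> \<Longrightarrow> (\<Sum>y\<in>Y. if tabloid_act G \<sigma> y X' = X' then \<phi> y else 0) = of_nat (c X')"
  shows "char_inner (wreath G n) (perm_char (wreath G n) (stabilizer (wreath G n) (tabloid_act G \<sigma>) X))
      (induced_char (wreath G n) Y \<phi>) \<noteq> 0 \<longleftrightarrow> (\<exists>x\<in>carrier (wreath G n). c (tabloid_act G \<sigma> x X) \<noteq> 0)"
proof -
  interpret comm_group G by fact
  let ?W = "wreath G n" and ?act = "tabloid_act G \<sigma>"
  interpret W: group ?W by (rule group_wreath) (rule group_axioms)
  let ?H = "stabilizer ?W ?act X"
  have finW: "finite (carrier ?W)" by (rule finite_wreath[OF G(2)])
  have H: "finite ?H" "\<one>\<^bsub>?W\<^esub> \<in> ?H"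
    using finW tabloid_act_one[OF G(1) X] by (auto simp: stabilizer_def)
  have finY: "finite Y" using finW Y(1) by (rule rev_finite_subset)
  have conj: "inv\<^bsub>?W\<^esub> x \<otimes>\<^bsub>?W\<^esub> y \<otimes>\<^bsub>?W\<^esub> x \<in> ?H \<longleftrightarrow> ?act y (?act x X) = ?act x X"
    if x: "x \<in> carrier ?W" and y: "y \<in> carrier ?W" for x y
  proof -
    have "?act (inv\<^bsub>?W\<^esub> x \<otimes>\<^bsub>?W\<^esub> y \<otimes>\<^bsub>?W\<^esub> x) X = ?act (inv\<^bsub>?W\<^esub> x) (?act y (?act x X))"
      using x y X by (simp add: tabloid_act_mult[OF G(1), where n = n] tabloid_act_in[OF G(1)] W.m_assoc)
    moreover have "?act (inv\<^bsub>?W\<^esub> x) Z = X \<longleftrightarrow> Z = ?act x X" if "Z \<in> tabloids G n \<sigma>" for Z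
    proof
      assume "?act (inv\<^bsub>?W\<^esub> x) Z = X"
      then have "?act x X = ?act x (?act (inv\<^bsub>?W\<^esub> x) Z)" by simp
      then show "Z = ?act x X" using x that by (simp add: tabloid_act_mult[OF G(1), where n = n] tabloid_act_one[OF G(1)])
    next
      assume "Z = ?act x X"
      then show "?act (inv\<^bsub>?W\<^esub> x) Z = X" using x X by (simp add: tabloid_act_mult[OF G(1), where n = n] tabloid_act_one[OF G(1)])
    qed
    ultimately show ?thesis using x y X by (simp add: stabilizer_def tabloid_act_in[OF G(1)])
  qed
  have "(\<Sum>y\<in>Y. if inv\<^bsub>?W\<^esub> x \<otimes>\<^bsub>?W\<^esub> y \<otimes>\<^bsub>?W\<^esub> x \<in> ?H then cnj (\<phi> y) else 0) = of_nat (c (?act x X))"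
    if x: "x \<in> carrier ?W" for x
  proof -
    \<comment> \<open>The complex conjugation acts on the whole sum, which is a natural number and
      hence unaffected.\<close>
    have "(\<Sum>y\<in>Y. if inv\<^bsub>?W\<^esub> x \<otimes>\<^bsub>?W\<^esub> y \<otimes>\<^bsub>?W\<^esub> x \<in> ?H then cnj (\<phi> y) else 0) =
        cnj (\<Sum>y\<in>Y. if ?act y (?act x X) = ?act x X then \<phi> y else 0)"
      unfolding cnj_sum using conj[OF x] Y(1) by (intro sum.cong refl) auto
    then show ?thesis using c[OF tabloid_act_in[OF G(1) x X]] by simp
  qed
  then have "char_inner ?W (perm_char ?W ?H) (induced_char ?W Y \<phi>) =
      of_nat (\<Sum>x\<in>carrier ?W. c (?act x X)) / (of_nat (card ?H) * of_nat (card Y))"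
    using W.char_inner_perm_induced[OF finW Y(1)] by simp
  moreover have "card ?H \<noteq> 0" "card Y \<noteq> 0" using H finY Y(2) by auto
  ultimately have "char_inner ?W (perm_char ?W ?H) (induced_char ?W Y \<phi>) \<noteq> 0 \<longleftrightarrow>
      (\<Sum>x\<in>carrier ?W. c (?act x X)) \<noteq> 0" by (simp del: of_nat_sum)
  then show ?thesis using finW by simp
qed

section \<open>Sums over the stabiliser of a tabloid\<close>

lemma (in comm_group) hom_complex_units:
  assumes "\<chi> \<in> hom G complex_units"
  shows "x \<in> carrier G \<Longrightarrow> \<chi> x \<noteq> 0"
    and "x \<in> carrier G \<Longrightarrow> y \<in> carrier G \<Longrightarrow> \<chi> (x \<otimes> y) = \<chi> x * \<chi> y"
    and "\<chi> \<one> = 1"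
    and "x \<in> carrier G \<Longrightarrow> \<chi> (inv x) = inverse (\<chi> x)"
proof -
  show nz: "\<chi> x \<noteq> 0" if "x \<in> carrier G" for x
    using assms that by (auto simp: hom_def complex_units_def)
  show mult: "\<chi> (x \<otimes> y) = \<chi> x * \<chi> y" if "x \<in> carrier G" "y \<in> carrier G" for x y
    using assms that by (simp add: hom_def complex_units_def)
  show one: "\<chi> \<one> = 1" using mult[of \<one> \<one>] nz[of \<one>] by simp
  show "\<chi> (inv x) = inverse (\<chi> x)" if "x \<in> carrier G" for x
    using mult[of "inv x" x] one that by (intro inverse_unique[symmetric]) (simp add: mult.commute)
qed

text \<open>Translating by \<open>v\<close> multiplies the sum by \<open>\<chi> v\<close>; if this
  factor is not 1, the sum must vanish.\<close>

lemma (in comm_group) sum_hom_subgroup: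
  assumes \<chi>: "\<chi> \<in> hom G complex_units" and U: "subgroup U G"
  shows "(\<Sum>u\<in>U. \<chi> u) = (if \<forall>u\<in>U. \<chi> u = 1 then of_nat (card U) else 0)"
proof (cases "\<forall>u\<in>U. \<chi> u = 1")
  case False
  then obtain v where v: "v \<in> U" "\<chi> v \<noteq> 1" by blast
  interpret U: subgroup U G by (rule U)
  have "(\<Sum>u\<in>U. \<chi> u) = (\<Sum>u\<in>U. \<chi> (v \<otimes> u))"
    by (rule sum.reindex_bij_witness[where i = "\<lambda>u. v \<otimes> u" and j = "\<lambda>u. inv v \<otimes> u"])
      (use v in \<open>simp_all add: mult_inv_cancel\<close>)
  also have "\<dots> = \<chi> v * (\<Sum>u\<in>U. \<chi> u)"
    using v by (simp add: hom_complex_units(2)[OF \<chi>] sum_distrib_left)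
  finally have "(\<Sum>u\<in>U. \<chi> u) = 0" using v(2) by (metis mult_cancel_right1)
  then show ?thesis by (simp only: False if_False)
qed simp

lemma (in comm_group) r_coset_eq_iff:
  assumes U: "subgroup U G" and "x \<in> carrier G" "y \<in> carrier G"
  shows "U #> x = U #> y \<longleftrightarrow> x \<otimes> inv y \<in> U"
proof -
  have UC: "U \<subseteq> carrier G" by (rule subgroup.subset[OF U])
  have xy: "x \<otimes> inv y \<in> carrier G" using assms by simp
  have "U #> x = U #> y \<longleftrightarrow> U #> (x \<otimes> inv y) = U"
    using coset_mult_inv1[of U x y] coset_mult_inv2[of U x y] assms UC by blast
  also have "\<dots> \<longleftrightarrow> x \<otimes> inv y \<in> U"
    using coset_join1[OF _ xy U] coset_join2[OF xy U] by blast
  finally show ?thesis .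
qed

text \<open>The elements translating one coset of \<open>U\<close> to another form a coset of
  \<open>U\<close>, represented by the quotient of the representatives.\<close>

lemma (in comm_group) sum_hom_between_cosets:
  assumes \<chi>: "\<chi> \<in> hom G complex_units" and U: "subgroup U G" and a: "a \<in> carrier G" "a' \<in> carrier G"
  shows "(\<Sum>z | z \<in> carrier G \<and> U #> a = (U #> a') #> z. \<chi> z) = \<chi> a / \<chi> a' * (\<Sum>u\<in>U. \<chi> u)"
proof -
  interpret U: subgroup U G by (rule U)
  have "(\<Sum>z | z \<in> carrier G \<and> U #> a = (U #> a') #> z. \<chi> z) = (\<Sum>u\<in>U. \<chi> (u \<otimes> (inv a' \<otimes> a)))"
  proof (rule sum.reindex_bij_witness[where i = "\<lambda>u. u \<otimes> (inv a' \<otimes> a)" and j = "\<lambda>z. z \<otimes> inv (inv a' \<otimes> a)"])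
    fix z assume "z \<in> {z \<in> carrier G. U #> a = (U #> a') #> z}"
    then have z: "z \<in> carrier G" "U #> (a' \<otimes> z) = U #> a" using a U.subset by (auto simp: coset_mult_assoc)
    show "z \<otimes> inv (inv a' \<otimes> a) \<otimes> (inv a' \<otimes> a) = z" using a z(1) by (simp add: m_assoc)
    have "a' \<otimes> z \<otimes> inv a \<in> U" using z r_coset_eq_iff[OF U, of "a' \<otimes> z" a] a by simp
    moreover have "z \<otimes> inv (inv a' \<otimes> a) = a' \<otimes> z \<otimes> inv a" using a z(1) by (simp add: inv_mult_group m_ac)
    ultimately show "z \<otimes> inv (inv a' \<otimes> a) \<in> U" by simp
    show "\<chi> (z \<otimes> inv (inv a' \<otimes> a) \<otimes> (inv a' \<otimes> a)) = \<chi> z" using a z(1) by (simp add: m_assoc)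
  next
    fix u assume u: "u \<in> U"
    then have uc: "u \<in> carrier G" by simp
    show "u \<otimes> (inv a' \<otimes> a) \<otimes> inv (inv a' \<otimes> a) = u" using a uc by (simp add: m_assoc)
    have "a' \<otimes> (u \<otimes> (inv a' \<otimes> a)) = u \<otimes> a"
    proof -
      have "a' \<otimes> (u \<otimes> (inv a' \<otimes> a)) = u \<otimes> (a' \<otimes> (inv a' \<otimes> a))" using a uc by (simp add: m_lcomm)
      then show ?thesis using a by (simp add: mult_inv_cancel)
    qed
    moreover have "U #> (u \<otimes> a) = U #> a"
      using r_coset_eq_iff[OF U, of "u \<otimes> a" a] a u by (simp add: m_assoc)
    ultimately show "u \<otimes> (inv a' \<otimes> a) \<in> {z \<in> carrier G. U #> a = (U #> a') #> z}"
      using a uc U.subset by (simp add: coset_mult_assoc)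
  qed
  also have "\<dots> = (\<Sum>u\<in>U. \<chi> u * (\<chi> a / \<chi> a'))"
    using a by (intro sum.cong refl) (simp add: hom_complex_units[OF \<chi>] divide_inverse)
  also have "\<dots> = \<chi> a / \<chi> a' * (\<Sum>u\<in>U. \<chi> u)"
    unfolding sum_distrib_right[symmetric] by (rule mult.commute)
  finally show ?thesis .
qed

text \<open>A permutation that preserves every block is the same as a family of permutations of the blocks.\<close>

lemma sum_block_permutations:
  fixes F :: "'g \<Rightarrow> ('e \<Rightarrow> 'e) \<Rightarrow> complex"
  assumes A: "finite A" and P: "disjoint_family_on P A" "\<And>g. g \<in> A \<Longrightarrow> finite (P g)"
    and N: "(\<Union>g\<in>A. P g) = N"
  shows "(\<Sum>p | p permutes N \<and> (\<forall>i\<in>N. \<rho> (p i) = \<rho> i) \<and> (\<forall>g\<in>A. p ` P g = P g). \<Prod>g\<in>A. F g (perm_restrict p (P g))) =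
    (\<Prod>g\<in>A. \<Sum>q\<in>label_stabilizer (P g) \<rho>. F g q)"
proof -
  let ?K = "{p. p permutes N \<and> (\<forall>i\<in>N. \<rho> (p i) = \<rho> i) \<and> (\<forall>g\<in>A. p ` P g = P g)}"
  let ?L = "PiE A (\<lambda>g. label_stabilizer (P g) \<rho>)"
  define col where "col i = (THE g. g \<in> A \<and> i \<in> P g)" for i
  have col: "col i = g" if "g \<in> A" "i \<in> P g" for i g
    unfolding col_def using that P(1) by (intro the_equality) (auto simp: disjoint_family_on_def)
  have colN: "col i \<in> A" "i \<in> P (col i)" if "i \<in> N" for i
    using that col unfolding N[symmetric] by auto
  define j where "j p = (\<lambda>g\<in>A. perm_restrict p (P g))" for p :: "'e \<Rightarrow> 'e"
  \<comment> \<open>\<open>j\<close> restricts a permutation to the blocks and \<open>k\<close>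
    glues a family; the two are shown to be mutually inverse.\<close>
  define k where "k h i = (if i \<in> N then h (col i) i else i)" for h :: "'g \<Rightarrow> 'e \<Rightarrow> 'e" and i
  have kP: "k h i = h g i" if "g \<in> A" "i \<in> P g" for h g i
    using that col N by (auto simp: k_def)
  have kj: "k (j p) = p" if "p \<in> ?K" for p
  proof
    fix i show "k (j p) i = p i"
      using that colN[of i] permutes_not_in[of p N i] by (cases "i \<in> N") (simp_all add: k_def j_def perm_restrict_def)
  qed
  have jL: "j p \<in> ?L" if p: "p \<in> ?K" for p
  proof -
    have "perm_restrict p (P g) \<in> label_stabilizer (P g) \<rho>" if g: "g \<in> A" for g
    proof -
      have "inj_on p (P g)" using p permutes_inj inj_on_subset by blast
      then have "bij_betw p (P g) (P g)" using p g by (simp add: bij_betw_def)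
      then have "bij_betw (perm_restrict p (P g)) (P g) (P g)"
        by (subst bij_betw_cong[where g = p]) (auto simp: perm_restrict_def)
      then have "perm_restrict p (P g) permutes P g" by (rule bij_imp_permutes) (simp add: perm_restrict_def)
      then show ?thesis using p g N by (auto simp: label_stabilizer_def perm_restrict_def)
    qed
    then show ?thesis by (simp add: j_def)
  qed
  have hperm: "h g permutes P g" if "h \<in> ?L" "g \<in> A" for h g
    using PiE_mem[OF that] by (simp add: label_stabilizer_def)
  have jk: "j (k h) = h" if h: "h \<in> ?L" for h
  proof
    fix g show "j (k h) g = h g"
    proof (cases "g \<in> A")
      case True
      have "perm_restrict (k h) (P g) x = h g x" for x
        using kP[OF True] permutes_not_in[OF hperm[OF h True], of x] by (simp add: perm_restrict_def)
      then show ?thesis using True by (simp add: j_def fun_eq_iff)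
    next
      case False
      then show ?thesis using PiE_arb[OF h] by (simp add: j_def)
    qed
  qed
  have jk': "perm_restrict (k h) (P g) = h g" if "h \<in> ?L" "g \<in> A" for h g
    using fun_cong[OF jk[OF that(1)], of g] that(2) by (simp add: j_def)
  have kK: "k h \<in> ?K" if h: "h \<in> ?L" for h
  proof -
    have im: "k h ` P g = P g" if g: "g \<in> A" for g
    proof -
      have "k h ` P g = h g ` P g" using kP[OF g] by (intro image_cong) auto
      then show ?thesis using permutes_image[OF hperm[OF h g]] by simp
    qed
    have "k h ` N = N" unfolding N[symmetric] image_UN using im by simp
    \<comment> \<open>An image point reveals its block and thereby which injective
      \<open>h g\<close> produced it.\<close>
    moreover have "inj_on (k h) N"
    proof (rule inj_onI)
      fix x y assume xy: "x \<in> N" "y \<in> N" "k h x = k h y"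
      have "k h x \<in> P (col x)" "k h y \<in> P (col y)" using im colN xy by blast+
      then have "col x = col y" using col[OF colN(1)[OF xy(1)]] col[OF colN(1)[OF xy(2)]] xy(3) by metis
      then have "h (col x) x = h (col x) y" using xy by (simp add: k_def)
      then show "x = y" using permutes_inj[OF hperm[OF h colN(1)[OF xy(1)]]] by (simp add: inj_eq)
    qed
    ultimately have "k h permutes N" by (intro bij_imp_permutes) (auto simp: bij_betw_def k_def)
    moreover have "\<rho> (k h i) = \<rho> i" if "i \<in> N" for i
      using PiE_mem[OF h colN(1)[OF that]] colN(2)[OF that] that by (simp add: label_stabilizer_def k_def)
    ultimately show ?thesis using im by simp
  qed
  have "(\<Prod>g\<in>A. \<Sum>q\<in>label_stabilizer (P g) \<rho>. F g q) = (\<Sum>h\<in>?L. \<Prod>g\<in>A. F g (h g))"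
    using A P(2) finite_label_stabilizer by (intro prod_sum_PiE) auto
  also have "\<dots> = (\<Sum>p\<in>?K. \<Prod>g\<in>A. F g (perm_restrict p (P g)))"
    by (rule sum.reindex_bij_witness[where i = j and j = k]) (use kj jL jk kK in \<open>simp_all add: jk' cong: prod.cong\<close>)
  finally show ?thesis by simp
qed

text \<open>The tableau is a parameter, so the locale can be interpreted at every tableau of the
  orbit. \<open>block_of\<close> and \<open>block_char\<close> depend on the blocks but not on
  \<open>t\<close>, so different interpretations share them.\<close>

locale wreath_tableau = comm_group G for G :: "('a, 'b) monoid_scheme" (structure) +
  fixes n :: nat and \<theta> :: "'a \<Rightarrow> 'a \<Rightarrow> complex"
    and \<sigma> :: "'a set \<Rightarrow> nat \<Rightarrow> nat" and lam :: "'a \<Rightarrow> nat \<Rightarrow> nat"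
    and P :: "'a \<Rightarrow> nat set" and t :: "('a set \<times> nat) \<times> nat \<Rightarrow> 'a set \<times> nat"
  assumes fin: "finite (carrier G)" and \<theta>: "\<theta> \<in> iso G (linear_chars G)"
    and \<sigma>: "\<sigma> \<in> par_maps_subgroups G n" and lam: "lam \<in> par_maps_carrier G n"
    and P: "block_system G n lam P" and t: "t \<in> tableaux G n \<sigma>"
begin

section \<open>The tableau seen from its entries\<close>

abbreviation "B \<equiv> boxes G \<sigma>"

definition entry_box where "entry_box i = inv_into B (\<lambda>b. snd (t b)) i"
text \<open>A row label is a pair, so \<open>fst (entry_row i)\<close> is the subgroup whose cosets
  label the diagram containing \<open>i\<close>.\<close>

definition entry_row where "entry_row i = fst (entry_box i)"
definition entry_coset where "entry_coset i = fst (t (entry_box i))"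
definition entry_rep where "entry_rep i = (SOME a. a \<in> carrier G \<and> entry_coset i = fst (entry_row i) #> a)"
definition block_of where "block_of i = (THE g. g \<in> carrier G \<and> i \<in> P g)"

lemma finite_boxes: "finite B" and card_boxes: "card B = n"
proof -
  have finU: "finite {U. subgroup U G}"
    by (rule finite_subset[of _ "Pow (carrier G)"]) (auto dest: subgroup.subset simp: fin)
  have \<sigma>P: "\<sigma> U \<in> Par" if "subgroup U G" for U
    using \<sigma> that by (auto simp: par_maps_subgroups_def)
  have "B = (\<lambda>(U, r, c). ((U, r), c)) ` (SIGMA U:{U. subgroup U G}. diagram (\<sigma> U))"
    by (auto simp: boxes_def diagram_def image_iff)
  moreover have "inj_on (\<lambda>(U, r, c). ((U, r), c)) (SIGMA U:{U. subgroup U G}. diagram (\<sigma> U))"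
    by (auto simp: inj_on_def)
  moreover have finS: "finite (SIGMA U:{U. subgroup U G}. diagram (\<sigma> U))"
    using finU finite_diagram \<sigma>P by (intro finite_SigmaI) auto
  moreover have "card (SIGMA U:{U. subgroup U G}. diagram (\<sigma> U)) = n"
    using finU finite_diagram \<sigma>P \<sigma> by (simp add: card_diagram par_maps_subgroups_def)
  ultimately show "finite B" "card B = n" by (simp_all add: card_image)
qed

lemma bij_entries: "bij_betw (\<lambda>b. snd (t b)) B {1..n}"
proof -
  have inj: "inj_on (\<lambda>b. snd (t b)) B" using t by (simp add: tableaux_def)
  have sub: "(\<lambda>b. snd (t b)) ` B \<subseteq> {1..n}" using tableau_entry(2)[OF t] by blast
  have "(\<lambda>b. snd (t b)) ` B = {1..n}"
    using sub card_image[OF inj] card_boxes by (intro card_subset_eq) auto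
  then show ?thesis using inj by (simp add: bij_betw_def)
qed

lemma entry_box: "i \<in> {1..n} \<Longrightarrow> entry_box i \<in> B" "i \<in> {1..n} \<Longrightarrow> snd (t (entry_box i)) = i"
  unfolding entry_box_def using bij_betw_imp_surj_on[OF bij_entries]
    f_inv_into_f[of i "\<lambda>b. snd (t b)" B] inv_into_into[of i "\<lambda>b. snd (t b)" B] by auto

lemma entry_box_snd: "b \<in> B \<Longrightarrow> entry_box (snd (t b)) = b"
  unfolding entry_box_def using bij_betw_imp_inj_on[OF bij_entries] by (rule inv_into_f_f)

lemma snd_entry: "b \<in> B \<Longrightarrow> snd (t b) \<in> {1..n}"
  using tableau_entry(2)[OF t] .

lemma t_entry_box: "i \<in> {1..n} \<Longrightarrow> t (entry_box i) = (entry_coset i, i)"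
  using entry_box(2) by (simp add: entry_coset_def prod_eq_iff)

lemma subgroup_entry: "i \<in> {1..n} \<Longrightarrow> subgroup (fst (entry_row i)) G"
  using tableau_entry(3)[OF t entry_box(1)] by (simp add: entry_row_def)

lemma entry_rep:
  assumes "i \<in> {1..n}"
  shows "entry_rep i \<in> carrier G" "entry_coset i = fst (entry_row i) #> entry_rep i"
proof -
  have "\<exists>a. a \<in> carrier G \<and> entry_coset i = fst (entry_row i) #> a"
    using tableau_entry(1)[OF t entry_box(1)[OF assms]] by (auto simp: entry_row_def entry_coset_def RCOSETS_def)
  from someI_ex[OF this] show "entry_rep i \<in> carrier G" "entry_coset i = fst (entry_row i) #> entry_rep i"
    by (auto simp: entry_rep_def)
qed

lemma blocks: "(\<Union>g\<in>carrier G. P g) = {1..n}" "disjoint_family_on P (carrier G)"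
  "g \<in> carrier G \<Longrightarrow> card (P g) = psize (lam g)"
  using P by (simp_all add: block_system_def)

lemma finite_block: "g \<in> carrier G \<Longrightarrow> finite (P g)"
  using blocks(1) by (intro finite_subset[of "P g" "{1..n}"]) auto

lemma block_of_eq: "g \<in> carrier G \<Longrightarrow> i \<in> P g \<Longrightarrow> block_of i = g"
  unfolding block_of_def using blocks(2) by (intro the_equality) (auto simp: disjoint_family_on_def)

lemma block_of: "i \<in> {1..n} \<Longrightarrow> block_of i \<in> carrier G" "i \<in> {1..n} \<Longrightarrow> i \<in> P (block_of i)"
  using block_of_eq unfolding blocks(1)[symmetric] by auto

lemma \<theta>_hom: assumes "g \<in> carrier G" shows "\<theta> g \<in> hom G complex_units"
proof -
  have "\<theta> \<in> hom G (linear_chars G)" using \<theta> by (simp add: iso_def)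
  then have "\<theta> g \<in> carrier (linear_chars G)" using assms by (rule hom_in_carrier)
  then show ?thesis by (simp add: linear_chars_def)
qed

lemma row_entries: "t ` {b \<in> B. fst b = r} = (\<lambda>i. (entry_coset i, i)) ` {i \<in> {1..n}. entry_row i = r}"
proof (intro equalityI subsetI)
  fix e assume "e \<in> t ` {b \<in> B. fst b = r}"
  then obtain b where b: "b \<in> B" "fst b = r" "e = t b" by blast
  then have "e = (entry_coset (snd (t b)), snd (t b))" "entry_row (snd (t b)) = r"
    using t_entry_box[OF snd_entry[OF b(1)]] entry_box_snd[OF b(1)] by (simp_all add: entry_row_def)
  then show "e \<in> (\<lambda>i. (entry_coset i, i)) ` {i \<in> {1..n}. entry_row i = r}" using snd_entry[OF b(1)] by blast
next
  fix e assume "e \<in> (\<lambda>i. (entry_coset i, i)) ` {i \<in> {1..n}. entry_row i = r}"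
  then obtain i where i: "i \<in> {1..n}" "entry_row i = r" "e = (entry_coset i, i)" by blast
  then have "e = t (entry_box i)" "fst (entry_box i) = r" using t_entry_box by (simp_all add: entry_row_def)
  then show "e \<in> t ` {b \<in> B. fst b = r}" using entry_box(1)[OF i(1)] by blast
qed

abbreviation "tabloid \<equiv> row_class B (tableaux G n \<sigma>) t"

text \<open>Corresponding rows must agree as sets of entries. Entries have distinct numbers, so the
  image of entry \<open>i\<close> can only coincide with the entry numbered \<open>p i\<close>, and
  the condition decouples into one per entry.\<close>

lemma tabloid_fixed_iff:
  assumes w: "(x, p) \<in> carrier (wreath G n)"
  shows "tabloid_act G \<sigma> (x, p) tabloid = tabloid \<longleftrightarrow>
    (\<forall>i\<in>{1..n}. entry_row (p i) = entry_row i \<and> entry_coset (p i) = entry_coset i #> x (p i))"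
proof -
  have p: "p permutes {1..n}" using w by (simp add: wreath_carrier)
  let ?E = "\<lambda>r. (\<lambda>i. (entry_coset i, i)) ` {i \<in> {1..n}. entry_row i = r}"
  have act: "entry_act G (x, p) ` ?E r = (\<lambda>i. (entry_coset i #> x (p i), p i)) ` {i \<in> {1..n}. entry_row i = r}" for r
    by (simp add: image_image)
  have "tabloid_act G \<sigma> (x, p) tabloid = tabloid \<longleftrightarrow> (\<forall>r. entry_act G (x, p) ` ?E r = ?E r)"
    unfolding tabloid_act_row_class[OF comm_group_axioms w t]
      row_class_eq_iff[OF tableau_act[OF comm_group_axioms w t] t] compose_row row_entries ..
  also have "\<dots> \<longleftrightarrow> (\<forall>i\<in>{1..n}. entry_row (p i) = entry_row i \<and> entry_coset (p i) = entry_coset i #> x (p i))"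
    (is "?l \<longleftrightarrow> ?r")
  proof
    assume l: ?l
    show ?r
    proof
      fix i assume i: "i \<in> {1..n}"
      then have "(entry_coset i #> x (p i), p i) \<in> entry_act G (x, p) ` ?E (entry_row i)" unfolding act by blast
      then have "(entry_coset i #> x (p i), p i) \<in> ?E (entry_row i)"
        using l[THEN spec, of "entry_row i"] by (simp only:)
      then show "entry_row (p i) = entry_row i \<and> entry_coset (p i) = entry_coset i #> x (p i)" by auto
    qed
  next
    assume r: ?r
    show ?l
    proof
      fix r'
      show "entry_act G (x, p) ` ?E r' = ?E r'"
      proof (intro equalityI subsetI)
        fix e assume "e \<in> entry_act G (x, p) ` ?E r'"
        then obtain i where i: "i \<in> {1..n}" "entry_row i = r'" "e = (entry_coset i #> x (p i), p i)" unfolding act by blast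
        moreover have "p i \<in> {1..n}" by (rule permutes_in_image[OF p, THEN iffD2, OF i(1)])
        ultimately show "e \<in> ?E r'" using r by (intro image_eqI[of _ _ "p i"]) simp_all
      next
        fix e assume "e \<in> ?E r'"
        then obtain k where k: "k \<in> {1..n}" "entry_row k = r'" "e = (entry_coset k, k)" by blast
        define i where "i = inv_into UNIV p k"
        have i: "i \<in> {1..n}" unfolding i_def by (rule permutes_in_image[OF permutes_inv[OF p], THEN iffD2, OF k(1)])
        have pi: "p i = k" unfolding i_def by (rule permutes_inverses(1)[OF p])
        have "entry_row i = r'" "e = (entry_coset i #> x (p i), p i)" using r i k by (simp_all add: pi[symmetric])
        then show "e \<in> entry_act G (x, p) ` ?E r'" unfolding act using i by blast
      qed
    qed
  qed
  finally show ?thesis .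
qed

definition stab_perms where
  "stab_perms = {p. p permutes {1..n} \<and> (\<forall>i\<in>{1..n}. entry_row (p i) = entry_row i) \<and> (\<forall>g\<in>carrier G. p ` P g = P g)}"

text \<open>The permissible values of the base component at \<open>j\<close>: those moving the coset
  at the preimage of \<open>j\<close> to the coset at \<open>j\<close>.\<close>

definition stab_shifts where
  "stab_shifts p j = {z \<in> carrier G. entry_coset j = entry_coset (inv_into UNIV p j) #> z}"

text \<open>Once \<open>p\<close> is fixed, the conditions on the coordinates of \<open>x\<close>
  are independent of each other; the stabiliser thus fibres over the permutations with product
  fibres, ready for factoring the character sum.\<close>

lemma young_stabilizer:
  "{y \<in> wreath_young G n P. tabloid_act G \<sigma> y tabloid = tabloid} =
    (\<lambda>(p, x). (x, p)) ` (SIGMA p:stab_perms. PiE {1..n} (stab_shifts p))"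
proof -
  have "(x, p) \<in> wreath_young G n P \<and> tabloid_act G \<sigma> (x, p) tabloid = tabloid \<longleftrightarrow>
      p \<in> stab_perms \<and> x \<in> PiE {1..n} (stab_shifts p)" for x p
  proof (cases "p permutes {1..n}")
    case False
    then show ?thesis by (simp add: wreath_young_def wreath_carrier stab_perms_def)
  next
    case p: True
    \<comment> \<open>Substituting \<open>j = p i\<close> lets each condition constrain the
      coordinate \<open>x j\<close>.\<close>
    have "(\<forall>i\<in>{1..n}. Q (p i) i) \<longleftrightarrow> (\<forall>j\<in>{1..n}. Q j (inv_into UNIV p j))" for Q
    proof
      assume Q: "\<forall>i\<in>{1..n}. Q (p i) i"
      show "\<forall>j\<in>{1..n}. Q j (inv_into UNIV p j)"
      proof
        fix j assume "j \<in> {1..n}"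
        then have "Q (p (inv_into UNIV p j)) (inv_into UNIV p j)"
          using Q permutes_in_image[OF permutes_inv[OF p], THEN iffD2] by blast
        then show "Q j (inv_into UNIV p j)" unfolding permutes_inverses(1)[OF p] .
      qed
    next
      assume Q: "\<forall>j\<in>{1..n}. Q j (inv_into UNIV p j)"
      show "\<forall>i\<in>{1..n}. Q (p i) i"
      proof
        fix i assume "i \<in> {1..n}"
        then have "Q (p i) (inv_into UNIV p (p i))" using Q permutes_in_image[OF p, THEN iffD2] by blast
        then show "Q (p i) i" unfolding permutes_inverses(2)[OF p] .
      qed
    qed
    note shift = this[of "\<lambda>j i. entry_coset j = entry_coset i #> x j"]
    have PiE: "x \<in> PiE {1..n} (stab_shifts p) \<longleftrightarrow> x \<in> {1..n} \<rightarrow>\<^sub>E carrier G \<and>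
        (\<forall>j\<in>{1..n}. entry_coset j = entry_coset (inv_into UNIV p j) #> x j)"
      unfolding PiE_iff stab_shifts_def by blast
    show ?thesis
    proof (cases "x \<in> {1..n} \<rightarrow>\<^sub>E carrier G")
      case True
      then have w: "(x, p) \<in> carrier (wreath G n)" using p by (simp add: wreath_carrier)
      have "(\<forall>i\<in>{1..n}. entry_row (p i) = entry_row i \<and> entry_coset (p i) = entry_coset i #> x (p i)) \<longleftrightarrow>
          (\<forall>i\<in>{1..n}. entry_row (p i) = entry_row i) \<and>
          (\<forall>j\<in>{1..n}. entry_coset j = entry_coset (inv_into UNIV p j) #> x j)"
        unfolding ball_conj_distrib shift ..
      then show ?thesis using w True p unfolding tabloid_fixed_iff[OF w] PiE
        by (simp only: wreath_young_def stab_perms_def mem_Collect_eq split_conv) blast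
    next
      case False
      then show ?thesis unfolding PiE by (simp only: wreath_young_def wreath_carrier mem_Collect_eq split_conv) blast
    qed
  qed
  note iff = this
  show ?thesis
  proof (rule Set.set_eqI)
    fix y :: "(nat \<Rightarrow> 'a) \<times> (nat \<Rightarrow> nat)"
    obtain x p where y: "y = (x, p)" by (cases y)
    show "y \<in> {y \<in> wreath_young G n P. tabloid_act G \<sigma> y tabloid = tabloid} \<longleftrightarrow>
      y \<in> (\<lambda>(p, x). (x, p)) ` (SIGMA p:stab_perms. PiE {1..n} (stab_shifts p))"
      unfolding y mem_Collect_eq iff by (auto simp: image_iff simp del: One_nat_def)
  qed
qed

section \<open>Evaluation of the character sum over the stabiliser\<close>

definition block_char where
  "block_char = (\<lambda>(x :: nat \<Rightarrow> 'a, p). \<Prod>g\<in>carrier G.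
        (\<Prod>i\<in>P g. \<theta> g (x i)) * sym_char (lam g) (P g) (perm_restrict p (P g)))"

definition shift_sum where
  "shift_sum i = (\<Sum>u\<in>fst (entry_row i). \<theta> (block_of i) u)"

lemma prod_blocks: "(\<Prod>g\<in>carrier G. \<Prod>i\<in>P g. f g i) = (\<Prod>i\<in>{1..n}. f (block_of i) i)"
proof -
  have "(\<Prod>i\<in>{1..n}. f (block_of i) i) = (\<Prod>g\<in>carrier G. \<Prod>i\<in>P g. f (block_of i) i)"
    unfolding blocks(1)[symmetric] using fin finite_block blocks(2)
    by (intro prod.UNION_disjoint) (auto simp: disjoint_family_on_def)
  also have "\<dots> = (\<Prod>g\<in>carrier G. \<Prod>i\<in>P g. f g i)" by (intro prod.cong refl) (simp add: block_of_eq)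
  finally show ?thesis by simp
qed

text \<open>Each coordinate contributes a quotient of character values at two coset representatives
  times \<open>shift_sum\<close>. Since \<open>p\<close> preserves rows and blocks and merely
  permutes the entries, the quotients multiply to 1, and the linear part no longer depends on
  \<open>p\<close>.\<close>

lemma sum_shifts:
  assumes p: "p \<in> stab_perms"
  shows "(\<Sum>x\<in>PiE {1..n} (stab_shifts p). block_char (x, p)) =
    (\<Prod>g\<in>carrier G. sym_char (lam g) (P g) (perm_restrict p (P g))) * (\<Prod>i\<in>{1..n}. shift_sum i)"
proof -
  let ?s = "\<Prod>g\<in>carrier G. sym_char (lam g) (P g) (perm_restrict p (P g))"
  let ?q = "inv_into UNIV p"
  have pp: "p permutes {1..n}" using p by (simp add: stab_perms_def)
  have q: "?q permutes {1..n}" by (rule permutes_inv[OF pp])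
  have qin: "?q j \<in> {1..n}" if "j \<in> {1..n}" for j by (rule permutes_in_image[OF q, THEN iffD2, OF that])
  have qrow: "entry_row (?q j) = entry_row j" if j: "j \<in> {1..n}" for j
  proof -
    have "entry_row (p (?q j)) = entry_row (?q j)" using p qin[OF j] by (simp add: stab_perms_def)
    then show ?thesis by (simp add: permutes_inverses[OF pp])
  qed
  have qblock: "block_of (?q j) = block_of j" if j: "j \<in> {1..n}" for j
  proof -
    have "p ` P (block_of (?q j)) = P (block_of (?q j))" using p block_of(1)[OF qin[OF j]] by (simp add: stab_perms_def)
    then have "p (?q j) \<in> P (block_of (?q j))" using block_of(2)[OF qin[OF j]] by blast
    then show ?thesis using block_of_eq[OF block_of(1)[OF qin[OF j]]] by (simp add: permutes_inverses[OF pp])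
  qed
  let ?c = "\<lambda>j. \<theta> (block_of j) (entry_rep j)"
  \<comment> \<open>As \<open>j\<close> and its preimage share row and block, the same subgroup and
    the same linear character govern both.\<close>
  have factor: "(\<Sum>z\<in>stab_shifts p j. \<theta> (block_of j) z) = ?c j / ?c (?q j) * shift_sum j" if j: "j \<in> {1..n}" for j
  proof -
    have "stab_shifts p j = {z. z \<in> carrier G \<and> fst (entry_row j) #> entry_rep j = (fst (entry_row j) #> entry_rep (?q j)) #> z}"
      unfolding stab_shifts_def entry_rep(2)[OF j] entry_rep(2)[OF qin[OF j]] qrow[OF j] ..
    then show ?thesis unfolding qblock[OF j] shift_sum_def
      using sum_hom_between_cosets[OF \<theta>_hom[OF block_of(1)[OF j]] subgroup_entry[OF j] entry_rep(1)[OF j] entry_rep(1)[OF qin[OF j]]]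
      by simp
  qed
  have telescope: "(\<Prod>j\<in>{1..n}. ?c j / ?c (?q j)) = 1"
  proof -
    have "(\<Prod>j\<in>{1..n}. ?c (?q j)) = (\<Prod>j\<in>{1..n}. ?c j)"
      by (rule prod.reindex_bij_betw[OF permutes_imp_bij[OF q]])
    moreover have "(\<Prod>j\<in>{1..n}. ?c j) \<noteq> 0"
      using hom_complex_units(1)[OF \<theta>_hom[OF block_of(1)] entry_rep(1)] by (simp add: prod_zero_iff)
    ultimately show ?thesis unfolding prod_dividef by simp
  qed
  have "(\<Sum>x\<in>PiE {1..n} (stab_shifts p). block_char (x, p)) =
      (\<Sum>x\<in>PiE {1..n} (stab_shifts p). (\<Prod>j\<in>{1..n}. \<theta> (block_of j) (x j)) * ?s)"
  proof (rule sum.cong[OF refl])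
    fix x
    show "block_char (x, p) = (\<Prod>j\<in>{1..n}. \<theta> (block_of j) (x j)) * ?s"
      using prod_blocks[of "\<lambda>g i. \<theta> g (x i)"] by (simp add: block_char_def prod.distrib)
  qed
  also have "\<dots> = (\<Sum>x\<in>PiE {1..n} (stab_shifts p). \<Prod>j\<in>{1..n}. \<theta> (block_of j) (x j)) * ?s"
    by (rule sum_distrib_right[symmetric])
  also have "(\<Sum>x\<in>PiE {1..n} (stab_shifts p). \<Prod>j\<in>{1..n}. \<theta> (block_of j) (x j)) =
      (\<Prod>j\<in>{1..n}. \<Sum>z\<in>stab_shifts p j. \<theta> (block_of j) z)"
    using fin by (intro prod_sum_PiE[symmetric]) (auto simp: stab_shifts_def)
  also have "\<dots> = (\<Prod>j\<in>{1..n}. ?c j / ?c (?q j) * shift_sum j)" by (intro prod.cong refl factor)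
  also have "\<dots> = (\<Prod>j\<in>{1..n}. shift_sum j)" unfolding prod.distrib telescope by simp
  finally show ?thesis by (simp only: mult.commute)
qed

text \<open>The linear part factors out of the sum over permutations, which then splits into
  independent sums over Young subgroups of the blocks.\<close>

lemma sum_young_stabilizer:
  "(\<Sum>y\<in>wreath_young G n P. if tabloid_act G \<sigma> y tabloid = tabloid then block_char y else 0) =
    (\<Prod>i\<in>{1..n}. shift_sum i) * (\<Prod>g\<in>carrier G. \<Sum>q\<in>label_stabilizer (P g) entry_row. sym_char (lam g) (P g) q)"
proof -
  have finY: "finite (wreath_young G n P)"
    by (rule finite_subset[OF _ finite_wreath[OF fin, of n]]) (auto simp: wreath_young_def)
  have fin1: "finite stab_perms"
    by (rule finite_subset[OF _ finite_permutations[of "{1..n}"]]) (auto simp: stab_perms_def)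
  have fin2: "finite (PiE {1..n} (stab_shifts p))" for p
    using fin by (intro finite_PiE) (auto simp: stab_shifts_def)
  have "(\<Sum>y\<in>wreath_young G n P. if tabloid_act G \<sigma> y tabloid = tabloid then block_char y else 0) =
      (\<Sum>y | y \<in> wreath_young G n P \<and> tabloid_act G \<sigma> y tabloid = tabloid. block_char y)"
    by (rule sum.inter_filter[OF finY, symmetric])
  also have "\<dots> = (\<Sum>(p, x)\<in>(SIGMA p:stab_perms. PiE {1..n} (stab_shifts p)). block_char (x, p))"
    unfolding young_stabilizer by (subst sum.reindex) (auto simp: inj_on_def intro!: sum.cong)
  also have "\<dots> = (\<Sum>p\<in>stab_perms. \<Sum>x\<in>PiE {1..n} (stab_shifts p). block_char (x, p))"
    using fin1 fin2 by (intro sum.Sigma[symmetric]) auto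
  also have "\<dots> = (\<Sum>p\<in>stab_perms. \<Prod>g\<in>carrier G. sym_char (lam g) (P g) (perm_restrict p (P g))) *
      (\<Prod>i\<in>{1..n}. shift_sum i)"
    unfolding sum_distrib_right by (rule sum.cong[OF refl]) (rule sum_shifts)
  also have "(\<Sum>p\<in>stab_perms. \<Prod>g\<in>carrier G. sym_char (lam g) (P g) (perm_restrict p (P g))) =
      (\<Prod>g\<in>carrier G. \<Sum>q\<in>label_stabilizer (P g) entry_row. sym_char (lam g) (P g) q)"
    unfolding stab_perms_def by (rule sum_block_permutations[OF fin blocks(2) finite_block blocks(1)])
  finally show ?thesis by (simp only: mult.commute)
qed

end

section \<open>Colourings of the boxes\<close>

lemma arises_from_iff:
  "arises_from G \<sigma> \<kappa> \<mu> \<longleftrightarrow> (\<forall>g\<in>carrier G. \<forall>k\<ge>1.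
     card {i. \<mu> g i = k} = card {r. card {b \<in> {b \<in> boxes G \<sigma>. \<kappa> b = g}. fst b = r} = k})"
proof -
  \<comment> \<open>Counting by row labels gives the fibre form used for Young subgroups. Labels
    whose first component is no subgroup have empty fibres and are ruled out by
    \<open>k \<ge> 1\<close>.\<close>
  have "{(U, r). subgroup U G \<and> card {c. c < \<sigma> U r \<and> \<kappa> ((U, r), c) = g} = k} =
      {r. card {b \<in> {b \<in> boxes G \<sigma>. \<kappa> b = g}. fst b = r} = k}" if "k \<ge> 1" for g k
  proof -
    have "subgroup U G \<and> card {c. c < \<sigma> U r \<and> \<kappa> ((U, r), c) = g} = k \<longleftrightarrow>
        card {b \<in> {b \<in> boxes G \<sigma>. \<kappa> b = g}. fst b = (U, r)} = k" for U r
    proof (cases "subgroup U G")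
      case True
      then have "{b \<in> {b \<in> boxes G \<sigma>. \<kappa> b = g}. fst b = (U, r)} = Pair (U, r) ` {c. c < \<sigma> U r \<and> \<kappa> ((U, r), c) = g}"
        by (auto simp: boxes_def)
      then have "card {b \<in> {b \<in> boxes G \<sigma>. \<kappa> b = g}. fst b = (U, r)} = card {c. c < \<sigma> U r \<and> \<kappa> ((U, r), c) = g}"
        by (simp only:) (rule card_image, simp add: inj_on_def)
      then show ?thesis using True by simp
    next
      case False
      then have "{b \<in> {b \<in> boxes G \<sigma>. \<kappa> b = g}. fst b = (U, r)} = {}" by (auto simp: boxes_def)
      then have "card {b \<in> {b \<in> boxes G \<sigma>. \<kappa> b = g}. fst b = (U, r)} = 0" by (simp only: card.empty)
      then show ?thesis using False that by simp
    qed
    then show ?thesis by auto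
  qed
  then show ?thesis unfolding arises_from_def by simp
qed

lemma arises_from_cong:
  assumes "\<And>b. b \<in> boxes G \<sigma> \<Longrightarrow> \<kappa> b = \<kappa>' b"
  shows "arises_from G \<sigma> \<kappa> \<mu> \<longleftrightarrow> arises_from G \<sigma> \<kappa>' \<mu>"
proof -
  have "{b \<in> boxes G \<sigma>. \<kappa> b = g} = {b \<in> boxes G \<sigma>. \<kappa>' b = g}" for g using assms by auto
  then show ?thesis unfolding arises_from_iff by (simp only:)
qed

lemma colouring_iff:
  "colouring G \<theta> \<sigma> \<kappa> \<longleftrightarrow> (\<forall>b\<in>boxes G \<sigma>. \<kappa> b \<in> annihilator G \<theta> (fst (fst b)))"
  by (auto simp: colouring_def)

text \<open>Dominance compares partial sums without fixing the size; far enough out these are the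
  sizes. Equality of sizes will follow from equality of the totals over all
  \<open>g\<close>.\<close>

lemma dominated_psize_le:
  assumes "\<mu> \<in> Par" "\<nu> \<in> Par" "\<mu> \<unlhd>\<^sub>d \<nu>" shows "psize \<mu> \<le> psize \<nu>"
proof -
  have "finite ({i. \<mu> i \<noteq> 0} \<union> {i. \<nu> i \<noteq> 0})" using assms by (simp add: Par_def)
  then obtain L where L: "\<forall>i\<in>{i. \<mu> i \<noteq> 0} \<union> {i. \<nu> i \<noteq> 0}. i < L"
    unfolding finite_nat_set_iff_bounded by blast
  then have "psize \<mu> = (\<Sum>i<L. \<mu> i)" unfolding psize_def by (intro sum.mono_neutral_left) auto
  also have "\<dots> \<le> (\<Sum>i<L. \<nu> i)" using assms(3) by (simp add: dominated_def)
  also have "\<dots> = psize \<nu>" using L unfolding psize_def by (intro sum.mono_neutral_right) auto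
  finally show ?thesis .
qed

context wreath_tableau begin

text \<open>The colouring attached to a tableau: each box takes the index of the block containing
  its entry.\<close>

definition entry_colour where "entry_colour b = block_of (snd (t b))"

lemma block_eq_entries:
  assumes "g \<in> carrier G"
  shows "{i \<in> P g. entry_row i = r} = (\<lambda>b. snd (t b)) ` {b \<in> {b \<in> B. entry_colour b = g}. fst b = r}"
proof (intro equalityI subsetI)
  fix i assume i: "i \<in> {i \<in> P g. entry_row i = r}"
  then have "i \<in> {1..n}" using blocks(1) assms by blast
  then have "i = snd (t (entry_box i))" "entry_box i \<in> B" using entry_box by auto
  moreover have "entry_colour (entry_box i) = g" "fst (entry_box i) = r"
    using i block_of_eq[OF assms] calculation(1) by (simp_all add: entry_colour_def entry_row_def)
  ultimately show "i \<in> (\<lambda>b. snd (t b)) ` {b \<in> {b \<in> B. entry_colour b = g}. fst b = r}" by blast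
next
  fix i assume "i \<in> (\<lambda>b. snd (t b)) ` {b \<in> {b \<in> B. entry_colour b = g}. fst b = r}"
  then obtain b where b: "b \<in> B" "entry_colour b = g" "fst b = r" "i = snd (t b)" by blast
  then have "i \<in> P g" using block_of(2)[OF snd_entry[OF b(1)]] by (simp add: entry_colour_def)
  then show "i \<in> {i \<in> P g. entry_row i = r}" using b entry_box_snd by (simp add: entry_row_def)
qed

lemma card_block_eq:
  assumes "g \<in> carrier G"
  shows "card {i \<in> P g. entry_row i = r} = card {b \<in> {b \<in> B. entry_colour b = g}. fst b = r}"
  unfolding block_eq_entries[OF assms]
  by (rule card_image) (rule inj_on_subset[OF bij_betw_imp_inj_on[OF bij_entries]], auto)

lemma lam_Par: "g \<in> carrier G \<Longrightarrow> lam g \<in> Par"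
  using lam by (auto simp: par_maps_carrier_def)

lemma shift_sum_nat:
  assumes i: "i \<in> {1..n}"
  obtains s :: nat where "shift_sum i = of_nat s"
    "s \<noteq> 0 \<longleftrightarrow> block_of i \<in> annihilator G \<theta> (fst (entry_row i))"
proof
  let ?U = "fst (entry_row i)"
  let ?s = "if \<forall>u\<in>?U. \<theta> (block_of i) u = 1 then card ?U else 0"
  have U: "subgroup ?U G" by (rule subgroup_entry[OF i])
  show "shift_sum i = of_nat ?s"
    unfolding shift_sum_def using sum_hom_subgroup[OF \<theta>_hom[OF block_of(1)[OF i]] U] by simp
  have "finite ?U" "?U \<noteq> {}"
    using subgroup.subset[OF U] fin finite_subset subgroup.one_closed[OF U] by blast+
  then have "card ?U \<noteq> 0" by simp
  then show "?s \<noteq> 0 \<longleftrightarrow> block_of i \<in> annihilator G \<theta> ?U"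
    using block_of(1)[OF i] by (simp add: annihilator_def)
qed

lemma colouring_entry_colour:
  "colouring G \<theta> \<sigma> entry_colour \<longleftrightarrow> (\<forall>i\<in>{1..n}. block_of i \<in> annihilator G \<theta> (fst (entry_row i)))"
proof
  assume "colouring G \<theta> \<sigma> entry_colour"
  then show "\<forall>i\<in>{1..n}. block_of i \<in> annihilator G \<theta> (fst (entry_row i))"
    using entry_box unfolding colouring_iff entry_colour_def entry_row_def by metis
next
  assume r: "\<forall>i\<in>{1..n}. block_of i \<in> annihilator G \<theta> (fst (entry_row i))"
  show "colouring G \<theta> \<sigma> entry_colour"
    unfolding colouring_iff
  proof
    fix b assume b: "b \<in> B"
    show "entry_colour b \<in> annihilator G \<theta> (fst (fst b))"
      using r[rule_format, OF snd_entry[OF b]] by (simp add: entry_colour_def entry_row_def entry_box_snd[OF b])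
  qed
qed

text \<open>All factors are natural numbers, so the product is nonzero iff each factor is. The
  factors at the entries express admissibility of the colouring, those at the blocks the dominance
  conditions.\<close>

lemma sum_young_stabilizer_nat:
  obtains c :: nat where
    "(\<Sum>y\<in>wreath_young G n P. if tabloid_act G \<sigma> y tabloid = tabloid then block_char y else 0) = of_nat c"
    "c \<noteq> 0 \<longleftrightarrow> (\<exists>\<mu>\<in>par_maps_carrier G n. (\<forall>g\<in>carrier G. \<mu> g \<unlhd>\<^sub>d lam g) \<and>
      colouring G \<theta> \<sigma> entry_colour \<and> arises_from G \<sigma> entry_colour \<mu>)"
proof -
  let ?parts = "\<lambda>\<mu> g. \<forall>k\<ge>1. card {i. \<mu> i = k} = card {r. card {b \<in> {b \<in> B. entry_colour b = g}. fst b = r} = k}"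
  have "\<exists>s. \<forall>i\<in>{1..n}. shift_sum i = of_nat (s i :: nat) \<and>
      (s i \<noteq> 0 \<longleftrightarrow> block_of i \<in> annihilator G \<theta> (fst (entry_row i)))"
    using shift_sum_nat by (intro bchoice ballI) metis
  then obtain s where s: "\<And>i. i \<in> {1..n} \<Longrightarrow> shift_sum i = of_nat (s i :: nat)"
    "\<And>i. i \<in> {1..n} \<Longrightarrow> s i \<noteq> 0 \<longleftrightarrow> block_of i \<in> annihilator G \<theta> (fst (entry_row i))" by blast
  have "\<exists>d. \<forall>g\<in>carrier G. (\<Sum>q\<in>label_stabilizer (P g) entry_row. sym_char (lam g) (P g) q) = of_nat (d g :: nat) \<and>
      (d g \<noteq> 0 \<longleftrightarrow> (\<exists>\<mu>\<in>Par. ?parts \<mu> g \<and> \<mu> \<unlhd>\<^sub>d lam g))"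
  proof (intro bchoice ballI)
    fix g assume g: "g \<in> carrier G"
    show "\<exists>d. (\<Sum>q\<in>label_stabilizer (P g) entry_row. sym_char (lam g) (P g) q) = of_nat (d :: nat) \<and>
      (d \<noteq> 0 \<longleftrightarrow> (\<exists>\<mu>\<in>Par. ?parts \<mu> g \<and> \<mu> \<unlhd>\<^sub>d lam g))"
      using sum_sym_char_label_stabilizer_nonzero_iff[OF finite_block[OF g] lam_Par[OF g] blocks(3)[OF g, symmetric], of entry_row]
      unfolding card_block_eq[OF g] .
  qed
  then obtain d where d: "\<And>g. g \<in> carrier G \<Longrightarrow>
      (\<Sum>q\<in>label_stabilizer (P g) entry_row. sym_char (lam g) (P g) q) = of_nat (d g :: nat)"
    "\<And>g. g \<in> carrier G \<Longrightarrow> d g \<noteq> 0 \<longleftrightarrow> (\<exists>\<mu>\<in>Par. ?parts \<mu> g \<and> \<mu> \<unlhd>\<^sub>d lam g)" by blast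
  have parts_iff: "(\<forall>g\<in>carrier G. \<exists>\<mu>\<in>Par. ?parts \<mu> g \<and> \<mu> \<unlhd>\<^sub>d lam g) \<longleftrightarrow>
      (\<exists>\<mu>\<in>par_maps_carrier G n. (\<forall>g\<in>carrier G. \<mu> g \<unlhd>\<^sub>d lam g) \<and> arises_from G \<sigma> entry_colour \<mu>)"
  proof
    assume "\<forall>g\<in>carrier G. \<exists>\<mu>\<in>Par. ?parts \<mu> g \<and> \<mu> \<unlhd>\<^sub>d lam g"
    then have "\<forall>g\<in>carrier G. \<exists>\<mu>. \<mu> \<in> Par \<and> ?parts \<mu> g \<and> \<mu> \<unlhd>\<^sub>d lam g" by (simp only: Bex_def)
    from bchoice[OF this] obtain m where
      m: "\<forall>g\<in>carrier G. m g \<in> Par \<and> ?parts (m g) g \<and> m g \<unlhd>\<^sub>d lam g" ..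
    have mP: "m g \<in> Par" and m\<mu>: "?parts (m g) g" and mdom: "m g \<unlhd>\<^sub>d lam g" if "g \<in> carrier G" for g
      using m[rule_format, OF that] by blast+
    \<comment> \<open>Both sizes equal that of the block, so the partitions found for the single
      \<open>g\<close> assemble to total size \<open>n\<close>.\<close>
    have "psize (m g) = psize (lam g)" if g: "g \<in> carrier G" for g
    proof -
      have "psize (m g) = card (P g)"
      proof (rule psize_eq_card[where \<rho> = entry_row, OF finite_block[OF g]])
        show "m g \<in> Par" by (rule mP[OF g])
        show "card {i. m g i = k} = card {r. card {a \<in> P g. entry_row a = r} = k}" if "k \<ge> 1" for k
          unfolding card_block_eq[OF g] using m\<mu>[OF g] that by blast
      qed
      then show ?thesis using blocks(3)[OF g] by simp
    qed
    then have "restrict m (carrier G) \<in> par_maps_carrier G n"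
      using mP lam by (simp add: par_maps_carrier_def)
    moreover have "\<forall>g\<in>carrier G. restrict m (carrier G) g \<unlhd>\<^sub>d lam g" using mdom by simp
    moreover have "arises_from G \<sigma> entry_colour (restrict m (carrier G))"
      unfolding arises_from_iff using m\<mu> by (intro ballI) (simp only: restrict_apply' )
    ultimately show "\<exists>\<mu>\<in>par_maps_carrier G n. (\<forall>g\<in>carrier G. \<mu> g \<unlhd>\<^sub>d lam g) \<and> arises_from G \<sigma> entry_colour \<mu>"
      by blast
  next
    assume "\<exists>\<mu>\<in>par_maps_carrier G n. (\<forall>g\<in>carrier G. \<mu> g \<unlhd>\<^sub>d lam g) \<and> arises_from G \<sigma> entry_colour \<mu>"
    then obtain \<mu> where \<mu>: "\<mu> \<in> par_maps_carrier G n" "\<forall>g\<in>carrier G. \<mu> g \<unlhd>\<^sub>d lam g" "arises_from G \<sigma> entry_colour \<mu>"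
      by blast
    show "\<forall>g\<in>carrier G. \<exists>\<mu>\<in>Par. ?parts \<mu> g \<and> \<mu> \<unlhd>\<^sub>d lam g"
    proof
      fix g assume g: "g \<in> carrier G"
      have "\<mu> g \<in> Par" using \<mu>(1) g by (auto simp: par_maps_carrier_def)
      then show "\<exists>\<mu>\<in>Par. ?parts \<mu> g \<and> \<mu> \<unlhd>\<^sub>d lam g"
        using \<mu>(2) \<mu>(3)[unfolded arises_from_iff, rule_format, OF g] g by blast
    qed
  qed
  let ?c = "(\<Prod>i\<in>{1..n}. s i) * (\<Prod>g\<in>carrier G. d g)"
  have "?c \<noteq> 0 \<longleftrightarrow> (\<forall>i\<in>{1..n}. s i \<noteq> 0) \<and> (\<forall>g\<in>carrier G. d g \<noteq> 0)"
    using prod_zero_iff[OF finite_atLeastAtMost[of 1 n], of s] prod_zero_iff[OF fin, of d]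
    by (simp only: mult_eq_0_iff) simp
  also have "\<dots> \<longleftrightarrow> colouring G \<theta> \<sigma> entry_colour \<and> (\<forall>g\<in>carrier G. \<exists>\<mu>\<in>Par. ?parts \<mu> g \<and> \<mu> \<unlhd>\<^sub>d lam g)"
    unfolding colouring_entry_colour using s(2) d(2) by (simp only: cong: ball_cong)
  also have "\<dots> \<longleftrightarrow> (\<exists>\<mu>\<in>par_maps_carrier G n. (\<forall>g\<in>carrier G. \<mu> g \<unlhd>\<^sub>d lam g) \<and>
      colouring G \<theta> \<sigma> entry_colour \<and> arises_from G \<sigma> entry_colour \<mu>)"
    unfolding parts_iff by blast
  finally have "?c \<noteq> 0 \<longleftrightarrow> (\<exists>\<mu>\<in>par_maps_carrier G n. (\<forall>g\<in>carrier G. \<mu> g \<unlhd>\<^sub>d lam g) \<and>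
      colouring G \<theta> \<sigma> entry_colour \<and> arises_from G \<sigma> entry_colour \<mu>)" .
  moreover have "(\<Sum>y\<in>wreath_young G n P. if tabloid_act G \<sigma> y tabloid = tabloid then block_char y else 0) = of_nat ?c"
    unfolding sum_young_stabilizer of_nat_mult of_nat_prod using s(1) d(1) by (intro arg_cong2[where f = "(*)"] prod.cong refl) blast+
  ultimately show thesis using that by blast
qed

text \<open>The colouring uses each \<open>g\<close> exactly \<open>card (P g)\<close> times, so
  some renumbering of the boxes puts entries of \<open>P g\<close> into the boxes coloured
  \<open>g\<close>. It comes from an element with trivial base component, as only the numbers of the
  entries matter.\<close>

lemma exists_recolouring:
  assumes \<mu>: "\<mu> \<in> par_maps_carrier G n" "\<forall>g\<in>carrier G. \<mu> g \<unlhd>\<^sub>d lam g"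
    and \<kappa>: "colouring G \<theta> \<sigma> \<kappa>" "arises_from G \<sigma> \<kappa> \<mu>"
  shows "\<exists>x\<in>carrier (wreath G n). \<forall>b\<in>B. block_of (snd (compose B (entry_act G x) t b)) = \<kappa> b"
proof -
  have \<mu>P: "\<mu> g \<in> Par" if "g \<in> carrier G" for g using \<mu>(1) that by (auto simp: par_maps_carrier_def)
  have le: "psize (\<mu> g) \<le> psize (lam g)" if "g \<in> carrier G" for g
    using \<mu>(2) that by (intro dominated_psize_le \<mu>P lam_Par) auto
  have tot: "(\<Sum>g\<in>carrier G. psize (\<mu> g)) = (\<Sum>g\<in>carrier G. psize (lam g))"
    using \<mu>(1) lam by (simp add: par_maps_carrier_def)
  have sizes: "psize (\<mu> g) = psize (lam g)" if "g \<in> carrier G" for g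
    by (rule sum_mono_inv[OF tot le that fin])
  have \<kappa>C: "\<kappa> b \<in> carrier G" if "b \<in> B" for b using \<kappa>(1) that by (auto simp: colouring_iff annihilator_def)
  have "card {b \<in> B. \<kappa> b = g} = card {i \<in> {1..n}. block_of i = g}" for g
  proof (cases "g \<in> carrier G")
    case True
    have "psize (\<mu> g) = card {b \<in> B. \<kappa> b = g}"
      using \<kappa>(2)[unfolded arises_from_iff, rule_format, OF True] finite_boxes
      by (intro psize_eq_card[where \<rho> = fst] \<mu>P True) simp_all
    moreover have "{i \<in> {1..n}. block_of i = g} = P g"
      using block_of block_of_eq[OF True] blocks(1) True by blast
    ultimately show ?thesis using sizes[OF True] blocks(3)[OF True] by simp
  next
    case False
    then have "{b \<in> B. \<kappa> b = g} = {}" "{i \<in> {1..n}. block_of i = g} = {}" using \<kappa>C block_of(1) by blast+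
    then show ?thesis by (simp only: card.empty)
  qed
  then obtain \<beta> where \<beta>: "bij_betw \<beta> B {1..n}" "\<And>b. b \<in> B \<Longrightarrow> block_of (\<beta> b) = \<kappa> b"
    using bij_betw_matching_fibres[OF finite_boxes finite_atLeastAtMost, of \<kappa> 1 n block_of] by blast
  \<comment> \<open>The current number in box \<open>b\<close> is sent to the desired number
    \<open>\<beta> b\<close>.\<close>
  define p where "p i = (if i \<in> {1..n} then \<beta> (entry_box i) else i)" for i
  have "bij_betw (\<beta> \<circ> entry_box) {1..n} {1..n}"
    using bij_betw_trans[OF bij_betw_inv_into[OF bij_entries] \<beta>(1)] unfolding entry_box_def[abs_def] .
  then have "bij_betw p {1..n} {1..n}" by (subst bij_betw_cong[where g = "\<beta> \<circ> entry_box"]) (simp_all add: p_def)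
  then have p: "p permutes {1..n}" by (rule bij_imp_permutes) (simp only: p_def if_False)
  let ?x = "(\<lambda>i\<in>{1..n}. \<one>, p)"
  have "?x \<in> carrier (wreath G n)" using p by (simp add: wreath_carrier)
  moreover have "block_of (snd (compose B (entry_act G ?x) t b)) = \<kappa> b" if b: "b \<in> B" for b
  proof -
    have "snd (compose B (entry_act G ?x) t b) = p (snd (t b))" using b by (cases "t b") (simp add: compose_def)
    also have "\<dots> = \<beta> b" using snd_entry[OF b] entry_box_snd[OF b] by (simp add: p_def)
    finally show ?thesis using \<beta>(2)[OF b] by simp
  qed
  ultimately show ?thesis by blast
qed

end

theorem theorem4p5:
  fixes G :: "('a, 'b) monoid_scheme" and n :: nat
    and \<theta> :: "'a \<Rightarrow> 'a \<Rightarrow> complex"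
    and \<sigma> :: "'a set \<Rightarrow> nat \<Rightarrow> nat" and lam :: "'a \<Rightarrow> nat \<Rightarrow> nat"
    and X :: "(('a set \<times> nat) \<times> nat \<Rightarrow> 'a set \<times> nat) set" and P :: "'a \<Rightarrow> nat set"
  assumes "comm_group G" and "finite (carrier G)" and "n > 0"
    and "\<theta> \<in> iso G (linear_chars G)"
    and "\<sigma> \<in> par_maps_subgroups G n" and "lam \<in> par_maps_carrier G n"
    and "X \<in> tabloids G n \<sigma>" and "block_system G n lam P"
  shows "char_inner (wreath G n)
           (perm_char (wreath G n) (stabilizer (wreath G n) (tabloid_act G \<sigma>) X))
           (wreath_char G n \<theta> lam P) \<noteq> 0
         \<longleftrightarrow> arrow G n \<theta> \<sigma> lam"
proof -
  let ?W = "wreath G n" and ?Y = "wreath_young G n P" and ?B = "boxes G \<sigma>"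
  interpret comm_group G by fact
  interpret W: group ?W by (rule group_wreath) (rule group_axioms)
  have wt: "wreath_tableau G n \<theta> \<sigma> lam P t" if "t \<in> tableaux G n \<sigma>" for t
    using assms that by (simp add: wreath_tableau_def wreath_tableau_axioms_def comm_group_axioms)
  obtain t where t: "t \<in> tableaux G n \<sigma>" "X = row_class ?B (tableaux G n \<sigma>) t"
    using assms(7) by (auto simp: tabloids_def)
  interpret t: wreath_tableau G n \<theta> \<sigma> lam P t by (rule wt[OF t(1)])
  let ?sum = "\<lambda>X'. \<Sum>y\<in>?Y. if tabloid_act G \<sigma> y X' = X' then t.block_char y else 0"
  let ?arrow = "\<lambda>s. \<exists>\<mu>\<in>par_maps_carrier G n. (\<forall>g\<in>carrier G. \<mu> g \<unlhd>\<^sub>d lam g) \<and>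
      colouring G \<theta> \<sigma> (\<lambda>b. t.block_of (snd (s b))) \<and> arises_from G \<sigma> (\<lambda>b. t.block_of (snd (s b))) \<mu>"
  \<comment> \<open>The value is chosen from the tabloid alone, so it is well defined even though
    the evaluation below goes through a representing tableau.\<close>
  define c where "c X' = (SOME c::nat. ?sum X' = of_nat c)" for X'
  have nat: "?sum (row_class ?B (tableaux G n \<sigma>) s) = of_nat (c (row_class ?B (tableaux G n \<sigma>) s)) \<and>
      (c (row_class ?B (tableaux G n \<sigma>) s) \<noteq> 0 \<longleftrightarrow> ?arrow s)" if s: "s \<in> tableaux G n \<sigma>" for s
  proof -
    interpret s: wreath_tableau G n \<theta> \<sigma> lam P s by (rule wt[OF s])
    obtain k :: nat where k: "?sum s.tabloid = of_nat k" "k \<noteq> 0 \<longleftrightarrow> ?arrow s"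
      using s.sum_young_stabilizer_nat unfolding s.entry_colour_def[abs_def] by blast
    then have "c s.tabloid = k" unfolding c_def by (intro some_equality) simp_all
    then show ?thesis using k by simp
  qed
  have sums: "?sum X' = of_nat (c X')" if "X' \<in> tabloids G n \<sigma>" for X'
    using that nat by (auto simp: tabloids_def)
  have Y: "?Y \<subseteq> carrier ?W" by (auto simp: wreath_young_def)
  have "((\<lambda>i\<in>{1..n}. \<one>\<^bsub>G\<^esub>), id) \<in> ?Y" by (simp add: wreath_young_def wreath_carrier permutes_id)
  \<comment> \<open>Nonemptiness keeps the factor \<open>card ?Y\<close> in the denominator away
    from zero.\<close>
  then have Y0: "?Y \<noteq> {}" by blast
  have "char_inner ?W (perm_char ?W (stabilizer ?W (tabloid_act G \<sigma>) X)) (wreath_char G n \<theta> lam P) \<noteq> 0 \<longleftrightarrow>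
      (\<exists>x\<in>carrier ?W. c (tabloid_act G \<sigma> x X) \<noteq> 0)"
    unfolding wreath_char_def t.block_char_def[symmetric]
    by (rule char_inner_stabilizer[OF comm_group_axioms assms(2,7) Y Y0 sums])
  also have "\<dots> \<longleftrightarrow> (\<exists>x\<in>carrier ?W. ?arrow (compose ?B (entry_act G x) t))"
    using nat tableau_act[OF comm_group_axioms _ t(1)] tabloid_act_row_class[OF comm_group_axioms _ t(1)]
    by (simp add: t(2))
  also have "\<dots> \<longleftrightarrow> arrow G n \<theta> \<sigma> lam"
  proof
    assume "\<exists>x\<in>carrier ?W. ?arrow (compose ?B (entry_act G x) t)"
    \<comment> \<open>The colouring induced by the translated tableau is itself the required
      one.\<close>
    then show "arrow G n \<theta> \<sigma> lam" unfolding arrow_def by blast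
  next
    assume "arrow G n \<theta> \<sigma> lam"
    then obtain \<mu> \<kappa> where \<mu>: "\<mu> \<in> par_maps_carrier G n" "\<forall>g\<in>carrier G. \<mu> g \<unlhd>\<^sub>d lam g"
      and \<kappa>: "colouring G \<theta> \<sigma> \<kappa>" "arises_from G \<sigma> \<kappa> \<mu>" unfolding arrow_def by blast
    \<comment> \<open>A given colouring is replaced by the one induced by a suitable tableau in the
      orbit; they agree on all boxes.\<close>
    obtain x where x: "x \<in> carrier ?W" "\<forall>b\<in>?B. t.block_of (snd (compose ?B (entry_act G x) t b)) = \<kappa> b"
      using t.exists_recolouring[OF \<mu> \<kappa>] by blast
    have "colouring G \<theta> \<sigma> (\<lambda>b. t.block_of (snd (compose ?B (entry_act G x) t b)))"
      using \<kappa>(1) x(2) unfolding colouring_iff by simp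
    moreover have "arises_from G \<sigma> (\<lambda>b. t.block_of (snd (compose ?B (entry_act G x) t b))) \<mu>"
      by (subst arises_from_cong[where \<kappa>' = \<kappa>]) (use \<kappa>(2) x(2) in simp_all)
    ultimately show "\<exists>x\<in>carrier ?W. ?arrow (compose ?B (entry_act G x) t)" using \<mu> x(1) by blast
  qed
  finally show ?thesis .
qed

end
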